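(* Let $F$ be a field of characteristic $2$ and let $\varphi,\psi$ be totally singular quadratic forms over $F$ that are weakly Vishik equivalent. Assume that $\varphi$ is a special quasi-Pfister neighbor given by the triple $(\pi,b,\sigma)$, and that $c\pi\subseteq\psi$ for some $c\in F^*$. Moreover, suppose that $\sigma$ is either a quasi-Pfister form, a quasi-Pfister neighbor of codimension one, or a minimal form over $F$. Then $\varphi$ and $\psi$ are similar.
   Context: A totally singular quadratic form over a field $F$ of characteristic $2$ is a map $\varphi:V\to F$ on a finite-dimensional $F$-vector space $V$ with $\varphi(av)=a^2\varphi(v)$ and $\varphi(v+w)=\varphi(v)+\varphi(w)$; $\dim\varphi=\dim V$. Write $\langle a_1,\dots,a_n\rangle$ for $(x_i)\mapsto\sum a_ix_i^2$ on $F^n$. $\perp$ is the orthogonal sum (concatenation of diagonal coefficients), and $\langle a_1,\dots,a_n\rangle\otimes\psi=a_1\psi\perp\dots\perp a_n\psi$. Isometry $\varphi\simeq\psi$: there is a bijective linear $f$ with $\varphi(v)=\psi(f(v))$; if $f$ is only injective, $\varphi$ is a subform of $\psi$, written $\varphi\subseteq\psi$. Similar: $\varphi\simeq c\psi$ for some $c\in F^*$. Isotropic: vanishing at some nonzero vector; anisotropic otherwise. $\varphi\simeq\varphi_{\mathrm{an}}\perp k\times\langle0\rangle$ with $\varphi_{\mathrm{an}}$ anisotropic; the defect is $\mathfrak{i}_{\mathrm d}(\varphi)=k$. For $E/F$, $\varphi_E$ on $E\otimes_FV$ is given by $\varphi_E(e\otimes v)=e^2\varphi(v)$. Weak Vishik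 equivalence: $\dim\varphi=\dim\psi$ and $\mathfrak{i}_{\mathrm d}(\varphi_{F(\sqrt a)})=\mathfrak{i}_{\mathrm d}(\psi_{F(\sqrt a)})$ for every $a\in F$. An $n$-fold quasi-Pfister form is $\langle\!\langle a_1,\dots,a_n\rangle\!\rangle=\langle1,a_1\rangle\otimes\dots\otimes\langle1,a_n\rangle$ (and $\langle1\rangle$ for $n=0$). $\varphi$ is a quasi-Pfister neighbor (of $\pi$) if $c\varphi\subseteq\pi$ for some $c\in F^*$ and quasi-Pfister form $\pi$ with $\dim\varphi>\frac12\dim\pi$; its codimension is $\dim\pi-\dim\varphi$. $\varphi$ is a special quasi-Pfister neighbor given by the triple $(\pi,b,\sigma)$ if $\varphi$ is similar to $\pi\perp b\sigma$ with $\pi$ a quasi-Pfister form over $F$, $b\in F^*$ and $\sigma\subseteq\pi$. With $D_F^*(\varphi)$ the set of nonzero values of $\varphi$, $N_F(\varphi)=F^2(x/y\mid x,y\in D_F^*(\varphi))$ and $\mathrm{ndeg}_F\varphi=[N_F(\varphi):F^2]$. An anisotropic form $\varphi$ is minimal over $F$ if $\mathrm{ndeg}_F\varphi=2^{\dim\varphi-1}$. *)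

theory Defs
  imports
    "HOL-Algebra.Algebraic_Closure_Type"
    "HOL-Algebra.Generated_Fields"
    "HOL-Algebra.Embedded_Algebras"
    "HOL-Library.Function_Algebras"
    "HOL-Library.Product_Plus"
begin

text \<open>
  The base field \<open>F\<close> is a type \<open>'a\<close> of class \<open>field\<close>; its extensions
  \<open>F(\<surd>a)\<close> are subfields of the type \<open>'a alg_closure\<close>.  Since a subfield is a set and not a
  type, the notions below carry a field of coefficients \<open>K\<close>, a subset of a type \<open>'k\<close>.  For forms
  over \<open>F\<close> itself one takes \<open>'k = 'a\<close> and \<open>K = UNIV\<close>.
\<close>

record ('k, 'v) qform =
  qspace :: "'v set"
  qscale :: "'k \<Rightarrow> 'v \<Rightarrow> 'v"
  qval :: "'v \<Rightarrow> 'k"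

text \<open>
  The underlying \<open>K\<close>-vector space is a \<open>K\<close>-subspace of a \<open>'k\<close>-vector space.  For \<open>K = UNIV\<close> this
  is an arbitrary vector space over the field \<open>'k\<close>.
\<close>

definition ts_qform :: "'k::field set \<Rightarrow> ('k, 'v::ab_group_add) qform \<Rightarrow> bool" where
  "ts_qform K Q \<longleftrightarrow>
     subfield K ring_of_type_algebra \<and>
     vector_space (qscale Q) \<and>
     0 \<in> qspace Q \<and>
     (\<forall>v\<in>qspace Q. \<forall>w\<in>qspace Q. v + w \<in> qspace Q) \<and>
     (\<forall>a\<in>K. \<forall>v\<in>qspace Q. qscale Q a v \<in> qspace Q) \<and>
     (\<exists>B. finite B \<and> B \<subseteq> qspace Q \<and>
        (\<forall>v\<in>qspace Q. \<exists>c. (\<forall>b\<in>B. c b \<in> K) \<and> v = (\<Sum>b\<in>B. qscale Q (c b) b))) \<and>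
     (\<forall>v\<in>qspace Q. qval Q v \<in> K) \<and>
     (\<forall>a\<in>K. \<forall>v\<in>qspace Q. qval Q (qscale Q a v) = a\<^sup>2 * qval Q v) \<and>
     (\<forall>v\<in>qspace Q. \<forall>w\<in>qspace Q. qval Q (v + w) = qval Q v + qval Q w)"

definition linear_over ::
    "'k set \<Rightarrow> ('k, 'v::ab_group_add) qform \<Rightarrow> ('k, 'w::ab_group_add) qform \<Rightarrow> ('v \<Rightarrow> 'w) \<Rightarrow> bool" where
  "linear_over K P Q f \<longleftrightarrow>
     f ` qspace P \<subseteq> qspace Q \<and>
     (\<forall>v\<in>qspace P. \<forall>w\<in>qspace P. f (v + w) = f v + f w) \<and>
     (\<forall>a\<in>K. \<forall>v\<in>qspace P. f (qscale P a v) = qscale Q a (f v))"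

definition isometric ::
    "'k set \<Rightarrow> ('k, 'v::ab_group_add) qform \<Rightarrow> ('k, 'w::ab_group_add) qform \<Rightarrow> bool" where
  "isometric K P Q \<longleftrightarrow>
     (\<exists>f. linear_over K P Q f \<and> bij_betw f (qspace P) (qspace Q) \<and>
          (\<forall>v\<in>qspace P. qval P v = qval Q (f v)))"

definition subform ::
    "'k set \<Rightarrow> ('k, 'v::ab_group_add) qform \<Rightarrow> ('k, 'w::ab_group_add) qform \<Rightarrow> bool" where
  "subform K P Q \<longleftrightarrow>
     (\<exists>f. linear_over K P Q f \<and> inj_on f (qspace P) \<and>
          (\<forall>v\<in>qspace P. qval P v = qval Q (f v)))"

definition scaled :: "'k::field \<Rightarrow> ('k, 'v) qform \<Rightarrow> ('k, 'v) qform" where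
  "scaled c Q = Q\<lparr>qval := \<lambda>v. c * qval Q v\<rparr>"

definition similar ::
    "'k::field set \<Rightarrow> ('k, 'v::ab_group_add) qform \<Rightarrow> ('k, 'w::ab_group_add) qform \<Rightarrow> bool" where
  "similar K P Q \<longleftrightarrow> (\<exists>c\<in>K. c \<noteq> 0 \<and> isometric K P (scaled c Q))"

definition orth_sum :: "('k::field, 'v) qform \<Rightarrow> ('k, 'w) qform \<Rightarrow> ('k, 'v \<times> 'w) qform" where
  "orth_sum P Q =
     \<lparr>qspace = qspace P \<times> qspace Q,
      qscale = (\<lambda>a (v, w). (qscale P a v, qscale Q a w)),
      qval = (\<lambda>(v, w). qval P v + qval Q w)\<rparr>"

text \<open>\<open>\<langle>a\<^sub>1, \<dots>, a\<^sub>n\<rangle>\<close>, with \<open>K\<^sup>n\<close> realised as the sequences in \<open>K\<close> vanishing from index \<open>n\<close> on\<close>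

definition diag :: "'k::field set \<Rightarrow> 'k list \<Rightarrow> ('k, nat \<Rightarrow> 'k) qform" where
  "diag K as =
     \<lparr>qspace = {x. (\<forall>i<length as. x i \<in> K) \<and> (\<forall>i\<ge>length as. x i = 0)},
      qscale = (\<lambda>a x i. a * x i),
      qval = (\<lambda>x. \<Sum>i<length as. as ! i * (x i)\<^sup>2)\<rparr>"

definition anisotropic :: "('k::field, 'v::ab_group_add) qform \<Rightarrow> bool" where
  "anisotropic Q \<longleftrightarrow> (\<forall>v\<in>qspace Q. v \<noteq> 0 \<longrightarrow> qval Q v \<noteq> 0)"

text \<open>The space of the anisotropic part embeds into the one of \<open>Q\<close>, so it may be taken inside the
  same type \<open>'v\<close>.\<close>

definition defect :: "'k::field set \<Rightarrow> ('k, 'v::ab_group_add) qform \<Rightarrow> nat" where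
  "defect K Q =
     (THE k. \<exists>A :: ('k, 'v) qform. ts_qform K A \<and> anisotropic A \<and>
               isometric K Q (orth_sum A (diag K (replicate k 0))))"


text \<open>
  \<open>E \<otimes>\<^sub>F V\<close> for a finite-dimensional \<open>V\<close> is realised inside the \<open>E\<close>-valued functions on the dual
  space of \<open>V\<close>: \<open>e \<otimes> v\<close> is the function \<open>l \<mapsto> e * l v\<close>, and \<open>E \<otimes>\<^sub>F V\<close> consists of the finite sums
  of such functions.  (Linear forms on the subspace \<open>V\<close> extend to the ambient vector space, so one
  may take linear forms on the latter.)
\<close>

definition pure_tensor ::
    "('a::field, 'v::ab_group_add) qform \<Rightarrow> 'a alg_closure \<Rightarrow> 'v \<Rightarrow> ('v \<Rightarrow> 'a) \<Rightarrow> 'a alg_closure" where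
  "pure_tensor Q e v = (\<lambda>l. if Vector_Spaces.linear (qscale Q) (*) l then e * to_ac (l v) else 0)"

definition base_change ::
    "'a alg_closure set \<Rightarrow> ('a::field, 'v::ab_group_add) qform
       \<Rightarrow> ('a alg_closure, ('v \<Rightarrow> 'a) \<Rightarrow> 'a alg_closure) qform" where
  "base_change E Q =
     \<lparr>qspace = {\<Sum>(e, v)\<leftarrow>ts. pure_tensor Q e v | ts. set ts \<subseteq> E \<times> qspace Q},
      qscale = (\<lambda>a t l. a * t l),
      qval = (\<lambda>t. THE q. \<exists>ts. set ts \<subseteq> E \<times> qspace Q \<and>
                 t = (\<Sum>(e, v)\<leftarrow>ts. pure_tensor Q e v) \<and>
                 q = (\<Sum>(e, v)\<leftarrow>ts. e\<^sup>2 * to_ac (qval Q v)))\<rparr>"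

text \<open>The values \<open>e\<^sup>2 * qval Q v\<close> on the pure tensors \<open>e \<otimes> v\<close> are indeed compatible.\<close>

lemma base_change_pure_tensor:
  fixes Q :: "('a::field, 'v::ab_group_add) qform"
  assumes "CHAR('a) = 2" and Q: "ts_qform UNIV Q" and "e \<in> E" and "v \<in> qspace Q"
  shows "pure_tensor Q e v \<in> qspace (base_change E Q)"
    and "qval (base_change E Q) (pure_tensor Q e v) = e\<^sup>2 * to_ac (qval Q v)"
proof -
  interpret V: vector_space "qscale Q" using Q by (simp add: ts_qform_def)
  let ?V = "qspace Q"
  let ?T = "\<lambda>ts. \<Sum>(e, v)\<leftarrow>ts. pure_tensor Q e v"
  let ?q = "\<lambda>ts. \<Sum>(e, v)\<leftarrow>ts. e\<^sup>2 * to_ac (qval Q v)"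
  have subsp: "V.subspace ?V"
    using Q by (auto simp: ts_qform_def V.subspace_def)
  have add: "qval Q (v + w) = qval Q v + qval Q w" if "v \<in> ?V" "w \<in> ?V" for v w
    using Q that by (simp add: ts_qform_def)
  have scale: "qval Q (qscale Q a v) = a\<^sup>2 * qval Q v" if "v \<in> ?V" for a v
    using Q that by (simp add: ts_qform_def)
  obtain B0 where B0: "finite B0" "B0 \<subseteq> ?V"
    "\<forall>v\<in>?V. \<exists>c. v = (\<Sum>b\<in>B0. qscale Q (c b) b)"
    using Q by (auto simp: ts_qform_def)
  have "?V \<subseteq> V.span B0"
  proof
    fix v assume "v \<in> ?V"
    then obtain c where "v = (\<Sum>b\<in>B0. qscale Q (c b) b)" using B0 by blast
    then show "v \<in> V.span B0" by (simp add: V.span_base V.span_scale V.span_sum)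
  qed
  obtain B where B: "B \<subseteq> ?V" "V.independent B" "?V \<subseteq> V.span B"
    using V.maximal_independent_subset[of ?V] by blast
  have finB: "finite B"
    using V.independent_span_bound[OF B0(1) B(2)] B(1) \<open>?V \<subseteq> V.span B0\<close> by blast
  define B' where "B' = V.extend_basis B"
  have B': "V.independent B'" "V.span B' = UNIV" "B \<subseteq> B'"
    using B(2) unfolding B'_def
    by (simp_all add: V.independent_extend_basis V.extend_basis_superset)
  define co where "co b v = V.representation B' v b" for b v
  have lin: "Vector_Spaces.linear (qscale Q) (*) (co b)" for b
    unfolding co_def by (rule V.linear_representation[OF B'(1,2)])
  have rep: "v = (\<Sum>b\<in>B. qscale Q (co b v) b)" if "v \<in> ?V" for v
  proof -
    have "v \<in> V.span B" using that B(3) by blast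
    then have "V.representation B' v = V.representation B v"
      using V.representation_extend[OF B'(1) _ B'(3)] by simp
    then show ?thesis unfolding co_def
      using V.sum_representation_eq[OF B(2) \<open>v \<in> V.span B\<close> finB order_refl] by simp
  qed
  have valsum: "qval Q (\<Sum>b\<in>S. qscale Q (c b) b) = (\<Sum>b\<in>S. (c b)\<^sup>2 * qval Q b) \<and>
      (\<Sum>b\<in>S. qscale Q (c b) b) \<in> ?V" if "finite S" "S \<subseteq> ?V" for S c
    using that
  proof (induction S rule: finite_induct)
    case empty
    have "qval Q (qscale Q 0 0) = 0"
      using scale[OF V.subspace_0[OF subsp], of 0] by simp
    then show ?case using V.subspace_0[OF subsp] by simp
  next
    case (insert x S)
    then show ?case using V.subspace_scale[OF subsp] V.subspace_add[OF subsp] by (simp add: add scale)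
  qed
  have val: "qval Q v = (\<Sum>b\<in>B. (co b v)\<^sup>2 * qval Q b)" if "v \<in> ?V" for v
    using valsum[OF finB B(1), of "\<lambda>b. co b v"] rep[OF that] by simp
  have two: "(2 :: 'a alg_closure) = 0"
    using of_nat_CHAR[where 'a="'a alg_closure"] assms(1) by simp
  have sq: "(x + y)\<^sup>2 = x\<^sup>2 + y\<^sup>2" for x y :: "'a alg_closure"
    by (simp add: power2_sum two)
  have key: "?q ts = (\<Sum>b\<in>B. (?T ts (co b))\<^sup>2 * to_ac (qval Q b))"
    if "set ts \<subseteq> E \<times> ?V" for ts
    using that
  proof (induction ts)
    case (Cons t ts)
    obtain e v where t: "t = (e, v)" by (cases t)
    have "to_ac (qval Q v) = (\<Sum>b\<in>B. (to_ac (co b v))\<^sup>2 * to_ac (qval Q b))"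
      using val[of v] Cons.prems t by (simp add: to_ac_sum)
    then show ?case using Cons t
      by (simp add: pure_tensor_def lin sq sum.distrib sum_distrib_left power_mult_distrib algebra_simps)
  qed simp
  have ev: "set [(e, v)] \<subseteq> E \<times> ?V" "pure_tensor Q e v = ?T [(e, v)]" using assms by simp_all
  then show "pure_tensor Q e v \<in> qspace (base_change E Q)"
    unfolding base_change_def by (simp only: qform.simps) blast
  have "(THE q. \<exists>ts. set ts \<subseteq> E \<times> ?V \<and> pure_tensor Q e v = ?T ts \<and> q = ?q ts) = ?q [(e, v)]"
  proof (rule the_equality)
    show "\<exists>ts. set ts \<subseteq> E \<times> ?V \<and> pure_tensor Q e v = ?T ts \<and> ?q [(e, v)] = ?q ts"
      by (rule exI[of _ "[(e, v)]"]) (use ev in simp)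
    fix q assume "\<exists>ts. set ts \<subseteq> E \<times> ?V \<and> pure_tensor Q e v = ?T ts \<and> q = ?q ts"
    then obtain ts where ts: "set ts \<subseteq> E \<times> ?V" "pure_tensor Q e v = ?T ts" "q = ?q ts" by blast
    show "q = ?q [(e, v)]"
      unfolding ts(3) key[OF ts(1)] key[OF ev(1)] ts(2)[symmetric] ev(2)[symmetric] by (rule refl)
  qed
  then show "qval (base_change E Q) (pure_tensor Q e v) = e\<^sup>2 * to_ac (qval Q v)"
    by (simp add: base_change_def)
qed

definition adjoin_sqrt :: "'a::field \<Rightarrow> 'a alg_closure set" where
  "adjoin_sqrt a = generate_field ring_of_type_algebra (range to_ac \<union> {s. s\<^sup>2 = to_ac a})"


definition qdim :: "('a::field, 'v::ab_group_add) qform \<Rightarrow> nat" where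
  "qdim Q = vector_space.dim (qscale Q) (qspace Q)"

definition weakly_Vishik_equivalent ::
    "('a::field, 'v::ab_group_add) qform \<Rightarrow> ('a, 'w::ab_group_add) qform \<Rightarrow> bool" where
  "weakly_Vishik_equivalent P Q \<longleftrightarrow>
     qdim P = qdim Q \<and>
     (\<forall>a. defect (adjoin_sqrt a) (base_change (adjoin_sqrt a) P) =
          defect (adjoin_sqrt a) (base_change (adjoin_sqrt a) Q))"

text \<open>Coefficients of \<open>\<langle>a\<^sub>1, \<dots>, a\<^sub>m\<rangle> \<otimes> \<langle>b\<^sub>1, \<dots>, b\<^sub>n\<rangle> = a\<^sub>1\<langle>b\<^sub>1, \<dots>, b\<^sub>n\<rangle> \<bottom> \<dots> \<bottom> a\<^sub>m\<langle>b\<^sub>1, \<dots>, b\<^sub>n\<rangle>\<close>\<close>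

definition tensor_coeffs :: "'a::field list \<Rightarrow> 'a list \<Rightarrow> 'a list" where
  "tensor_coeffs as bs = concat (map (\<lambda>a. map (\<lambda>b. a * b) bs) as)"

primrec pfister_coeffs :: "'a::field list \<Rightarrow> 'a list" where
  "pfister_coeffs [] = [1]"
| "pfister_coeffs (a # as) = tensor_coeffs [1, a] (pfister_coeffs as)"

definition pfister_form :: "'a::field list \<Rightarrow> ('a, nat \<Rightarrow> 'a) qform" where
  "pfister_form as = diag UNIV (pfister_coeffs as)"

definition quasi_Pfister :: "('a::field, 'v::ab_group_add) qform \<Rightarrow> bool" where
  "quasi_Pfister Q \<longleftrightarrow> (\<exists>as. isometric UNIV Q (pfister_form as))"

definition quasi_Pfister_neighbor_of ::
    "('a::field, 'v::ab_group_add) qform \<Rightarrow> ('a, 'w::ab_group_add) qform \<Rightarrow> bool" where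
  "quasi_Pfister_neighbor_of P Q \<longleftrightarrow>
     quasi_Pfister Q \<and> (\<exists>c. c \<noteq> 0 \<and> subform UNIV (scaled c P) Q) \<and> 2 * qdim P > qdim Q"

definition quasi_Pfister_neighbor_codim ::
    "nat \<Rightarrow> ('a::field, 'v::ab_group_add) qform \<Rightarrow> bool" where
  "quasi_Pfister_neighbor_codim k P \<longleftrightarrow>
     (\<exists>as. quasi_Pfister_neighbor_of P (pfister_form as) \<and> qdim (pfister_form as) = qdim P + k)"

definition special_quasi_Pfister_neighbor ::
    "('a::field, 'v::ab_group_add) qform \<Rightarrow> ('a, 'p::ab_group_add) qform \<Rightarrow> 'a
       \<Rightarrow> ('a, 's::ab_group_add) qform \<Rightarrow> bool" where
  "special_quasi_Pfister_neighbor Q \<pi> b \<sigma> \<longleftrightarrow>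
     quasi_Pfister \<pi> \<and> b \<noteq> 0 \<and> subform UNIV \<sigma> \<pi> \<and>
     similar UNIV Q (orth_sum \<pi> (scaled b \<sigma>))"

definition nonzero_values :: "('a::field, 'v::ab_group_add) qform \<Rightarrow> 'a set" where
  "nonzero_values Q = qval Q ` qspace Q - {0}"

definition squares :: "'a::field set" where
  "squares = range (\<lambda>x. x\<^sup>2)"

definition norm_field :: "('a::field, 'v::ab_group_add) qform \<Rightarrow> 'a set" where
  "norm_field Q = generate_field ring_of_type_algebra
     (squares \<union> {x / y | x y. x \<in> nonzero_values Q \<and> y \<in> nonzero_values Q})"

definition ndeg :: "('a::field, 'v::ab_group_add) qform \<Rightarrow> nat" where
  "ndeg Q = ring.dim ring_of_type_algebra squares (norm_field Q)"

text \<open>For the zero form \<open>2\<^sup>d\<^sup>i\<^sup>m\<^sup>-\<^sup>1\<close> is \<open>1/2\<close>, so it is not minimal; truncated subtraction would make it so.\<close>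

definition minimal_form :: "('a::field, 'v::ab_group_add) qform \<Rightarrow> bool" where
  "minimal_form Q \<longleftrightarrow> anisotropic Q \<and> qdim Q \<ge> 1 \<and> ndeg Q = 2 ^ (qdim Q - 1)"

end

theory Submission
  imports Defs
begin

text \<open>
  The idea is to forget the forms and to work with their sets of values.  Let \<open>F\<close> act on itself by
  \<open>a \<bullet> x = a\<^sup>2 * x\<close>.  Since a totally singular form is additive, its value set \<open>D\<close> is a
  finite-dimensional subspace of \<open>F\<close> for this action, and a form is determined up to isometry by
  \<open>D\<close> together with its dimension (\<open>isometric_if_value_set_eq\<close>): the vectors of value zero form a
  subspace, and the value map identifies the quotient with \<open>D\<close>.  Similarity amounts to \<open>D\<close> up to a
  factor.

  The same holds over \<open>E = F(\<surd>a)\<close>, where \<open>E\<^sup>2 = F\<^sup>2 + a F\<^sup>2\<close>, so that the value set becomes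
  \<open>D + a D\<close>; its size measures the anisotropic part over \<open>E\<close>, hence the defect
  (\<open>defect_quadratic_extension\<close>).  So weakly Vishik equivalent forms satisfy
  \<open>dim (D + a D) = dim (D' + a D')\<close> for every \<open>a\<close>, and the task is to show that, for the value
  sets at hand, this forces \<open>D' = x D\<close> for some \<open>x \<noteq> 0\<close>.

  Let \<open>P\<close> be the value set of \<open>\<pi>\<close>, a field between \<open>F\<^sup>2\<close> and \<open>F\<close>, and let \<open>S \<subseteq> P\<close> be that of \<open>\<sigma>\<close>.
  After scaling, \<open>\<phi>\<close> has the value set \<open>U = P + b S\<close>, and the value set \<open>W\<close> of \<open>\<psi>\<close> contains
  \<open>P\<close>.  If \<open>b \<in> P\<close>, then \<open>U = P = W\<close> by dimension.  Otherwise, as \<open>b\<^sup>2\<close> is a square,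
  \<open>U + b U\<close> is just \<open>P + b P\<close>.  The hypothesis for \<open>a = b\<close> then confines \<open>W\<close> to \<open>P + b P\<close>, so
  \<open>W = P + b T\<close> with \<open>T \<subseteq> P\<close>, and the hypothesis for \<open>a \<in> P\<close> says that \<open>S\<close> and \<open>T\<close> are
  related in the same way as \<open>U\<close> and \<open>W\<close>.  Thus it is enough to solve the problem for \<open>S\<close>
  (\<open>twisted_sum_similar\<close>).

  If \<open>\<sigma>\<close> is a quasi-Pfister form or a neighbor of codimension one, then \<open>S\<close> is contained in a
  multiple of a field \<open>R\<close>, with codimension at most one.  For every ratio \<open>a\<close> of elements of \<open>S\<close>,
  \<open>S + a S\<close> stays in that multiple of \<open>R\<close>, so \<open>T \<inter> a T\<close> has codimension at most one in \<open>T\<close>;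
  intersecting over the ratios from a basis of \<open>S\<close> leaves room for a nonzero vector, which
  exhibits \<open>T\<close> as a multiple of \<open>S\<close> (\<open>rigid_codim_le_one\<close>).

  If \<open>\<sigma>\<close> is minimal, then \<open>S\<close> has, up to a factor, a basis \<open>1, s\<^sub>1, \<dots>, s\<^sub>d\<close> with
  \<open>s\<^sub>1, \<dots>, s\<^sub>d\<close> independent as generators over \<open>F\<^sup>2\<close>.  The spaces \<open>S\<close> and \<open>T\<close> have the same ratios
  of elements, so \<open>T\<close> is minimal too, and each \<open>s\<^sub>i\<close> is a ratio in \<open>T\<close>; this gives
  planes \<open>x\<^sub>i (F\<^sup>2 + s\<^sub>i F\<^sup>2) \<subseteq> T\<close>, regarded as lines of the projective space of \<open>T\<close>.
  As \<open>s\<^sub>i s\<^sub>j\<close> is a ratio as well, any two of these lines meet (\<open>minimal_space_lines_meet\<close>), and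
  three of them cannot lie in a plane because of the independence of the \<open>s\<^sub>i\<close>.  So they pass through
  a common point \<open>y\<close>, and \<open>T = y S\<close> (\<open>rigid_minimal_space\<close>).
\<close>

section \<open>Finite-dimensional subspaces of arbitrary vector spaces\<close>

text \<open>
  \<open>F\<close> may have infinite degree over \<open>F\<^sup>2\<close>, so the dimension formulas are needed for
  finite-dimensional subspaces of a possibly infinite-dimensional space.
\<close>

definition fin_dim :: "('a::field \<Rightarrow> 'b::ab_group_add \<Rightarrow> 'b) \<Rightarrow> 'b set \<Rightarrow> bool" where
  "fin_dim sc U \<longleftrightarrow> (\<exists>B. finite B \<and> U \<subseteq> module.span sc B)"

context vector_space begin

lemma fin_dim_mono: "fin_dim scale W \<Longrightarrow> U \<subseteq> W \<Longrightarrow> fin_dim scale U"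
  unfolding fin_dim_def by blast

lemma fin_dim_span: "finite B \<Longrightarrow> fin_dim scale (span B)"
  unfolding fin_dim_def by blast

lemma fin_dim_basis:
  assumes "subspace U" "fin_dim scale U"
  obtains B where "finite B" "independent B" "B \<subseteq> U" "span B = U" "card B = dim U"
proof -
  obtain B where B: "B \<subseteq> U" "independent B" "U \<subseteq> span B" "card B = dim U"
    using basis_exists[of U] by blast
  obtain C where C: "finite C" "U \<subseteq> span C" using assms(2) unfolding fin_dim_def by blast
  have "finite B" using independent_span_bound[OF C(1) B(2)] B(1) C(2) by blast
  moreover have "span B = U" using B(1,3) assms(1) by (rule span_subspace)
  ultimately show ?thesis using that B by blast
qed

lemma fin_dim_independent:
  assumes "fin_dim scale U" "independent C" "C \<subseteq> U"
  shows "finite C" and "card C \<le> dim U"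
proof -
  have fd: "fin_dim scale (span U)"
    using assms(1) unfolding fin_dim_def by (meson span_minimal subspace_span)
  obtain B where "finite B" "independent B" "B \<subseteq> span U" "span B = span U" "card B = dim (span U)"
    by (rule fin_dim_basis[OF subspace_span fd])
  then have B: "finite B" "span B = span U" "card B = dim U" by simp_all
  have "C \<subseteq> span B" using assms(3) B(2) span_superset by blast
  then show "finite C" "card C \<le> dim U"
    using independent_span_bound[OF B(1) assms(2)] B(3) by auto
qed

lemma fin_dim_dim_mono:
  assumes "fin_dim scale W" "U \<subseteq> W"
  shows "dim U \<le> dim W"
proof -
  obtain B where B: "B \<subseteq> U" "independent B" "U \<subseteq> span B" "card B = dim U"
    using basis_exists[of U] by blast
  have "card B \<le> dim W"
    using fin_dim_independent(2)[OF assms(1) B(2)] B(1) assms(2) by simp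
  then show ?thesis using B(4) by simp
qed

lemma fin_dim_subspace_eq:
  assumes "fin_dim scale W" "subspace U" "subspace W" "U \<subseteq> W" "dim W \<le> dim U"
  shows "U = W"
proof (rule ccontr)
  assume "U \<noteq> W"
  then obtain y where y: "y \<in> W" "y \<notin> U" using assms(4) by blast
  obtain B where B: "finite B" "independent B" "B \<subseteq> U" "span B = U" "card B = dim U"
    by (rule fin_dim_basis[OF assms(2) fin_dim_mono[OF assms(1,4)]])
  have "independent (insert y B)" using B y by (simp add: independent_insertI)
  then have "card (insert y B) \<le> dim W"
    using fin_dim_independent(2)[OF assms(1)] B(3) assms(4) y by blast
  moreover have "y \<notin> B" using y B(3) by blast
  ultimately show False using B assms(5) by simp
qed

lemma fin_dim_sums:
  assumes "fin_dim scale U" "fin_dim scale W"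
  shows "fin_dim scale {x + y | x y. x \<in> U \<and> y \<in> W}"
proof -
  obtain B C where "finite B" "U \<subseteq> span B" "finite C" "W \<subseteq> span C"
    using assms unfolding fin_dim_def by blast
  then have "finite (B \<union> C) \<and> {x + y | x y. x \<in> U \<and> y \<in> W} \<subseteq> span (B \<union> C)"
    unfolding span_Un by blast
  then show ?thesis unfolding fin_dim_def by blast
qed

lemma fin_dim_dim_eq_0:
  assumes "fin_dim scale U" "subspace U" "dim U = 0"
  shows "U = {0}"
proof -
  have "{0} \<subseteq> U" using subspace_0[OF assms(2)] by simp
  then have "{0} = U"
    using fin_dim_subspace_eq[OF assms(1) subspace_single_0 assms(2)] assms(3) by simp
  then show ?thesis by simp
qed

text \<open>
  A basis of the intersection is extended to bases \<open>C\<close> and \<open>D\<close> of both spaces; the union \<open>C \<union> D\<close>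
  is independent, since a relation puts a vector of \<open>D\<close> into \<open>U \<inter> W\<close> up to other elements of
  \<open>D\<close>.
\<close>

lemma dim_sums_Int_fin:
  assumes U: "subspace U" "fin_dim scale U" and W: "subspace W" "fin_dim scale W"
  shows "dim {x + y | x y. x \<in> U \<and> y \<in> W} + dim (U \<inter> W) = dim U + dim W"
proof -
  obtain B where B: "finite B" "independent B" "B \<subseteq> U \<inter> W" "span B = U \<inter> W" "card B = dim (U \<inter> W)"
    by (rule fin_dim_basis[OF subspace_inter[OF U(1) W(1)] fin_dim_mono[OF U(2) Int_lower1]])
  obtain C where C: "B \<subseteq> C" "C \<subseteq> U" "independent C" "U \<subseteq> span C"
    using maximal_independent_subset_extend[of B U] B by blast
  obtain D where D: "B \<subseteq> D" "D \<subseteq> W" "independent D" "W \<subseteq> span D"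
    using maximal_independent_subset_extend[of B W] B by blast
  have sC: "span C = U" using C(2,4) U(1) by (rule span_subspace)
  have sD: "span D = W" using D(2,4) W(1) by (rule span_subspace)
  have fC: "finite C" using fin_dim_independent(1)[OF U(2) C(3,2)] .
  have fD: "finite D" using fin_dim_independent(1)[OF W(2) D(3,2)] .
  have ind: "independent (C \<union> E)" if "finite E" "E \<subseteq> D - B" for E
    using that
  proof (induction E rule: finite_induct)
    case (insert d E)
    have "d \<notin> span (C \<union> E)"
    proof
      assume "d \<in> span (C \<union> E)"
      then obtain c e where ce: "d = c + e" "c \<in> span C" "e \<in> span E"
        unfolding span_Un by blast
      have dY: "d \<in> W" using insert.prems D by blast
      have "span E \<subseteq> W"
      proof (rule span_minimal)
        show "E \<subseteq> W" using insert.prems D by blast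
      qed (rule W)
      then have eY: "e \<in> W" using ce by blast
      have "c = d - e" using ce by simp
      then have "c \<in> U \<inter> W" using dY eY ce sC subspace_diff[OF W(1)] by blast
      then have "d \<in> span (B \<union> E)" using ce B(4) unfolding span_Un by blast
      moreover have "B \<union> E \<subseteq> D - {d}" using insert D by blast
      ultimately have "d \<in> span (D - {d})" using span_mono by blast
      moreover have "d \<in> D" using insert by blast
      ultimately show False using D(3) unfolding dependent_def by blast
    qed
    then show ?case using insert by (simp add: independent_insertI)
  qed (simp add: C)
  have ind2: "independent (C \<union> (D - B))" by (rule ind) (use fD in auto)
  have CD: "C \<union> (D - B) = C \<union> D" using C(1) by blast
  have disj: "C \<inter> (D - B) = {}"
  proof (rule ccontr)
    assume "C \<inter> (D - B) \<noteq> {}"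
    then obtain d where d: "d \<in> C" "d \<in> D" "d \<notin> B" by blast
    then have "d \<in> span B" using C D B by blast
    moreover have "B \<subseteq> D - {d}" using D(1) d by blast
    ultimately have "d \<in> span (D - {d})" using span_mono by blast
    then show False using d(2) D(3) unfolding dependent_def by blast
  qed
  have "dim {x + y | x y. x \<in> U \<and> y \<in> W} = dim (span (C \<union> (D - B)))"
    unfolding CD span_Un sC sD ..
  also have "\<dots> = card C + card (D - B)"
    using ind2 disj fC fD by (simp add: dim_eq_card_independent card_Un_disjoint)
  also have "card (D - B) = card D - card B"
    using D(1) B(1) by (simp add: card_Diff_subset)
  finally show ?thesis
    using B(5) dim_eq_card_independent[OF C(3)] dim_eq_card_independent[OF D(3)] sC sD
      card_mono[OF fD D(1)] dim_span[of C] dim_span[of D]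
    by simp
qed

end

lemma (in Vector_Spaces.linear) dim_inj_image:
  assumes "inj_on f U" "vs1.subspace U"
  shows "vs2.dim (f ` U) = vs1.dim U"
proof -
  obtain B where B: "B \<subseteq> U" "vs1.independent B" "U \<subseteq> vs1.span B" "card B = vs1.dim U"
    using vs1.basis_exists[of U] by blast
  have s: "vs1.span B = U" using B(1,3) assms(2) by (rule vs1.span_subspace)
  have "vs2.independent (f ` B)"
    using B(2) assms(1) s independent_injective_image by blast
  moreover have "vs2.span (f ` B) = f ` U" using span_image[of B] s by simp
  moreover have "card (f ` B) = card B"
    using card_image inj_on_subset[OF assms(1) B(1)] by blast
  ultimately show ?thesis
    using vs2.dim_eq_card_independent[of "f ` B"] vs2.dim_span[of "f ` B"] B(4) by simp
qed

lemma (in Vector_Spaces.linear) fin_dim_image: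
  assumes "fin_dim s1 U"
  shows "fin_dim s2 (f ` U)"
proof -
  obtain B where "finite B" "U \<subseteq> vs1.span B" using assms unfolding fin_dim_def by auto
  then have "finite (f ` B)" "f ` U \<subseteq> vs2.span (f ` B)" unfolding span_image by blast+
  then show ?thesis unfolding fin_dim_def by blast
qed

section \<open>The field acting on itself through squares\<close>

text \<open>
  With this action a subspace of \<open>F\<close> is an \<open>F\<^sup>2\<close>-subspace, while the scalars form the whole type;
  a totally singular form becomes a linear map.
\<close>

definition sq_scale :: "'a::field \<Rightarrow> 'a \<Rightarrow> 'a" where
  "sq_scale a x = a\<^sup>2 * x"

text \<open>
  The value set \<open>S + a S\<close> over \<open>F(\<surd>a)\<close> of a form with value set \<open>S\<close> over \<open>F\<close>.
\<close>

definition spread :: "'a::field \<Rightarrow> 'a set \<Rightarrow> 'a set" where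
  "spread a S = {x + a * y | x y. x \<in> S \<and> y \<in> S}"

text \<open>
  The intermediate fields of \<open>F / F\<^sup>2\<close>: they are closed under inverses because
  \<open>inverse x = x * (inverse x)\<^sup>2\<close>.
\<close>

definition sq_ring :: "'a::field set \<Rightarrow> bool" where
  "sq_ring R \<longleftrightarrow> squares \<subseteq> R \<and> (\<forall>x\<in>R. \<forall>y\<in>R. x + y \<in> R \<and> x * y \<in> R)"

text \<open>
  \<open>F\<^sup>2(g\<^sub>1, \<dots>, g\<^sub>n)\<close>, which is also the value set of \<open>\<langle>\<langle>g\<^sub>1, \<dots>, g\<^sub>n\<rangle>\<rangle>\<close>.  As \<open>g\<^sup>2\<close> is a square, each
  generator contributes only the powers \<open>1\<close> and \<open>g\<close>, whence the degree is at most \<open>2\<^sup>n\<close>.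
\<close>

primrec sq_adjoin :: "'a::field list \<Rightarrow> 'a set" where
  "sq_adjoin [] = squares"
| "sq_adjoin (g # gs) = spread g (sq_adjoin gs)"

definition value_set :: "('a, 'v) qform \<Rightarrow> 'a set" where
  "value_set Q = qval Q ` qspace Q"

lemma square_in_squares [simp]: "a\<^sup>2 \<in> squares"
  by (simp add: squares_def)

locale char_two =
  fixes F :: "'a::field itself"
  assumes CHAR_eq_2: "CHAR('a) = 2"
begin

lemma two_eq_0 [simp]: "(2::'a) = 0"
  using of_nat_CHAR[where 'a='a] CHAR_eq_2 by simp

lemma add_self [simp]: "x + x = (0::'a)"
  using mult_2[of x] by simp

lemma uminus_eq [simp]: "- x = (x::'a)"
  using add_self[of x] by (metis add_eq_0_iff)

lemma eq_iff_add: "x = y \<longleftrightarrow> x + y = (0::'a)"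
  by (metis add_eq_0_iff uminus_eq)

lemma sq_add: "(x + y)\<^sup>2 = x\<^sup>2 + (y::'a)\<^sup>2"
  by (simp add: power2_sum)

lemma vector_space_sq_scale: "vector_space (sq_scale :: 'a \<Rightarrow> 'a \<Rightarrow> 'a)"
  by unfold_locales (simp_all add: sq_scale_def sq_add algebra_simps power_mult_distrib)

sublocale sq: vector_space "sq_scale :: 'a \<Rightarrow> 'a \<Rightarrow> 'a"
  by (rule vector_space_sq_scale)

abbreviation fd :: "'a set \<Rightarrow> bool" where
  "fd \<equiv> fin_dim sq_scale"

lemma linear_mult: "Vector_Spaces.linear sq_scale sq_scale ((*) (x::'a))"
  unfolding Vector_Spaces.linear_iff using vector_space_sq_scale
  by (simp add: sq_scale_def algebra_simps)

lemma subspace_mult: "sq.subspace S \<Longrightarrow> sq.subspace ((*) x ` S)"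
  using Vector_Spaces.linear.axioms(3)[OF linear_mult] module_hom.subspace_image by blast

lemma dim_mult: "sq.subspace S \<Longrightarrow> x \<noteq> 0 \<Longrightarrow> sq.dim ((*) x ` S) = sq.dim S"
  by (rule linear.dim_inj_image[OF linear_mult]) (simp_all add: inj_on_def)

lemma fd_mult: "fd S \<Longrightarrow> fd ((*) x ` S)"
  by (rule linear.fin_dim_image[OF linear_mult])

lemma mult_image_image: "(*) x ` (*) y ` S = (*) (x * y :: 'a) ` S"
  by (simp add: image_image mult.assoc)

lemma mult_1_image [simp]: "(*) (1::'a) ` S = S"
  by simp

lemma spread_sums: "spread a S = {x + y | x y. x \<in> S \<and> y \<in> (*) a ` S}"
  unfolding spread_def by blast

lemma subspace_spread: "sq.subspace S \<Longrightarrow> sq.subspace (spread a S)"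
  unfolding spread_sums by (intro sq.subspace_sums subspace_mult)

lemma fd_spread: "fd S \<Longrightarrow> fd (spread a S)"
  unfolding spread_sums by (intro sq.fin_dim_sums fd_mult)

lemma subset_spread: "sq.subspace S \<Longrightarrow> S \<subseteq> spread a S"
  unfolding spread_def using sq.subspace_0 by force

lemma spread_mono: "S \<subseteq> T \<Longrightarrow> spread a S \<subseteq> spread a T"
  unfolding spread_def by blast

lemma spread_0 [simp]: "sq.subspace S \<Longrightarrow> spread 0 S = S"
  unfolding spread_def using sq.subspace_0 by force

lemma spread_mult: "spread a ((*) x ` S) = (*) x ` spread a S"
proof -
  have "spread a ((*) x ` S) = {x * y + a * (x * z) | y z. y \<in> S \<and> z \<in> S}"
    unfolding spread_def by blast
  also have "\<dots> = {x * (y + a * z) | y z. y \<in> S \<and> z \<in> S}"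
    by (simp add: algebra_simps)
  finally show ?thesis unfolding spread_def by blast
qed

lemma dim_spread_Int:
  assumes "sq.subspace S" "fd S" "a \<noteq> 0"
  shows "sq.dim (spread a S) + sq.dim (S \<inter> (*) a ` S) = 2 * sq.dim S"
  using sq.dim_sums_Int_fin[OF assms(1,2) subspace_mult[OF assms(1)] fd_mult[OF assms(2)], of a]
    dim_mult[OF assms(1,3)] spread_sums[of a S] by simp

lemma dim_spread_le:
  assumes "sq.subspace S" "fd S"
  shows "sq.dim (spread a S) \<le> 2 * sq.dim S"
  using dim_spread_Int[OF assms, of a] assms by (cases "a = 0") auto

lemma exists_nonzero:
  assumes "sq.subspace S" "sq.dim S > 0"
  shows "\<exists>x\<in>S. x \<noteq> 0"
proof (rule ccontr)
  assume "\<not> ?thesis"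
  then have "S \<subseteq> sq.span {}" by auto
  then show False using sq.dim_le_card[of S "{}"] assms(2) by simp
qed

lemma dim_pos:
  assumes "sq.subspace S" "fd S" "x \<in> S" "x \<noteq> 0"
  shows "sq.dim S > 0"
  using sq.fin_dim_dim_eq_0[OF assms(2,1)] assms by auto

lemma fd_basis_containing:
  assumes "sq.subspace S" "fd S" "E \<subseteq> S" "sq.independent E"
  obtains B where "E \<subseteq> B" "B \<subseteq> S" "finite B" "sq.independent B" "sq.span B = S" "card B = sq.dim S"
proof -
  obtain B where B: "E \<subseteq> B" "B \<subseteq> S" "sq.independent B" "S \<subseteq> sq.span B"
    using sq.maximal_independent_subset_extend[OF assms(3,4)] by blast
  have "sq.span B = S" using B(2,4) assms(1) by (rule sq.span_subspace)
  moreover have "card B = sq.dim S" using B(2,4,3) by (rule sq.basis_card_eq_dim)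
  ultimately show ?thesis using that B sq.fin_dim_independent(1)[OF assms(2) B(3,2)] by blast
qed

lemma subspace_iff:
  "sq.subspace S \<longleftrightarrow> 0 \<in> S \<and> (\<forall>x\<in>S. \<forall>y\<in>S. x + y \<in> S) \<and> (\<forall>a. \<forall>x\<in>S. a\<^sup>2 * x \<in> S)"
  unfolding sq.subspace_def sq_scale_def by blast

lemma square_mult_subspace: "sq.subspace S \<Longrightarrow> x \<in> S \<Longrightarrow> a\<^sup>2 * x \<in> S"
  unfolding subspace_iff by blast

lemma sq_ring_0: "sq_ring R \<Longrightarrow> (0::'a) \<in> R"
  unfolding sq_ring_def using square_in_squares[of 0] by auto

lemma sq_ring_1: "sq_ring R \<Longrightarrow> (1::'a) \<in> R"
  unfolding sq_ring_def using square_in_squares[of 1] by auto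

lemma sq_ring_square: "sq_ring R \<Longrightarrow> (x::'a)\<^sup>2 \<in> R"
  unfolding sq_ring_def by auto

lemma sq_ring_add: "sq_ring R \<Longrightarrow> x \<in> R \<Longrightarrow> y \<in> R \<Longrightarrow> x + (y::'a) \<in> R"
  unfolding sq_ring_def by auto

lemma sq_ring_mult: "sq_ring R \<Longrightarrow> x \<in> R \<Longrightarrow> y \<in> R \<Longrightarrow> x * (y::'a) \<in> R"
  unfolding sq_ring_def by auto

lemma sq_ring_inverse:
  assumes "sq_ring R" "x \<in> R"
  shows "inverse (x::'a) \<in> R"
proof -
  have "inverse x = x * (inverse x)\<^sup>2"
    by (cases "x = 0") (simp_all add: power2_eq_square field_simps)
  then show ?thesis using assms sq_ring_mult sq_ring_square by metis
qed

lemma sq_ring_divide: "sq_ring R \<Longrightarrow> x \<in> R \<Longrightarrow> y \<in> R \<Longrightarrow> x / (y::'a) \<in> R"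
  unfolding divide_inverse by (intro sq_ring_mult sq_ring_inverse)

lemmas sq_ring_intros = sq_ring_add sq_ring_mult sq_ring_divide sq_ring_inverse
  sq_ring_square sq_ring_0 sq_ring_1

lemma subspace_sq_ring: "sq_ring R \<Longrightarrow> sq.subspace R"
  unfolding subspace_iff by (auto intro: sq_ring_intros)

lemma sq_ring_spread:
  assumes "sq_ring R"
  shows "sq_ring (spread (a::'a) R)"
  unfolding sq_ring_def
proof (intro conjI ballI)
  show "squares \<subseteq> spread a R"
    using assms subset_spread[OF subspace_sq_ring[OF assms]] unfolding sq_ring_def by blast
next
  fix x y assume xy: "x \<in> spread a R" "y \<in> spread a R"
  then show "x + y \<in> spread a R"
    using subspace_spread[OF subspace_sq_ring[OF assms]] sq.subspace_add by blast
  obtain p q r s where pq: "x = p + a * q" "y = r + a * s" "p \<in> R" "q \<in> R" "r \<in> R" "s \<in> R"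
    using xy unfolding spread_def by blast
  have "x * y = (p * r + a\<^sup>2 * (q * s)) + a * (p * s + q * r)"
    unfolding pq by (simp add: algebra_simps power2_eq_square)
  moreover have "p * r + a\<^sup>2 * (q * s) \<in> R" "p * s + q * r \<in> R"
    using pq assms by (auto intro!: sq_ring_intros)
  ultimately show "x * y \<in> spread a R" unfolding spread_def by blast
qed

lemma sq_ring_squares: "sq_ring (squares :: 'a set)"
  unfolding sq_ring_def squares_def
  by (auto simp flip: sq_add power_mult_distrib)

lemma sq_ring_adjoin: "sq_ring (sq_adjoin (gs :: 'a list))"
  by (induction gs) (simp_all add: sq_ring_squares sq_ring_spread)

lemma subspace_adjoin: "sq.subspace (sq_adjoin gs)"
  by (rule subspace_sq_ring[OF sq_ring_adjoin])

lemma squares_eq_span: "squares = sq.span {1}"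
  unfolding sq.span_singleton squares_def sq_scale_def by auto

lemma fd_adjoin: "fd (sq_adjoin gs)"
  by (induction gs) (simp_all add: fd_spread squares_eq_span sq.fin_dim_span)

lemma dim_adjoin_le: "sq.dim (sq_adjoin gs) \<le> 2 ^ length gs"
proof (induction gs)
  case Nil
  show ?case using sq.dim_le_card[of "squares" "{1}"] by (simp add: squares_eq_span)
next
  case (Cons g gs)
  then show ?case using dim_spread_le[OF subspace_adjoin fd_adjoin, of g gs] by simp
qed

lemma adjoin_generator: "g \<in> set gs \<Longrightarrow> g \<in> sq_adjoin (gs :: 'a list)"
proof (induction gs)
  case (Cons h gs)
  have "h = 0 + h * 1" by simp
  then have "h \<in> spread h (sq_adjoin gs)"
    unfolding spread_def using sq_ring_0 sq_ring_1 sq_ring_adjoin by blast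
  then show ?case
    using Cons subset_spread[OF subspace_adjoin, of gs h] by auto
qed simp

lemma adjoin_minimal:
  "sq_ring R \<Longrightarrow> set gs \<subseteq> R \<Longrightarrow> sq_adjoin (gs :: 'a list) \<subseteq> R"
proof (induction gs)
  case (Cons g gs)
  then show ?case by (auto simp: spread_def subset_iff intro!: sq_ring_add sq_ring_mult)
qed (auto simp: sq_ring_def)

lemma adjoin_mono: "set gs \<subseteq> set hs \<Longrightarrow> sq_adjoin gs \<subseteq> sq_adjoin (hs :: 'a list)"
  using adjoin_minimal[OF sq_ring_adjoin, of gs hs] adjoin_generator by blast

text \<open>
  An element outside of a field is linearly independent of \<open>1\<close> over it.
\<close>

lemma sq_ring_direct:
  assumes "sq_ring R" "s \<notin> R" "u \<in> R" "v \<in> R" "v + s * u = (0::'a)"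
  shows "u = 0" "v = 0"
proof -
  show "u = 0"
  proof (rule ccontr)
    assume "u \<noteq> 0"
    moreover have "s * u = v" using assms(5) eq_iff_add[of "s * u" v] by (simp add: add.commute)
    ultimately have "s = v / u" by (simp add: eq_divide_eq)
    then show False using assms by (auto intro: sq_ring_intros)
  qed
  then show "v = 0" using assms by simp
qed

section \<open>Subspaces determined by the dimensions of their spreads\<close>

text \<open>
  What weak Vishik equivalence says about the value sets.
\<close>

definition spread_equivalent :: "'a set \<Rightarrow> 'a set \<Rightarrow> bool" where
  "spread_equivalent S T \<longleftrightarrow>
     sq.subspace S \<and> fd S \<and> sq.subspace T \<and> fd T \<and>
     (\<forall>a. sq.dim (spread a S) = sq.dim (spread a T))"

text \<open>
  The property that has to be established for the value set of \<open>\<sigma>\<close>.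
\<close>

definition rigid :: "'a set \<Rightarrow> bool" where
  "rigid S \<longleftrightarrow> (\<forall>T. spread_equivalent S T \<longrightarrow> (\<exists>x. x \<noteq> 0 \<and> T = (*) x ` S))"

lemma spread_equivalent_sym: "spread_equivalent S T \<Longrightarrow> spread_equivalent T S"
  unfolding spread_equivalent_def by auto

lemma spread_equivalent_dim:
  assumes "spread_equivalent S T"
  shows "sq.dim S = sq.dim T"
proof -
  have "sq.dim (spread 0 S) = sq.dim (spread 0 T)"
    using assms unfolding spread_equivalent_def by blast
  then show ?thesis using assms unfolding spread_equivalent_def by simp
qed

lemma spread_equivalent_dim_Int:
  assumes "spread_equivalent S T" "a \<noteq> 0"
  shows "sq.dim (S \<inter> (*) a ` S) = sq.dim (T \<inter> (*) a ` T)"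
proof -
  have "sq.dim (spread a S) + sq.dim (S \<inter> (*) a ` S) = 2 * sq.dim S"
    "sq.dim (spread a T) + sq.dim (T \<inter> (*) a ` T) = 2 * sq.dim T"
    using assms dim_spread_Int unfolding spread_equivalent_def by blast+
  moreover have "sq.dim (spread a S) = sq.dim (spread a T)"
    using assms unfolding spread_equivalent_def by blast
  ultimately show ?thesis using spread_equivalent_dim[OF assms(1)] by simp
qed

lemma spread_equivalent_mult:
  assumes "spread_equivalent S T" "x \<noteq> 0"
  shows "spread_equivalent ((*) x ` S) T"
  using assms unfolding spread_equivalent_def spread_mult
  by (simp add: subspace_mult fd_mult dim_mult subspace_spread)

lemma rigid_if_multiple_rigid:
  assumes "x \<noteq> 0" "rigid ((*) x ` S)"
  shows "rigid S"
  unfolding rigid_def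
proof (intro allI impI)
  fix T assume "spread_equivalent S T"
  then obtain y where "y \<noteq> 0" "T = (*) y ` (*) x ` S"
    using assms spread_equivalent_mult unfolding rigid_def by blast
  then show "\<exists>x. x \<noteq> 0 \<and> T = (*) x ` S"
    using assms(1) mult_image_image by (intro exI[of _ "y * x"]) simp
qed

lemma in_mult_image_iff: "a \<noteq> 0 \<Longrightarrow> x \<in> (*) a ` S \<longleftrightarrow> x / a \<in> (S :: 'a set)"
  by (auto simp: image_iff field_simps intro: bexI[of _ "x / a"])

text \<open>
  Each of the subspaces is at most a hyperplane of \<open>T\<close>, so each intersection loses at most one
  dimension.
\<close>

lemma dim_Inter_hyperplanes:
  assumes T: "sq.subspace T" "fd T" and "finite I"
    and H: "\<And>i. i \<in> I \<Longrightarrow> sq.subspace (H i) \<and> H i \<subseteq> T \<and> sq.dim T \<le> sq.dim (H i) + 1"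
  shows "sq.subspace (T \<inter> \<Inter>(H ` I)) \<and> sq.dim T \<le> sq.dim (T \<inter> \<Inter>(H ` I)) + card I"
  using assms(3) H
proof (induction I rule: finite_induct)
  case (insert i I)
  define U where "U = T \<inter> \<Inter>(H ` I)"
  have U: "sq.subspace U" "sq.dim T \<le> sq.dim U + card I" "U \<subseteq> T"
    using insert unfolding U_def by auto
  have Hi: "sq.subspace (H i)" "H i \<subseteq> T" "sq.dim T \<le> sq.dim (H i) + 1" using insert.prems by auto
  have eq: "T \<inter> \<Inter>(H ` insert i I) = U \<inter> H i" using Hi(2) unfolding U_def by auto
  have "sq.dim {x + y | x y. x \<in> U \<and> y \<in> H i} \<le> sq.dim T"
    by (rule sq.fin_dim_dim_mono[OF T(2)]) (use U Hi T sq.subspace_add in blast)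
  moreover have "sq.dim {x + y | x y. x \<in> U \<and> y \<in> H i} + sq.dim (U \<inter> H i) = sq.dim U + sq.dim (H i)"
    using sq.dim_sums_Int_fin[OF U(1) sq.fin_dim_mono[OF T(2) U(3)] Hi(1) sq.fin_dim_mono[OF T(2) Hi(2)]] .
  ultimately show ?case
    unfolding eq using U Hi insert.hyps sq.subspace_inter[OF U(1) Hi(1)] by simp
qed (use T in simp)

text \<open>
  For a ratio \<open>a\<close> of elements of \<open>S\<close>, the spread \<open>S + a S\<close> stays in \<open>c R\<close> and so exceeds \<open>S\<close> by at
  most one dimension.  Hence \<open>T \<inter> a T\<close> is at most a hyperplane of \<open>T\<close>.  Fix \<open>s\<close> in a
  basis of \<open>S\<close>.  The other basis elements \<open>e\<close> give only \<open>dim T - 1\<close> hyperplanes \<open>T \<inter> (s / e) T\<close>,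
  so these have a nonzero vector \<open>u\<close> in common; then \<open>(u / s) e \<in> T\<close> for all \<open>e\<close>.
\<close>

lemma rigid_codim_le_one:
  assumes R: "sq_ring R" "fd R" and S: "sq.subspace S" "S \<subseteq> (*) c ` R" "c \<noteq> 0"
    and codim: "sq.dim R \<le> sq.dim S + 1"
  shows "rigid S"
  unfolding rigid_def
proof (intro allI impI)
  fix T assume eqv: "spread_equivalent S T"
  have T: "sq.subspace T" "fd T" "fd S" using eqv unfolding spread_equivalent_def by auto
  have dim: "sq.dim S = sq.dim T" by (rule spread_equivalent_dim[OF eqv])
  show "\<exists>x. x \<noteq> 0 \<and> T = (*) x ` S"
  proof (cases "sq.dim S = 0")
    case True
    then have "S = {0}" "T = {0}" using sq.fin_dim_dim_eq_0 S(1) T dim by auto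
    then show ?thesis by (intro exI[of _ 1]) simp
  next
    case False
    then obtain s where s: "s \<in> S" "s \<noteq> 0" using exists_nonzero[OF S(1)] by auto
    obtain B where B: "{s} \<subseteq> B" "B \<subseteq> S" "finite B" "sq.independent B" "sq.span B = S" "card B = sq.dim S"
      by (rule fd_basis_containing[OF S(1) T(3), of "{s}"]) (use s in auto)
    define H where "H e = T \<inter> (*) (s / e) ` T" for e
    have cod: "sq.subspace (H e) \<and> H e \<subseteq> T \<and> sq.dim T \<le> sq.dim (H e) + 1" if e: "e \<in> B - {s}" for e
    proof -
      have e0: "e \<noteq> 0" "e \<in> S" using e B sq.dependent_zero by auto
      define a where "a = s / e"
      have a: "a \<noteq> 0" using e0 s unfolding a_def by simp
      have "a = (s / c) / (e / c)" unfolding a_def using S(3) by simp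
      moreover have "s / c \<in> R" "e / c \<in> R" using S(2) s(1) e0(2) in_mult_image_iff[OF S(3)] by auto
      ultimately have aR: "a \<in> R" using sq_ring_divide[OF R(1)] by metis
      have "spread a S \<subseteq> (*) c ` R"
      proof
        fix x assume "x \<in> spread a S"
        then obtain y z where yz: "y \<in> S" "z \<in> S" "x = y + a * z" unfolding spread_def by blast
        then have "y / c \<in> R" "z / c \<in> R" using S(2) in_mult_image_iff[OF S(3)] by auto
        moreover have "x / c = y / c + a * (z / c)" using yz(3) by (simp add: add_divide_distrib)
        moreover have "y / c + a * (z / c) \<in> R"
          using calculation(1,2) by (intro sq_ring_add sq_ring_mult R(1) aR)
        ultimately have "x / c \<in> R" by simp
        then show "x \<in> (*) c ` R" using in_mult_image_iff[OF S(3)] by blast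
      qed
      then have "sq.dim (spread a S) \<le> sq.dim R"
        using sq.fin_dim_dim_mono[OF fd_mult[OF R(2)]] dim_mult[OF subspace_sq_ring[OF R(1)] S(3)] by metis
      then have "sq.dim S \<le> sq.dim (S \<inter> (*) a ` S) + 1"
        using dim_spread_Int[OF S(1) T(3) a] codim by simp
      then have "sq.dim T \<le> sq.dim (H e) + 1"
        using spread_equivalent_dim_Int[OF eqv a] dim unfolding H_def a_def by simp
      moreover have "sq.subspace (H e)" "H e \<subseteq> T"
        unfolding H_def by (intro sq.subspace_inter T(1) subspace_mult, rule Int_lower1)
      ultimately show ?thesis by blast
    qed
    define U where "U = T \<inter> \<Inter>(H ` (B - {s}))"
    have "finite (B - {s})" using B by simp
    then have U: "sq.subspace U" "sq.dim T \<le> sq.dim U + card (B - {s})"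
      unfolding U_def using dim_Inter_hyperplanes[OF T(1,2), of "B - {s}" H] cod by blast+
    have "card (B - {s}) + 1 = sq.dim T"
      using B dim by (metis Suc_eq_plus1 card_Suc_Diff1 insert_subset)
    then have "sq.dim U > 0" using U(2) by simp
    then obtain u where u: "u \<in> U" "u \<noteq> 0" using exists_nonzero[OF U(1)] by blast
    define x where "x = u / s"
    have x: "x \<noteq> 0" using u s unfolding x_def by simp
    have "(*) x ` B \<subseteq> T"
    proof (rule image_subsetI)
      fix e assume e: "e \<in> B"
      show "x * e \<in> T"
      proof (cases "e = s")
        case True then show ?thesis using u s unfolding x_def U_def by simp
      next
        case False
        then have "u \<in> H e" "e \<noteq> 0" using u e B sq.dependent_zero unfolding U_def by auto
        then have "u / (s / e) \<in> T" using in_mult_image_iff[of "s / e" u T] s unfolding H_def by simp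
        then show ?thesis unfolding x_def by (simp add: field_simps)
      qed
    qed
    then have "sq.span ((*) x ` B) \<subseteq> T" using T(1) by (rule sq.span_minimal)
    moreover have "sq.span ((*) x ` B) = (*) x ` S"
      using Vector_Spaces.linear.axioms(3)[OF linear_mult] module_hom.span_image B(5) by metis
    ultimately have "(*) x ` S \<subseteq> T" by simp
    then have "(*) x ` S = T"
      using sq.fin_dim_subspace_eq[OF T(2) subspace_mult[OF S(1)] T(1)] dim_mult[OF S(1) x] dim by simp
    then show ?thesis using x by blast
  qed
qed

text \<open>
  The value set of \<open>\<pi> \<bottom> b \<sigma>\<close> if \<open>P\<close> and \<open>S\<close> are those of \<open>\<pi>\<close> and \<open>\<sigma>\<close>.
\<close>

definition twisted_sum :: "'a set \<Rightarrow> 'a \<Rightarrow> 'a set \<Rightarrow> 'a set" where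
  "twisted_sum P b S = {p + b * s | p s. p \<in> P \<and> s \<in> S}"

lemma twisted_sum_sums: "twisted_sum P b S = {p + y | p y. p \<in> P \<and> y \<in> (*) b ` S}"
  unfolding twisted_sum_def by blast

lemma subspace_twisted_sum: "sq.subspace P \<Longrightarrow> sq.subspace S \<Longrightarrow> sq.subspace (twisted_sum P b S)"
  unfolding twisted_sum_sums by (intro sq.subspace_sums subspace_mult)

lemma dim_twisted_sum:
  assumes P: "sq_ring P" "fd P" and b: "b \<notin> P" and S: "sq.subspace S" "S \<subseteq> P"
  shows "sq.dim (twisted_sum P b S) = sq.dim P + sq.dim S"
proof -
  have b0: "b \<noteq> 0" using b sq_ring_0[OF P(1)] by blast
  have "P \<inter> (*) b ` S \<subseteq> {0}"
  proof
    fix x assume "x \<in> P \<inter> (*) b ` S"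
    then obtain s where s: "s \<in> S" "x = b * s" "x \<in> P" by blast
    have "s = 0" by (rule sq_ring_direct(1)[OF P(1) b, of s x]) (use s S in auto)
    then show "x \<in> {0}" using s by simp
  qed
  then have "P \<inter> (*) b ` S = {0}"
    using sq_ring_0[OF P(1)] sq.subspace_0[OF subspace_mult[OF S(1)]] by blast
  moreover have "sq.dim {0} = 0" using sq.dim_le_card[of "{0}" "{}"] by simp
  ultimately show ?thesis
    using sq.dim_sums_Int_fin[OF subspace_sq_ring[OF P(1)] P(2) subspace_mult[OF S(1)] fd_mult[OF sq.fin_dim_mono[OF P(2) S(2)]], of b]
      dim_mult[OF S(1) b0]
    unfolding twisted_sum_sums by simp
qed

text \<open>
  Multiplication by \<open>a \<in> P\<close> preserves \<open>P\<close>, so spreading only affects the second summand.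
\<close>

lemma spread_twisted_sum:
  assumes P: "sq_ring P" and S: "sq.subspace S" and a: "a \<in> P"
  shows "spread a (twisted_sum P b S) = twisted_sum P b (spread a S)"
proof
  show "spread a (twisted_sum P b S) \<subseteq> twisted_sum P b (spread a S)"
  proof
    fix x assume "x \<in> spread a (twisted_sum P b S)"
    then obtain u v where uv: "x = u + a * v" "u \<in> twisted_sum P b S" "v \<in> twisted_sum P b S"
      unfolding spread_def by blast
    obtain p s where ps: "u = p + b * s" "p \<in> P" "s \<in> S" using uv(2) unfolding twisted_sum_def by blast
    obtain q t where qt: "v = q + b * t" "q \<in> P" "t \<in> S" using uv(3) unfolding twisted_sum_def by blast
    have *: "x = (p + b * s) + a * (q + b * t)" "p \<in> P" "q \<in> P" "s \<in> S" "t \<in> S"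
      using uv ps qt by simp_all
    have "x = (p + a * q) + b * (s + a * t)" using * by (simp add: algebra_simps)
    moreover have "p + a * q \<in> P" using * a P by (auto intro: sq_ring_intros)
    moreover have "s + a * t \<in> spread a S" using * unfolding spread_def by blast
    ultimately show "x \<in> twisted_sum P b (spread a S)" unfolding twisted_sum_def by blast
  qed
  show "twisted_sum P b (spread a S) \<subseteq> spread a (twisted_sum P b S)"
  proof
    fix x assume "x \<in> twisted_sum P b (spread a S)"
    then obtain p s t where *: "x = p + b * (s + a * t)" "p \<in> P" "s \<in> S" "t \<in> S"
      unfolding spread_def twisted_sum_def by blast
    have "x = (p + b * s) + a * (0 + b * t)" using * by (simp add: algebra_simps)
    moreover have "p + b * s \<in> twisted_sum P b S" "0 + b * t \<in> twisted_sum P b S"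
      using * sq_ring_0[OF P] unfolding twisted_sum_def by blast+
    ultimately show "x \<in> spread a (twisted_sum P b S)" unfolding spread_def by blast
  qed
qed

lemma spread_subset_sq_ring:
  "sq_ring P \<Longrightarrow> S \<subseteq> P \<Longrightarrow> (a::'a) \<in> P \<Longrightarrow> spread a S \<subseteq> P"
  unfolding spread_def by (auto simp: subset_iff intro!: sq_ring_add sq_ring_mult)

text \<open>
  Outside of \<open>P\<close> the spreads of subspaces of \<open>P\<close> carry no information beyond their dimension.
\<close>

lemma dim_spread_outside:
  assumes P: "sq_ring P" and S: "sq.subspace S" "fd S" "S \<subseteq> P" and a: "a \<notin> P"
  shows "sq.dim (spread a S) = 2 * sq.dim S"
proof -
  have a0: "a \<noteq> 0" using a sq_ring_0[OF P] by blast
  have "S \<inter> (*) a ` S \<subseteq> {0}"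
  proof
    fix x assume "x \<in> S \<inter> (*) a ` S"
    then obtain s where s: "s \<in> S" "x = a * s" "x \<in> S" by blast
    have "s = 0" by (rule sq_ring_direct(1)[OF P a, of s x]) (use s S in auto)
    then show "x \<in> {0}" using s by simp
  qed
  then have "sq.dim (S \<inter> (*) a ` S) = 0" using sq.dim_le_card[of "S \<inter> (*) a ` S" "{}"] by simp
  then show ?thesis using dim_spread_Int[OF S(1,2) a0] by simp
qed

text \<open>
  Let \<open>b \<notin> P\<close>.  Spreading \<open>P + b S\<close> by \<open>b\<close> itself yields only \<open>P + b P\<close>, because \<open>b\<^sup>2\<close> is a
  square.  The spread of \<open>W\<close> by \<open>b\<close> contains \<open>P + b P\<close> and has the same dimension, so
  \<open>W \<subseteq> P + b P\<close>, that is, \<open>W = P + b T\<close> with \<open>T \<subseteq> P\<close>.  Comparing the spreads for \<open>a \<in> P\<close> shows that \<open>S\<close> and \<open>T\<close> are spread-equivalent.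
  The factor \<open>x\<close> with \<open>T = x S\<close> is a ratio of elements of \<open>P\<close>, so it preserves \<open>P\<close>.
\<close>

theorem twisted_sum_similar:
  assumes P: "sq_ring P" "fd P" and S: "sq.subspace S" "S \<subseteq> P" "rigid S"
    and eqv: "spread_equivalent (twisted_sum P b S) W" and PW: "P \<subseteq> W"
  shows "\<exists>t. t \<noteq> 0 \<and> W = (*) t ` twisted_sum P b S"
proof (cases "b \<in> P")
  case True
  have W: "sq.subspace W" "fd W" using eqv unfolding spread_equivalent_def by auto
  have "twisted_sum P b S \<subseteq> P" unfolding twisted_sum_def
    using True S(2) P(1) by (auto simp: subset_iff intro!: sq_ring_add sq_ring_mult)
  moreover have "P \<subseteq> twisted_sum P b S"
    unfolding twisted_sum_def using sq.subspace_0[OF S(1)] by force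
  ultimately have U: "twisted_sum P b S = P" by blast
  then have "P = W"
    using sq.fin_dim_subspace_eq[OF W(2) subspace_sq_ring[OF P(1)] W(1) PW] spread_equivalent_dim[OF eqv] by simp
  then show ?thesis unfolding U by (intro exI[of _ 1]) simp
next
  case b: False
  define U where "U = twisted_sum P b S"
  have W: "sq.subspace W" "fd W" using eqv unfolding spread_equivalent_def by auto
  have sP: "sq.subspace P" by (rule subspace_sq_ring[OF P(1)])
  have fS: "fd S" using sq.fin_dim_mono[OF P(2) S(2)] .
  have sU: "sq.subspace U" unfolding U_def by (rule subspace_twisted_sum[OF sP S(1)])
  have PU: "P \<subseteq> U" unfolding U_def twisted_sum_def using sq.subspace_0[OF S(1)] by force
  have "spread b U = spread b P"
  proof
    show "spread b P \<subseteq> spread b U" by (rule spread_mono[OF PU])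
    show "spread b U \<subseteq> spread b P"
    proof
      fix x assume "x \<in> spread b U"
      then obtain u v where uv: "x = u + b * v" "u \<in> U" "v \<in> U"
        unfolding spread_def by blast
      obtain p s where ps: "u = p + b * s" "p \<in> P" "s \<in> S"
        using uv(2) unfolding U_def twisted_sum_def by blast
      obtain q t where qt: "v = q + b * t" "q \<in> P" "t \<in> S"
        using uv(3) unfolding U_def twisted_sum_def by blast
      have *: "x = (p + b * s) + b * (q + b * t)" "p \<in> P" "q \<in> P" "s \<in> S" "t \<in> S"
        using uv ps qt by simp_all
      have "x = (p + b\<^sup>2 * t) + b * (s + q)" using * by (simp add: algebra_simps power2_eq_square)
      moreover have "p + b\<^sup>2 * t \<in> P" "s + q \<in> P" using * S(2) P(1)
        by (auto simp: subset_iff intro!: sq_ring_add square_mult_subspace[OF sP])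
      ultimately show "x \<in> spread b P" unfolding spread_def by blast
    qed
  qed
  then have "sq.dim (spread b W) = sq.dim (spread b P)"
    using eqv unfolding spread_equivalent_def U_def by metis
  then have "spread b P = spread b W"
    using sq.fin_dim_subspace_eq[OF fd_spread[OF W(2)] subspace_spread[OF sP] subspace_spread[OF W(1)] spread_mono[OF PW]] by simp
  then have WP: "W \<subseteq> spread b P" using subset_spread[OF W(1), of b] by simp
  define T where "T = {t \<in> P. b * t \<in> W}"
  have T: "sq.subspace T" "T \<subseteq> P"
  proof -
    show "sq.subspace T"
      using sP W(1) unfolding subspace_iff T_def by (auto simp: distrib_left mult.left_commute[of b])
  qed (auto simp: T_def)
  have fT: "fd T" using sq.fin_dim_mono[OF P(2) T(2)] .
  have WT: "W = twisted_sum P b T"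
  proof
    show "W \<subseteq> twisted_sum P b T"
    proof
      fix w assume w: "w \<in> W"
      then obtain p q where pq: "w = p + b * q" "p \<in> P" "q \<in> P" using WP unfolding spread_def by blast
      have "w - p \<in> W" using w pq PW by (intro sq.subspace_diff[OF W(1)]) auto
      moreover have "b * q = w - p" using pq by simp
      ultimately have "b * q \<in> W" by metis
      then show "w \<in> twisted_sum P b T" using pq unfolding twisted_sum_def T_def by blast
    qed
    show "twisted_sum P b T \<subseteq> W"
      unfolding twisted_sum_def T_def using PW sq.subspace_add[OF W(1)] by auto
  qed
  have inP: "sq.dim (spread a S) = sq.dim (spread a T)" if a: "a \<in> P" for a
  proof -
    have "sq.dim (twisted_sum P b (spread a S)) = sq.dim (twisted_sum P b (spread a T))"
      using eqv spread_twisted_sum[OF P(1) S(1) a] spread_twisted_sum[OF P(1) T(1) a]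
      unfolding spread_equivalent_def WT by metis
    then show ?thesis
      using dim_twisted_sum[OF P b subspace_spread[OF S(1)] spread_subset_sq_ring[OF P(1) S(2) a]]
        dim_twisted_sum[OF P b subspace_spread[OF T(1)] spread_subset_sq_ring[OF P(1) T(2) a]] by simp
  qed
  have dimST: "sq.dim S = sq.dim T" using inP[OF sq_ring_0[OF P(1)]] S(1) T(1) by simp
  have "spread_equivalent S T"
    unfolding spread_equivalent_def
  proof (intro conjI allI)
    fix a show "sq.dim (spread a S) = sq.dim (spread a T)"
    proof (cases "a \<in> P")
      case False
      then show ?thesis
        using dim_spread_outside[OF P(1) S(1) fS S(2)] dim_spread_outside[OF P(1) T(1) fT T(2)] dimST by simp
    qed (rule inP)
  qed (use S T fS fT in auto)
  then obtain x where x: "x \<noteq> 0" "T = (*) x ` S" using S(3) unfolding rigid_def by blast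
  show ?thesis
  proof (cases "S = {0}")
    case True
    then have "T = S" using x by simp
    then show ?thesis unfolding WT by (intro exI[of _ 1]) simp
  next
    case False
    then obtain s where s: "s \<in> S" "s \<noteq> 0" using sq.subspace_0[OF S(1)] by blast
    \<comment> \<open>The factor lies in \<open>P\<close>, hence \<open>x P = P\<close>.\<close>
    then have "x * s \<in> P" "s \<in> P" using x T(2) S(2) by auto
    then have "(x * s) / s \<in> P" by (intro sq_ring_divide[OF P(1)])
    then have xP: "x \<in> P" using s by simp
    have "twisted_sum P b T = (*) x ` twisted_sum P b S"
    proof
      show "twisted_sum P b T \<subseteq> (*) x ` twisted_sum P b S"
      proof
        fix y assume "y \<in> twisted_sum P b T"
        then obtain p s where ps: "y = p + b * (x * s)" "p \<in> P" "s \<in> S"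
          unfolding twisted_sum_def x by blast
        have "y / x = p / x + b * s" using ps x by (simp add: field_simps)
        moreover have "p / x \<in> P" using ps xP by (intro sq_ring_divide[OF P(1)])
        ultimately have "y / x \<in> twisted_sum P b S" using ps unfolding twisted_sum_def by blast
        then show "y \<in> (*) x ` twisted_sum P b S" using in_mult_image_iff[OF x(1)] by blast
      qed
      show "(*) x ` twisted_sum P b S \<subseteq> twisted_sum P b T"
      proof
        fix y assume "y \<in> (*) x ` twisted_sum P b S"
        then obtain p s where ps: "y = x * (p + b * s)" "p \<in> P" "s \<in> S"
          unfolding twisted_sum_def by blast
        have "y = x * p + b * (x * s)" using ps by (simp add: algebra_simps)
        moreover have "x * p \<in> P" using ps xP by (intro sq_ring_mult[OF P(1)])
        ultimately show "y \<in> twisted_sum P b T" using ps(3) unfolding twisted_sum_def x by blast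
      qed
    qed
    then show ?thesis using x(1) unfolding WT by blast
  qed
qed

section \<open>Minimal subspaces\<close>

text \<open>
  The value sets of minimal forms: the ratios of the elements of \<open>S\<close> do not lie in any field generated
  over \<open>F\<^sup>2\<close> by fewer than \<open>dim S - 1\<close> elements.  This form of minimality is visibly invariant under
  scaling, and is inherited by every space with the same ratios.
\<close>

definition minimal_space :: "'a set \<Rightarrow> bool" where
  "minimal_space S \<longleftrightarrow> sq.subspace S \<and> fd S \<and> sq.dim S > 0 \<and>
     (\<forall>p gs. p \<noteq> 0 \<longrightarrow> S \<subseteq> (*) p ` sq_adjoin gs \<longrightarrow> sq.dim S \<le> length gs + 1)"

lemma minimal_spaceD:
  assumes "minimal_space S"
  shows "sq.subspace S" "fd S" "sq.dim S > 0" "\<exists>x\<in>S. x \<noteq> 0"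
proof -
  show *: "sq.subspace S" "fd S" "sq.dim S > 0" using assms by (simp_all add: minimal_space_def)
  show "\<exists>x\<in>S. x \<noteq> 0" by (rule exists_nonzero[OF *(1,3)])
qed

lemma minimal_space_mult:
  assumes "minimal_space S" "x \<noteq> 0"
  shows "minimal_space ((*) x ` S)"
  unfolding minimal_space_def
proof (intro conjI allI impI)
  have S: "sq.subspace S" "fd S" "sq.dim S > 0" using minimal_spaceD[OF assms(1)] by simp_all
  show "sq.subspace ((*) x ` S)" "fd ((*) x ` S)" "0 < sq.dim ((*) x ` S)"
    using S assms(2) by (simp_all add: subspace_mult fd_mult dim_mult)
  fix p gs assume p: "p \<noteq> 0" and sub: "(*) x ` S \<subseteq> (*) p ` sq_adjoin gs"
  have "(*) (inverse x) ` (*) x ` S \<subseteq> (*) (inverse x) ` (*) p ` sq_adjoin gs"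
    using sub by (rule image_mono)
  then have "S \<subseteq> (*) (inverse x * p) ` sq_adjoin gs"
    using assms(2) unfolding mult_image_image by simp
  moreover have "inverse x * p \<noteq> 0" using p assms(2) by simp
  ultimately have "sq.dim S \<le> length gs + 1" using assms(1) unfolding minimal_space_def by blast
  then show "sq.dim ((*) x ` S) \<le> length gs + 1" using S assms(2) by (simp add: dim_mult)
qed

lemma subset_adjoin_if_basis:
  assumes "sq.span B = S" "B \<subseteq> sq_adjoin gs"
  shows "S \<subseteq> sq_adjoin gs"
  using sq.span_minimal[OF assms(2) subspace_adjoin] assms(1) by simp

text \<open>
  Independent elements of a minimal space that contains \<open>1\<close> generate as little of it as possible: if
  the field generated by \<open>gs\<close> contained a further element of \<open>S\<close>, that element could be spared as
  a generator of a field containing \<open>S\<close>, leaving too few generators.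
\<close>

lemma minimal_space_adjoin_Int:
  assumes S: "minimal_space S" and gs: "insert 1 (set gs) \<subseteq> S"
    and ind: "sq.independent (insert 1 (set gs))" "distinct gs" "1 \<notin> set gs"
    and x: "x \<in> S" "x \<in> sq_adjoin gs"
  shows "x \<in> sq.span (insert 1 (set gs))"
proof (rule ccontr)
  assume nx: "x \<notin> sq.span (insert 1 (set gs))"
  define E where "E = insert x (insert 1 (set gs))"
  have S': "sq.subspace S" "fd S" using minimal_spaceD[OF S] by simp_all
  have indE: "sq.independent E" unfolding E_def using ind(1) nx by (simp add: sq.independent_insertI)
  obtain B where B: "E \<subseteq> B" "B \<subseteq> S" "finite B" "sq.independent B" "sq.span B = S" "card B = sq.dim S"
    by (rule fd_basis_containing[OF S', of E]) (use indE gs x E_def in auto)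
  obtain hs where hs: "set hs = B - E" "distinct hs" using finite_distinct_list[of "B - E"] B(3) by auto
  have "B \<subseteq> sq_adjoin (gs @ hs)"
  proof
    fix y assume "y \<in> B"
    then consider "y = x" | "y = 1" | "y \<in> set (gs @ hs)" using hs unfolding E_def by auto
    then show "y \<in> sq_adjoin (gs @ hs)"
    proof cases
      case 1 then show ?thesis using x(2) adjoin_mono[of gs "gs @ hs"] by auto
    next
      case 2 then show ?thesis using sq_ring_1[OF sq_ring_adjoin] by simp
    next
      case 3 then show ?thesis by (rule adjoin_generator)
    qed
  qed
  then have "S \<subseteq> (*) 1 ` sq_adjoin (gs @ hs)" using subset_adjoin_if_basis[OF B(5)] by simp
  then have "sq.dim S \<le> length (gs @ hs) + 1"
    using S unfolding minimal_space_def by (metis one_neq_zero)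
  moreover have "length gs = card (set gs)" "length hs = card (set hs)"
    using ind(2) hs(2) by (simp_all add: distinct_card)
  moreover have "x \<notin> insert 1 (set gs)" using nx sq.span_base by blast
  then have "card E = card (set gs) + 2" unfolding E_def using ind(3) by simp
  moreover have "card B = card E + card (B - E)"
    using B(1,3) by (metis card_Diff_subset card_mono finite_subset le_add_diff_inverse)
  ultimately show False using B(6) hs(1) by simp
qed

lemma span_1: "x \<in> sq.span {1} \<longleftrightarrow> x \<in> squares"
  by (simp add: squares_eq_span)

lemma span_insertE:
  assumes "x \<in> sq.span (insert a A)"
  obtains c y where "y \<in> sq.span A" "x = c\<^sup>2 * a + y"
proof -
  obtain c where "x - sq_scale c a \<in> sq.span A" using assms sq.span_breakdown_eq by blast
  then show ?thesis using that[of "x - sq_scale c a" c] by (simp add: sq_scale_def)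
qed

lemma adjoin_singleton_subset:
  assumes "sq.subspace T" "x \<in> T" "x * a \<in> T" "u \<in> sq_adjoin [a]"
  shows "x * u \<in> T"
proof -
  obtain p q where "u = p\<^sup>2 + a * q\<^sup>2" using assms(4) by (auto simp: spread_def squares_def)
  then have "x * u = p\<^sup>2 * x + q\<^sup>2 * (x * a)" by (simp add: algebra_simps)
  then show ?thesis
    using assms(2,3) square_mult_subspace[OF assms(1)] sq.subspace_add[OF assms(1)] by metis
qed

lemma independent_basis_adjoin:
  assumes S: "minimal_space S" and B: "B \<subseteq> S" "sq.independent B" "1 \<in> B"
    and gs: "set gs \<subseteq> B - {1}" "distinct gs" and x: "x \<in> B - {1}" "x \<notin> set gs"
  shows "x \<notin> sq_adjoin gs"
proof
  assume "x \<in> sq_adjoin gs"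
  moreover have "sq.independent (insert 1 (set gs))"
    using B gs by (intro sq.independent_mono[OF B(2)]) auto
  ultimately have "x \<in> sq.span (insert 1 (set gs))"
    using minimal_space_adjoin_Int[OF S, of gs x] B gs x by auto
  moreover have "sq.span (insert 1 (set gs)) \<subseteq> sq.span (B - {x})"
    using B gs x by (intro sq.span_mono) auto
  ultimately show False using B(2) x(1) unfolding sq.dependent_def by blast
qed

text \<open>
  A number \<open>a \<noteq> 0\<close> is a ratio of elements of \<open>S\<close> if and only if \<open>S \<inter> a S\<close> is nonzero, and the
  dimension of this intersection is determined by those of \<open>S\<close> and \<open>S + a S\<close>.
\<close>

lemma ratio_transfer:
  assumes eqv: "spread_equivalent S T" and s: "s \<in> S" "s' \<in> S" "s \<noteq> 0" "s' \<noteq> 0"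
  shows "\<exists>t. t \<noteq> 0 \<and> t \<in> T \<and> t * (s' / s) \<in> T"
proof -
  have ST: "sq.subspace S" "fd S" "sq.subspace T" using eqv unfolding spread_equivalent_def by auto
  define a where "a = s' / s"
  have a: "a \<noteq> 0" using s unfolding a_def by simp
  have "s' \<in> S \<inter> (*) a ` S" using s in_mult_image_iff[OF a] unfolding a_def by simp
  then have "sq.dim (S \<inter> (*) a ` S) > 0"
    using dim_pos[OF sq.subspace_inter[OF ST(1) subspace_mult[OF ST(1)]] sq.fin_dim_mono[OF ST(2) Int_lower1]] s(4) by blast
  then have "sq.dim (T \<inter> (*) a ` T) > 0" using spread_equivalent_dim_Int[OF eqv a] by simp
  then obtain u where u: "u \<in> T" "u \<in> (*) a ` T" "u \<noteq> 0"
    using exists_nonzero[OF sq.subspace_inter[OF ST(3) subspace_mult[OF ST(3)]]] by blast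
  then obtain t where "t \<in> T" "u = a * t" by blast
  then show ?thesis using u unfolding a_def by (intro exI[of _ t]) (auto simp: mult.commute)
qed

lemma minimal_space_spread_equivalent:
  assumes eqv: "spread_equivalent S T" and S: "minimal_space S"
  shows "minimal_space T"
  unfolding minimal_space_def
proof (intro conjI allI impI)
  have ST: "sq.subspace S" "sq.subspace T" "fd T" using eqv unfolding spread_equivalent_def by auto
  show "sq.subspace T" "fd T" by fact+
  have dim: "sq.dim S = sq.dim T" by (rule spread_equivalent_dim[OF eqv])
  show dT: "sq.dim T > 0" using dim S unfolding minimal_space_def by simp
  fix p gs assume p: "p \<noteq> 0" and sub: "T \<subseteq> (*) p ` sq_adjoin gs"
  obtain s where s: "s \<in> S" "s \<noteq> 0" using exists_nonzero[OF ST(1)] dT dim by auto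
  have "S \<subseteq> (*) s ` sq_adjoin gs"
  proof
    fix x assume x: "x \<in> S"
    show "x \<in> (*) s ` sq_adjoin gs"
    proof (cases "x = 0")
      case True then show ?thesis using sq_ring_0[OF sq_ring_adjoin] by (intro image_eqI[of _ _ 0]) auto
    next
      case False
      then obtain t where t: "t \<noteq> 0" "t \<in> T" "t * (x / s) \<in> T"
        using ratio_transfer[OF eqv s(1) x s(2)] by blast
      have *: "t / p \<in> sq_adjoin gs" "t * (x / s) / p \<in> sq_adjoin gs"
        using sub t in_mult_image_iff[OF p] by blast+
      have "(t * (x / s) / p) / (t / p) \<in> sq_adjoin gs"
        by (rule sq_ring_divide[OF sq_ring_adjoin *(2,1)])
      moreover have "(t * (x / s) / p) / (t / p) = x / s" using t(1) p by simp
      ultimately show ?thesis using in_mult_image_iff[OF s(2)] by simp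
    qed
  qed
  then show "sq.dim T \<le> length gs + 1"
    using S s(2) dim unfolding minimal_space_def by metis
qed

lemma independent_pair:
  assumes "a \<notin> squares" shows "sq.independent {1, a}" "1 \<noteq> a"
proof -
  have "a \<notin> sq.span {1}" using assms span_1 by simp
  then have "sq.independent (insert a {1})" by (rule sq.independent_insertI) simp
  then show "sq.independent {1, a}" by (simp add: insert_commute)
  show "1 \<noteq> a" using assms square_in_squares[of 1] by auto
qed

lemma span_subset_adjoin: "sq.span (insert 1 (set gs)) \<subseteq> sq_adjoin gs"
  using adjoin_generator sq_ring_1[OF sq_ring_adjoin]
  by (intro sq.span_minimal subspace_adjoin) auto

text \<open>
  If \<open>u\<close> were not in \<open>F\<^sup>2(a)\<close>, then \<open>1, a, u\<close> would be independent, and \<open>u a\<close> would be an element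
  of \<open>T\<close> in the field generated by \<open>a\<close> and \<open>u\<close>, hence a combination of \<open>1, a, u\<close>.  Such a relation
  \<open>u a = c\<^sup>2 u + y\<close> can be solved for \<open>u\<close> in \<open>F\<^sup>2(a)\<close>.
\<close>

lemma minimal_space_line_unique_aux:
  assumes T: "minimal_space T" and a: "a \<notin> squares"
    and mem: "1 \<in> T" "a \<in> T" "u \<in> T" "u * a \<in> T"
  shows "u \<in> sq_adjoin [a]"
proof (rule ccontr)
  assume nu: "u \<notin> sq_adjoin [a]"
  then have "u \<notin> sq.span {1, a}" using span_subset_adjoin[of "[a]"] by auto
  then have "sq.independent (insert u {1, a})"
    by (rule sq.independent_insertI[OF _ independent_pair(1)[OF a]]) 
  moreover have "u \<noteq> a" "u \<noteq> 1"
    using nu adjoin_generator[of a "[a]"] sq_ring_1[OF sq_ring_adjoin, of "[a]"] by auto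
  moreover have ua: "u * a \<in> sq_adjoin [u, a]"
    by (intro sq_ring_mult[OF sq_ring_adjoin] adjoin_generator) auto
  ultimately have "u * a \<in> sq.span (insert 1 (set [u, a]))"
    using minimal_space_adjoin_Int[OF T, of "[u, a]" "u * a"] mem independent_pair[OF a]
    by (simp add: insert_commute)
  then have "u * a \<in> sq.span (insert u {1, a})" by (simp add: insert_commute)
  then obtain c y where cy: "y \<in> sq.span {1, a}" "u * a = c\<^sup>2 * u + y" by (rule span_insertE)
  have y: "y \<in> sq_adjoin [a]" using cy(1) span_subset_adjoin[of "[a]"] by auto
  have "c\<^sup>2 + a \<in> sq_adjoin [a]"
    by (intro sq_ring_add[OF sq_ring_adjoin] sq_ring_square[OF sq_ring_adjoin] adjoin_generator) auto
  moreover have "y + u * (c\<^sup>2 + a) = 0"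
    using cy(2) by (simp add: algebra_simps eq_iff_add[symmetric])
  ultimately have "c\<^sup>2 + a = 0" using sq_ring_direct(1)[OF sq_ring_adjoin nu _ y] by blast
  then have "a = c\<^sup>2" using eq_iff_add[of a "c\<^sup>2"] by (simp add: add.commute)
  then show False using a by simp
qed

text \<open>
  Projectively: for every \<open>a\<close>, a minimal space contains at most one line of the form
  \<open>y (F\<^sup>2 + a F\<^sup>2)\<close>.
\<close>

lemma minimal_space_line_unique:
  assumes T: "minimal_space T" and a: "a \<notin> squares"
    and mem: "y \<in> T" "y * a \<in> T" "u \<in> T" "u * a \<in> T" and y: "y \<noteq> 0"
  shows "u / y \<in> sq_adjoin [a]"
proof -
  have y': "inverse y \<noteq> 0" using y by simp
  have "x \<in> (*) (inverse y) ` T \<longleftrightarrow> x * y \<in> T" for x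
    using in_mult_image_iff[OF y', of x T] y by (simp add: divide_inverse)
  then show ?thesis
    using minimal_space_line_unique_aux[OF minimal_space_mult[OF T y'] a, of "u / y"] mem y
    by (simp add: mult.commute[of a])
qed

text \<open>
  The eight products of distinct elements among \<open>a, r, s\<close> are independent over \<open>F\<^sup>2\<close>.
  Up to squares, multiplying \<open>w\<close> by \<open>a r s\<close> turns the monomials \<open>1, a, r, s\<close> into
  \<open>a r s, r s, a s, a r\<close>, none of which occurs in the given span.  The coefficients are compared in the tower
  \<open>F\<^sup>2 \<subset> F\<^sup>2(a) \<subset> F\<^sup>2(r, a)\<close>.
\<close>

lemma no_triple_product_ratio:
  assumes a: "a \<notin> squares" and r: "r \<notin> sq_adjoin [a]" and s: "s \<notin> sq_adjoin [r, a]"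
    and w: "w \<in> sq.span {s, r, a, 1}" and lw: "a * r * s * w \<in> sq.span {s, r, a, 1}"
  shows "w = 0"
proof -
  let ?A = "sq_adjoin [a]" and ?R = "sq_adjoin [r, a]"
  have A: "sq_ring ?A" and R: "sq_ring ?R" by (rule sq_ring_adjoin)+
  have aA: "a \<in> ?A" "a \<in> ?R" "r \<in> ?R" by (intro adjoin_generator; simp)+
  have expand: "\<exists>c0 c1 c2 c3. x = c3\<^sup>2 * s + (c2\<^sup>2 * r + (c1\<^sup>2 * a + c0\<^sup>2))" if x: "x \<in> sq.span {s, r, a, 1}" for x
  proof -
    obtain c3 x2 where 3: "x2 \<in> sq.span {r, a, 1}" "x = c3\<^sup>2 * s + x2" using x by (rule span_insertE)
    obtain c2 x1 where 2: "x1 \<in> sq.span {a, 1}" "x2 = c2\<^sup>2 * r + x1" using 3(1) by (rule span_insertE)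
    obtain c1 x0 where 1: "x0 \<in> sq.span {1}" "x1 = c1\<^sup>2 * a + x0" using 2(1) by (rule span_insertE)
    obtain c0 where "x0 = c0\<^sup>2" using 1(1) unfolding span_1 squares_def by blast
    then show ?thesis using 1 2 3 by blast
  qed
  obtain c0 c1 c2 c3 where c: "w = c3\<^sup>2 * s + (c2\<^sup>2 * r + (c1\<^sup>2 * a + c0\<^sup>2))"
    using expand[OF w] by blast
  obtain d0 d1 d2 d3 where d: "a * r * s * w = d3\<^sup>2 * s + (d2\<^sup>2 * r + (d1\<^sup>2 * a + d0\<^sup>2))"
    using expand[OF lw] by blast
  define u where "u = a * r * c0\<^sup>2 + r * (c1 * a)\<^sup>2 + a * (c2 * r)\<^sup>2 + d3\<^sup>2"
  define v where "v = a * r * (c3 * s)\<^sup>2 + d2\<^sup>2 * r + d1\<^sup>2 * a + d0\<^sup>2"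
  have "v + s * u = a * r * s * w + (d3\<^sup>2 * s + (d2\<^sup>2 * r + (d1\<^sup>2 * a + d0\<^sup>2)))"
    unfolding u_def v_def c by (simp add: algebra_simps power2_eq_square)
  then have 0: "v + s * u = 0" using d by simp
  have "u \<in> ?R" unfolding u_def using aA
    by (intro sq_ring_add[OF R] sq_ring_mult[OF R] sq_ring_square[OF R])
  moreover have "v \<in> ?R" unfolding v_def using aA
    by (intro sq_ring_add[OF R] sq_ring_mult[OF R] sq_ring_square[OF R])
  ultimately have uv: "u = 0" "v = 0" using sq_ring_direct[OF R s] 0 by blast+
  have "(a * (c2 * r)\<^sup>2 + d3\<^sup>2) + r * (a * c0\<^sup>2 + (c1 * a)\<^sup>2) = 0"
    using uv(1) unfolding u_def by (simp add: algebra_simps)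
  moreover have "a * (c2 * r)\<^sup>2 + d3\<^sup>2 \<in> ?A" using aA
    by (intro sq_ring_add[OF A] sq_ring_mult[OF A] sq_ring_square[OF A])
  moreover have "a * c0\<^sup>2 + (c1 * a)\<^sup>2 \<in> ?A" using aA
    by (intro sq_ring_add[OF A] sq_ring_mult[OF A] sq_ring_square[OF A])
  ultimately have 1: "a * (c2 * r)\<^sup>2 + d3\<^sup>2 = 0" "a * c0\<^sup>2 + (c1 * a)\<^sup>2 = 0"
    using sq_ring_direct[OF A r] by blast+
  have "(d1\<^sup>2 * a + d0\<^sup>2) + r * (a * (c3 * s)\<^sup>2 + d2\<^sup>2) = 0"
    using uv(2) unfolding v_def by (simp add: algebra_simps)
  moreover have "d1\<^sup>2 * a + d0\<^sup>2 \<in> ?A" using aA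
    by (intro sq_ring_add[OF A] sq_ring_mult[OF A] sq_ring_square[OF A])
  moreover have "a * (c3 * s)\<^sup>2 + d2\<^sup>2 \<in> ?A" using aA
    by (intro sq_ring_add[OF A] sq_ring_mult[OF A] sq_ring_square[OF A])
  ultimately have 2: "a * (c3 * s)\<^sup>2 + d2\<^sup>2 = 0"
    using sq_ring_direct[OF A r] by blast
  have sqz: "x = 0 \<and> y = 0" if "a * x\<^sup>2 + y\<^sup>2 = 0" for x y
  proof -
    have "y\<^sup>2 + a * x\<^sup>2 = 0" using that by (simp add: add.commute)
    from sq_ring_direct[OF sq_ring_squares a square_in_squares square_in_squares this]
    show ?thesis by simp
  qed
  have "(0::'a) \<in> squares" by (rule sq_ring_0[OF sq_ring_squares])
  then have nz: "r \<noteq> 0" "s \<noteq> 0" "a \<noteq> 0" using a r s sq_ring_0[OF A] sq_ring_0[OF R] by metis+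
  show "w = 0" unfolding c using sqz[OF 1(1)] sqz[OF 1(2)] sqz[OF 2] nz by simp
qed

text \<open>
  The lines are \<open>F\<^sup>2 + a F\<^sup>2\<close> and \<open>r (F\<^sup>2 + a' F\<^sup>2)\<close>, and the last two memberships say that \<open>a a'\<close> is a
  ratio of elements of \<open>T\<close>.  Put \<open>s = r a'\<close>.  If the lines were disjoint, then \<open>1, a, r, s\<close> would
  be independent, and up to a square \<open>a a'\<close> would be the triple product \<open>a r s\<close>, say
  \<open>a r s w \<in> T\<close> with \<open>w \<in> T\<close>.  By minimality both \<open>w\<close> and \<open>a r s w\<close> are combinations of
  \<open>1, a, r, s\<close>, which contradicts the independence of the monomials.
\<close>

lemma minimal_space_lines_meet_aux:
  assumes T: "minimal_space T" and a: "a \<notin> squares" and a': "a' \<notin> sq_adjoin [a]"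
    and mem: "1 \<in> T" "a \<in> T" "r \<in> T" "r * a' \<in> T" "w \<in> T" "a * a' * w \<in> T"
    and nz: "r \<noteq> 0" "w \<noteq> 0"
  shows "\<exists>z. z \<noteq> 0 \<and> z \<in> T \<and> z * a \<in> T \<and> z * a' \<in> T"
proof -
  have sT: "sq.subspace T" by (rule minimal_spaceD(1)[OF T])
  let ?A = "sq_adjoin [a]"
  have A: "sq_ring ?A" by (rule sq_ring_adjoin)
  have aA: "a \<in> ?A" by (intro adjoin_generator) simp
  have AT: "u \<in> T" if "u \<in> ?A" for u
    using adjoin_singleton_subset[OF sT mem(1) _ that] mem(2) by simp
  have a0: "a \<noteq> 0" using a square_in_squares[of 0] by auto
  show ?thesis
  proof (cases "r \<in> ?A")
    case True
    then have "r * a \<in> T" using AT sq_ring_mult[OF A] aA by blast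
    then show ?thesis using mem nz by blast
  next
    case r: False
    define s where "s = r * a'"
    let ?R = "sq_adjoin [r, a]"
    have R: "sq_ring ?R" by (rule sq_ring_adjoin)
    have "r \<notin> sq.span {1, a}" using r span_subset_adjoin[of "[a]"] by auto
    then have ind3: "sq.independent {r, 1, a}"
      by (rule sq.independent_insertI[OF _ independent_pair(1)[OF a]])
    have ne3: "r \<noteq> 1" "r \<noteq> a" "a \<noteq> 1" using r sq_ring_1[OF A] aA independent_pair[OF a] by auto
    have span3: "x \<in> sq.span {r, 1, a}" if "x \<in> T" "x \<in> ?R" for x
      using minimal_space_adjoin_Int[OF T, of "[r, a]" x] mem ind3 ne3 that by (simp add: insert_commute)
    show ?thesis
    proof (cases "s \<in> ?R")
      case True
      then have "s \<in> sq.span (insert r {1, a})" using span3 mem unfolding s_def by blast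
      then obtain c u where cu: "u \<in> sq.span {1, a}" "s = c\<^sup>2 * r + u" by (rule span_insertE)
      have uA: "u \<in> ?A" using cu(1) span_subset_adjoin[of "[a]"] by auto
      have u: "u = r * a' + c\<^sup>2 * r" using cu(2) unfolding s_def
        by (metis add.commute add.left_commute add_self add_0_right)
      have u0: "u \<noteq> 0"
      proof
        assume "u = 0"
        then have "r * (a' + c\<^sup>2) = 0" using u by (simp add: algebra_simps)
        then have "a' = c\<^sup>2" using nz(1) eq_iff_add[of a' "c\<^sup>2"] by simp
        then show False using a' sq_ring_square[OF A] by blast
      qed
      have "u * a' = a'\<^sup>2 * r + c\<^sup>2 * (r * a')" unfolding u by (simp add: algebra_simps power2_eq_square)
      moreover have "a'\<^sup>2 * r + c\<^sup>2 * (r * a') \<in> T"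
        using mem(3,4) by (intro sq.subspace_add[OF sT] square_mult_subspace[OF sT])
      moreover have "u * a \<in> T" using AT sq_ring_mult[OF A uA aA] by blast
      ultimately show ?thesis using u0 AT[OF uA] by metis
    next
      case s: False
      let ?L = "sq_adjoin [s, r, a]"
      have L: "sq_ring ?L" by (rule sq_ring_adjoin)
      define l where "l = a * r * s"
      have gens: "a \<in> ?L" "r \<in> ?L" "s \<in> ?L" by (intro adjoin_generator; simp)+
      have lL: "l \<in> ?L" unfolding l_def using gens by (intro sq_ring_mult[OF L])
      have "a * r * s * w = r\<^sup>2 * (a * a' * w)" unfolding s_def by (simp add: power2_eq_square algebra_simps)
      then have lwT: "l * w \<in> T" unfolding l_def using square_mult_subspace[OF sT mem(6), of r] by metis
      have "s \<notin> sq.span {r, 1, a}"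
        using s span_subset_adjoin[of "[r, a]"] by (auto simp: insert_commute)
      then have ind4: "sq.independent {s, r, 1, a}"
        by (rule sq.independent_insertI[OF _ ind3])
      have ne4: "s \<noteq> 1" "s \<noteq> a" "s \<noteq> r"
        using s sq_ring_1[OF R] adjoin_generator[of a "[r, a]"] adjoin_generator[of r "[r, a]"] by auto
      have sT': "s \<in> T" using mem unfolding s_def by blast
      have span4: "x \<in> sq.span {s, r, a, 1}" if "x \<in> T" "x \<in> ?L" for x
        using minimal_space_adjoin_Int[OF T, of "[s, r, a]" x] mem sT' ind4 ne4 ne3 that by (simp add: insert_commute)
      have False
      proof (cases "w \<in> ?L")
        case True
        then have "w \<in> sq.span {s, r, a, 1}" "l * w \<in> sq.span {s, r, a, 1}"
          using span4 mem(5) lwT sq_ring_mult[OF L lL] by blast+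
        then show False using no_triple_product_ratio[OF a r s] nz(2) unfolding l_def by blast
      next
        case w: False
        have "w \<notin> sq.span {s, r, 1, a}"
          using w span_subset_adjoin[of "[s, r, a]"] by (auto simp: insert_commute)
        then have ind5: "sq.independent {w, s, r, 1, a}"
          by (rule sq.independent_insertI[OF _ ind4])
        have ne5: "w \<noteq> 1" "w \<noteq> a" "w \<noteq> r" "w \<noteq> s"
          using w gens sq_ring_1[OF L] by auto
        have "l \<in> sq_adjoin [w, s, r, a]"
          using lL adjoin_mono[of "[s, r, a]" "[w, s, r, a]"] by auto
        moreover have "w \<in> sq_adjoin [w, s, r, a]" by (intro adjoin_generator) simp
        ultimately have "l * w \<in> sq_adjoin [w, s, r, a]" by (rule sq_ring_mult[OF sq_ring_adjoin])
        then have "l * w \<in> sq.span (insert w {s, r, a, 1})"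
          using minimal_space_adjoin_Int[OF T, of "[w, s, r, a]" "l * w"] mem sT' lwT ind5 ne3 ne4 ne5
          by (simp add: insert_commute)
        then obtain c h where ch: "h \<in> sq.span {s, r, a, 1}" "l * w = c\<^sup>2 * w + h" by (rule span_insertE)
        \<comment> \<open>Solving \<open>l w = c\<^sup>2 w + h\<close> for \<open>w\<close> would put \<open>w\<close> into \<open>F\<^sup>2(s, r, a)\<close>.\<close>
        have hL: "h \<in> ?L" using ch(1) span_subset_adjoin[of "[s, r, a]"] by (auto simp: insert_commute)
        have "h + w * (l + c\<^sup>2) = (l * w) + (c\<^sup>2 * w + h)" by (simp add: algebra_simps)
        then have "h + w * (l + c\<^sup>2) = 0" using ch(2) by simp
        moreover have "l + c\<^sup>2 \<in> ?L" using lL by (intro sq_ring_add[OF L] sq_ring_square[OF L])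
        ultimately have "l + c\<^sup>2 = 0" using sq_ring_direct(1)[OF L w _ hL] by blast
        then have "c\<^sup>2 + s * (a * r) = 0" unfolding l_def by (simp add: algebra_simps)
        moreover have "a * r \<in> ?R" by (intro sq_ring_mult[OF R] adjoin_generator) simp_all
        \<comment> \<open>Otherwise \<open>s = c\<^sup>2 / (a r)\<close> would be in \<open>F\<^sup>2(r, a)\<close>.\<close>
        ultimately have "a * r = 0" using sq_ring_direct(1)[OF R s] sq_ring_square[OF R] by blast
        then show False using a0 nz(1) by simp
      qed
      then show ?thesis ..
    qed
  qed
qed

lemma minimal_space_lines_meet:
  assumes T: "minimal_space T" and a: "a \<notin> squares" and a': "a' \<notin> sq_adjoin [a]"
    and mem: "x \<in> T" "x * a \<in> T" "y \<in> T" "y * a' \<in> T" "w \<in> T" "a * a' * w \<in> T"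
    and nz: "x \<noteq> 0" "y \<noteq> 0" "w \<noteq> 0"
  shows "\<exists>z. z \<noteq> 0 \<and> z \<in> T \<and> z * a \<in> T \<and> z * a' \<in> T"
proof -
  have x': "inverse x \<noteq> 0" using nz by simp
  define T' where "T' = (*) (inverse x) ` T"
  have T'_iff: "u \<in> T' \<longleftrightarrow> u * x \<in> T" for u
    unfolding T'_def using in_mult_image_iff[OF x', of u T] nz by (simp add: divide_inverse)
  have "minimal_space T'" unfolding T'_def by (rule minimal_space_mult[OF T x'])
  moreover have "1 \<in> T'" "a \<in> T'" "y / x \<in> T'" "(y / x) * a' \<in> T'" "w / x \<in> T'" "a * a' * (w / x) \<in> T'"
    unfolding T'_iff using mem nz by (simp_all add: mult.commute)
  moreover have "y / x \<noteq> 0" "w / x \<noteq> 0" using nz by auto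
  ultimately obtain z where "z \<noteq> 0" "z \<in> T'" "z * a \<in> T'" "z * a' \<in> T'"
    using minimal_space_lines_meet_aux[OF _ a a', of T' "y / x" "w / x"] by blast
  then show ?thesis unfolding T'_iff using nz by (intro exI[of _ "z * x"]) (simp add: mult_ac)
qed

text \<open>
  After scaling, \<open>S\<close> has a basis \<open>1\<close> together with \<open>C\<close>.  For every \<open>s \<in> C\<close> the equivalent space \<open>T\<close> contains a
  line \<open>x (F\<^sup>2 + s F\<^sup>2)\<close>.  For distinct \<open>s, t \<in> C\<close> the product \<open>s t\<close> is, up to the square \<open>t\<^sup>2\<close>, the ratio
  \<open>s / t\<close>, so the two lines meet.  Let \<open>y\<close> be the common point of the lines of \<open>s\<close> and \<open>s'\<close>.
  A third line, for \<open>t\<close>, meets these in \<open>u\<close> and \<open>v\<close>.  Here \<open>v / u\<close> lies both in \<open>F\<^sup>2(t)\<close> and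
  in \<open>F\<^sup>2(s, s')\<close>, hence in \<open>F\<^sup>2\<close>; so \<open>u\<close> and \<open>v\<close> are the same point.  It lies on the first two lines, so it
  is \<open>y\<close>.
\<close>

theorem rigid_minimal_space:
  assumes S0: "minimal_space S0"
  shows "rigid S0"
proof -
  obtain s0 where s0: "s0 \<in> S0" "s0 \<noteq> 0" using minimal_spaceD(4)[OF S0] by blast
  have s0': "inverse s0 \<noteq> 0" using s0 by simp
  define S where "S = (*) (inverse s0) ` S0"
  have S: "minimal_space S" unfolding S_def by (rule minimal_space_mult[OF S0 s0'])
  have S1: "1 \<in> S" unfolding S_def using s0 by (intro image_eqI[of _ _ s0]) auto
  have S': "sq.subspace S" "fd S" using minimal_spaceD[OF S] by simp_all
  obtain B where B: "{1} \<subseteq> B" "B \<subseteq> S" "finite B" "sq.independent B" "sq.span B = S" "card B = sq.dim S"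
    by (rule fd_basis_containing[OF S', of "{1}"]) (use S1 in auto)
  define C where "C = B - {1}"
  have BC: "B = insert 1 C" using B(1) unfolding C_def by auto
  have C_adj: "x \<notin> sq_adjoin gs" if "set gs \<subseteq> C" "distinct gs" "x \<in> C" "x \<notin> set gs" for x gs
    by (rule independent_basis_adjoin[OF S B(2,4)]) (use B that C_def in auto)
  have C_sq: "x \<notin> squares" if "x \<in> C" for x using C_adj[of "[]" x] that by simp
  have C0: "x \<noteq> 0" if "x \<in> C" for x using C_sq[OF that] square_in_squares[of 0] by auto
  have CS: "C \<subseteq> S" using B(2) C_def by blast
  have "rigid S"
    unfolding rigid_def
  proof (intro allI impI)
    fix T assume eqv: "spread_equivalent S T"
    have T: "sq.subspace T" "fd T" using eqv unfolding spread_equivalent_def by auto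
    have dim: "sq.dim S = sq.dim T" by (rule spread_equivalent_dim[OF eqv])
    have mT: "minimal_space T" by (rule minimal_space_spread_equivalent[OF eqv S])
    have line: "\<exists>x. x \<noteq> 0 \<and> x \<in> T \<and> x * s \<in> T" if "s \<in> C" for s
      using ratio_transfer[OF eqv S1, of s] CS C0 that by auto
    have meet: "\<exists>y. y \<noteq> 0 \<and> y \<in> T \<and> y * s \<in> T \<and> y * t \<in> T" if st: "s \<in> C" "t \<in> C" "s \<noteq> t" for s t
    proof -
      obtain x where x: "x \<noteq> 0" "x \<in> T" "x * s \<in> T" using line st by blast
      obtain y where y: "y \<noteq> 0" "y \<in> T" "y * t \<in> T" using line st by blast
      obtain w where w: "w \<noteq> 0" "w \<in> T" "w * (s / t) \<in> T"
        using ratio_transfer[OF eqv, of t s] CS C0 st by blast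
      have "t\<^sup>2 * (w * (s / t)) = s * t * w" using C0[OF st(2)] by (simp add: power2_eq_square)
      then have "s * t * w \<in> T" using square_mult_subspace[OF T(1) w(3), of t] by simp
      moreover have "t \<notin> sq_adjoin [s]" using C_adj[of "[s]" t] st by auto
      ultimately show ?thesis
        using minimal_space_lines_meet[OF mT C_sq[OF st(1)] _ x(2,3) y(2,3) w(2) _ x(1) y(1) w(1)] by blast
    qed
    have "\<exists>y. y \<noteq> 0 \<and> y \<in> T \<and> (\<forall>t\<in>C. y * t \<in> T)"
    proof (cases "\<exists>s\<in>C. \<exists>s'\<in>C. s \<noteq> s'")
      case False
      show ?thesis
      proof (cases "C = {}")
        case True
        then show ?thesis using minimal_spaceD(4)[OF mT] by blast
      next
        case False
        then obtain s where "s \<in> C" by blast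
        then have "C = {s}" using \<open>\<not> (\<exists>s\<in>C. \<exists>s'\<in>C. s \<noteq> s')\<close> by blast
        then show ?thesis using line by simp
      qed
    next
      case True
      then obtain s s' where s: "s \<in> C" "s' \<in> C" "s \<noteq> s'" by blast
      obtain y where y: "y \<noteq> 0" "y \<in> T" "y * s \<in> T" "y * s' \<in> T" using meet[OF s] by blast
      have "y * t \<in> T" if t: "t \<in> C" for t
      proof (cases "t = s \<or> t = s'")
        case False
        obtain u where u: "u \<noteq> 0" "u \<in> T" "u * s \<in> T" "u * t \<in> T" using meet[of s t] s t False by blast
        obtain v where v: "v \<noteq> 0" "v \<in> T" "v * s' \<in> T" "v * t \<in> T" using meet[of s' t] s t False by blast
        have 1: "u / y \<in> sq_adjoin [s]" using minimal_space_line_unique[OF mT C_sq[OF s(1)] y(2,3) u(2,3) y(1)] .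
        have 2: "v / y \<in> sq_adjoin [s']" using minimal_space_line_unique[OF mT C_sq[OF s(2)] y(2,4) v(2,3) y(1)] .
        have 3: "v / u \<in> sq_adjoin [t]" using minimal_space_line_unique[OF mT C_sq[OF t] u(2,4) v(2,4) u(1)] .
        have up: "u / y \<in> sq_adjoin [s, s']" "v / y \<in> sq_adjoin [s, s']"
          using 1 2 adjoin_mono[of "[s]" "[s, s']"] adjoin_mono[of "[s']" "[s, s']"] by auto
        have "(v / y) / (u / y) \<in> sq_adjoin [s, s']" by (intro sq_ring_divide[OF sq_ring_adjoin] up)
        then have vu: "v / u \<in> sq_adjoin [s, s']" using y(1) by simp
        obtain p q where pq: "v / u = p\<^sup>2 + t * q\<^sup>2" using 3 by (auto simp: spread_def squares_def)
        have "(p\<^sup>2 + v / u) + t * q\<^sup>2 = 0" unfolding pq by (simp add: add.commute add.left_commute)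
        moreover have "t \<notin> sq_adjoin [s, s']" using C_adj[of "[s, s']" t] s t False by auto
        moreover have "p\<^sup>2 + v / u \<in> sq_adjoin [s, s']"
          by (intro sq_ring_add[OF sq_ring_adjoin] sq_ring_square[OF sq_ring_adjoin] vu)
        ultimately have "q\<^sup>2 = 0"
          using sq_ring_direct(1)[OF sq_ring_adjoin _ sq_ring_square[OF sq_ring_adjoin]] by blast
        then have vp: "v / u = p\<^sup>2" using pq by simp
        have "(v / y) = p\<^sup>2 * (u / y)" using vp u(1) by (simp add: field_simps)
        then have "v / y \<in> sq_adjoin [s]" using 1 sq_ring_mult[OF sq_ring_adjoin sq_ring_square[OF sq_ring_adjoin]] by metis
        moreover obtain g d where gd: "v / y = g\<^sup>2 + s' * d\<^sup>2" using 2 by (auto simp: spread_def squares_def)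
        ultimately have "g\<^sup>2 + v / y \<in> sq_adjoin [s]"
          by (intro sq_ring_add[OF sq_ring_adjoin] sq_ring_square[OF sq_ring_adjoin])
        moreover have "(g\<^sup>2 + v / y) + s' * d\<^sup>2 = 0" unfolding gd by (simp add: add.commute add.left_commute)
        moreover have "s' \<notin> sq_adjoin [s]" using C_adj[of "[s]" s'] s by auto
        ultimately have "d\<^sup>2 = 0"
          using sq_ring_direct(1)[OF sq_ring_adjoin _ sq_ring_square[OF sq_ring_adjoin]] by blast
        then have "v = g\<^sup>2 * y" using gd y(1) by (simp add: field_simps)
        moreover from this have "g \<noteq> 0" using v(1) by auto
        ultimately have "y * t = (inverse g)\<^sup>2 * (v * t)" by (simp add: power2_eq_square field_simps)
        then show ?thesis using square_mult_subspace[OF T(1) v(4)] by metis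
      qed (use y in auto)
      then show ?thesis using y by blast
    qed
    then obtain y where y: "y \<noteq> 0" "y \<in> T" "\<forall>t\<in>C. y * t \<in> T" by blast
    have "(*) y ` B \<subseteq> T" unfolding BC using y by auto
    then have "sq.span ((*) y ` B) \<subseteq> T" using T(1) by (rule sq.span_minimal)
    moreover have "sq.span ((*) y ` B) = (*) y ` S"
      using Vector_Spaces.linear.axioms(3)[OF linear_mult] module_hom.span_image B(5) by metis
    ultimately have "(*) y ` S = T"
      using sq.fin_dim_subspace_eq[OF T(2) subspace_mult[OF S'(1)] T(1)] dim_mult[OF S'(1) y(1)] dim by simp
    then show "\<exists>x. x \<noteq> 0 \<and> T = (*) x ` S" using y(1) by blast
  qed
  then show ?thesis using rigid_if_multiple_rigid[OF s0'] unfolding S_def by blast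
qed

end

section \<open>Forms over a subfield and their adapted bases\<close>

lemma ring_of_type_algebra_simps [simp]:
  "carrier ring_of_type_algebra = UNIV"
  "\<zero>\<^bsub>ring_of_type_algebra\<^esub> = 0" "\<one>\<^bsub>ring_of_type_algebra\<^esub> = 1"
  "x \<oplus>\<^bsub>ring_of_type_algebra\<^esub> y = x + y" "x \<otimes>\<^bsub>ring_of_type_algebra\<^esub> y = x * y"
  by (simp_all add: ring_of_type_algebra_def)

lemma ring_of_type_algebra_uminus [simp]:
  "\<ominus>\<^bsub>ring_of_type_algebra\<^esub> x = - (x::'k::field)"
proof -
  interpret R: Ring.field "ring_of_type_algebra :: 'k ring" by (rule field_from_type_algebra)
  have "\<ominus>\<^bsub>ring_of_type_algebra\<^esub> x + x = 0" using R.l_neg[of x] by simp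
  then show ?thesis by (simp add: eq_neg_iff_add_eq_0)
qed

lemma ring_of_type_algebra_inverse:
  assumes "x \<noteq> 0"
  shows "inv\<^bsub>ring_of_type_algebra\<^esub> x = inverse (x::'k::field)"
proof -
  interpret R: Ring.field "ring_of_type_algebra :: 'k ring" by (rule field_from_type_algebra)
  show ?thesis using assms R.comm_inv_char[of x "inverse x"] by simp
qed

lemma subfield_closed:
  assumes "subfield K (ring_of_type_algebra :: 'k::field ring)"
  shows "0 \<in> K" "1 \<in> K" "x \<in> K \<Longrightarrow> y \<in> K \<Longrightarrow> x + y \<in> K"
    "x \<in> K \<Longrightarrow> y \<in> K \<Longrightarrow> x * y \<in> K" "x \<in> K \<Longrightarrow> - x \<in> K" "x \<in> K \<Longrightarrow> inverse x \<in> K"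
proof -
  interpret R: Ring.field "ring_of_type_algebra :: 'k ring" by (rule field_from_type_algebra)
  note sr = subringE[OF subfieldE(1)[OF assms]]
  show 0: "0 \<in> K" and "1 \<in> K" using sr(2,3) by simp_all
  show "x \<in> K \<Longrightarrow> y \<in> K \<Longrightarrow> x + y \<in> K" "x \<in> K \<Longrightarrow> y \<in> K \<Longrightarrow> x * y \<in> K" "x \<in> K \<Longrightarrow> - x \<in> K"
    using sr(5)[of x] sr(6,7)[of x y] by simp_all
  show "x \<in> K \<Longrightarrow> inverse x \<in> K"
    using R.subfield_m_inv(1)[OF assms, of x] 0 by (cases "x = 0") (simp_all add: ring_of_type_algebra_inverse)
qed

lemma subfieldI_type:
  assumes "(1::'k::field) \<in> K" "\<And>x y. x \<in> K \<Longrightarrow> y \<in> K \<Longrightarrow> x + y \<in> K"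
    "\<And>x y. x \<in> K \<Longrightarrow> y \<in> K \<Longrightarrow> x * y \<in> K" "\<And>x. x \<in> K \<Longrightarrow> - x \<in> K" "\<And>x. x \<in> K \<Longrightarrow> inverse x \<in> K"
  shows "subfield K (ring_of_type_algebra :: 'k ring)"
proof -
  interpret R: Ring.field "ring_of_type_algebra :: 'k ring" by (rule field_from_type_algebra)
  show ?thesis
  proof (rule R.subfieldI')
    show "subring K ring_of_type_algebra" by (rule R.subringI) (use assms in auto)
    show "inv\<^bsub>ring_of_type_algebra\<^esub> k \<in> K" if "k \<in> K - {\<zero>\<^bsub>ring_of_type_algebra\<^esub>}" for k
      using that assms(5) ring_of_type_algebra_inverse[of k] by simp
  qed
qed

text \<open>
  One notion for two kinds of spaces: the span of \<open>B\<close> over a subfield \<open>K\<close>, where \<open>g b\<close> maps \<open>c\<close> to the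
  multiple \<open>c b\<close>, and value sets, where \<open>g b\<close> maps \<open>c\<close> to the value \<open>c\<^sup>2 q(b)\<close> of that multiple.
\<close>

definition sum_space :: "('b \<Rightarrow> 'k \<Rightarrow> 'v::ab_group_add) \<Rightarrow> 'k set \<Rightarrow> 'b set \<Rightarrow> 'v set" where
  "sum_space g K B = {\<Sum>b\<in>B. g b (c b) | c. \<forall>b\<in>B. c b \<in> K}"

lemma sum_space_insert:
  assumes "finite B" "b \<notin> B"
  shows "sum_space g K (insert b B) = {x + y | x y. x \<in> g b ` K \<and> y \<in> sum_space g K B}"
proof
  show "sum_space g K (insert b B) \<subseteq> {x + y | x y. x \<in> g b ` K \<and> y \<in> sum_space g K B}"
    unfolding sum_space_def using assms by auto
  show "{x + y | x y. x \<in> g b ` K \<and> y \<in> sum_space g K B} \<subseteq> sum_space g K (insert b B)"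
  proof
    fix z assume "z \<in> {x + y | x y. x \<in> g b ` K \<and> y \<in> sum_space g K B}"
    then obtain k c where kc: "k \<in> K" "\<forall>b\<in>B. c b \<in> K" "z = g b k + (\<Sum>b\<in>B. g b (c b))"
      unfolding sum_space_def by auto
    define c' where "c' = c(b := k)"
    have "(\<Sum>a\<in>B. g a (c' a)) = (\<Sum>a\<in>B. g a (c a))"
      by (rule sum.cong) (use assms(2) in \<open>auto simp: c'_def\<close>)
    then have "z = (\<Sum>a\<in>insert b B. g a (c' a))" using kc(3) assms by (simp add: c'_def)
    moreover have "\<forall>a\<in>insert b B. c' a \<in> K" using kc by (simp add: c'_def)
    ultimately show "z \<in> sum_space g K (insert b B)" unfolding sum_space_def by blast
  qed
qed

lemma sum_space_memI: "\<forall>b\<in>B. c b \<in> K \<Longrightarrow> (\<Sum>b\<in>B. g b (c b)) \<in> sum_space g K B"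
  unfolding sum_space_def by blast

lemma sum_space_E:
  assumes "v \<in> sum_space g K B"
  obtains c where "\<forall>b\<in>B. c b \<in> K" "v = (\<Sum>b\<in>B. g b (c b))"
  using assms unfolding sum_space_def by blast

context vector_space_pair begin

text \<open>
  In the applications \<open>K\<close> is a finite extension of the field of scalars, and the maps are linear over
  the scalars only.  Each index contributes a copy of \<open>K\<close>, so the rank over \<open>K\<close> can be read off from a
  dimension over the field of scalars.
\<close>

lemma dim_sum_space:
  assumes K: "vs1.subspace K" "fin_dim s1 K" and "finite B"
    and lin: "\<And>b. b \<in> B \<Longrightarrow> Vector_Spaces.linear s1 s2 (g b)"
    and ind: "\<And>c. (\<forall>b\<in>B. c b \<in> K) \<Longrightarrow> (\<Sum>b\<in>B. g b (c b)) = 0 \<Longrightarrow> \<forall>b\<in>B. c b = 0"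
  shows "vs2.subspace (sum_space g K B) \<and> fin_dim s2 (sum_space g K B) \<and>
    vs2.dim (sum_space g K B) = card B * vs1.dim K"
  using assms(3) lin ind
proof (induction B rule: finite_induct)
  case empty
  have "sum_space g K {} = {0}" unfolding sum_space_def by simp
  moreover have "fin_dim s2 {0}" unfolding fin_dim_def by (intro exI[of _ "{}"]) simp
  moreover have "vs2.dim {0} = 0" using vs2.dim_le_card[of "{0}" "{}"] by simp
  ultimately show ?case by simp
next
  case (insert b B)
  have 0: "0 \<in> K" using vs1.subspace_0[OF K(1)] .
  have g0: "g a 0 = 0" if "a \<in> insert b B" for a
    using insert.prems(1)[OF that] Vector_Spaces.linear.axioms(3) module_hom.zero by blast
  have "\<forall>a\<in>B. c a = 0" if c: "\<forall>a\<in>B. c a \<in> K" "(\<Sum>a\<in>B. g a (c a)) = 0" for c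
  proof -
    define c' where "c' = c(b := 0)"
    have "(\<Sum>a\<in>B. g a (c' a)) = (\<Sum>a\<in>B. g a (c a))"
      by (rule sum.cong) (use insert.hyps(2) in \<open>auto simp: c'_def\<close>)
    then have "(\<Sum>a\<in>insert b B. g a (c' a)) = 0"
      using insert.hyps c(2) g0 by (simp add: c'_def)
    moreover have "\<forall>a\<in>insert b B. c' a \<in> K" using c 0 by (simp add: c'_def)
    ultimately have "\<forall>a\<in>insert b B. c' a = 0" using insert.prems(2)[of c'] by blast
    then show ?thesis using insert.hyps(2) by (metis c'_def fun_upd_other insertCI)
  qed
  then have IH: "vs2.subspace (sum_space g K B)" "fin_dim s2 (sum_space g K B)"
    "vs2.dim (sum_space g K B) = card B * vs1.dim K"
    using insert.IH insert.prems(1) by simp_all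
  have lb: "Vector_Spaces.linear s1 s2 (g b)" using insert.prems(1) by simp
  interpret gb: Vector_Spaces.linear s1 s2 "g b" by (rule lb)
  have key: "k = 0 \<and> y = 0" if k: "k \<in> K" and y: "y \<in> sum_space g K B" and eq: "g b k + y = 0" for k y
  proof -
    obtain c where c: "\<forall>a\<in>B. c a \<in> K" "y = (\<Sum>a\<in>B. g a (c a))" using y by (rule sum_space_E)
    define c' where "c' = c(b := k)"
    have s: "(\<Sum>a\<in>B. g a (c' a)) = y" unfolding c(2)
      by (rule sum.cong) (use insert.hyps(2) in \<open>auto simp: c'_def\<close>)
    then have "(\<Sum>a\<in>insert b B. g a (c' a)) = 0"
      using insert.hyps eq by (simp add: c'_def)
    moreover have "\<forall>a\<in>insert b B. c' a \<in> K" using c k by (simp add: c'_def)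
    ultimately have "\<forall>a\<in>insert b B. c' a = 0" using insert.prems(2)[of c'] by blast
    then have "k = 0" by (simp add: c'_def)
    then show ?thesis using eq gb.zero by simp
  qed
  have sub: "vs2.subspace (g b ` K)" by (rule gb.subspace_image[OF K(1)])
  have fin: "fin_dim s2 (g b ` K)" by (rule gb.fin_dim_image[OF K(2)])
  have inj: "inj_on (g b) K"
    unfolding gb.inj_on_iff_eq_0[OF K(1)]
    using key[of _ 0] vs2.subspace_0[OF IH(1)] by simp
  have dimb: "vs2.dim (g b ` K) = vs1.dim K" by (rule gb.dim_inj_image[OF inj K(1)])
  have "g b ` K \<inter> sum_space g K B \<subseteq> {0}"
  proof
    fix y assume y: "y \<in> g b ` K \<inter> sum_space g K B"
    then obtain k where k: "k \<in> K" "y = g b k" by blast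
    have "- y \<in> sum_space g K B" using y vs2.subspace_neg[OF IH(1)] by blast
    then have "k = 0" using key[OF k(1), of "- y"] k(2) by simp
    then show "y \<in> {0}" using k gb.zero by simp
  qed
  then have "vs2.dim (g b ` K \<inter> sum_space g K B) = 0"
    using vs2.dim_le_card[of "g b ` K \<inter> sum_space g K B" "{}"] by simp
  then show ?case
    unfolding sum_space_insert[OF insert.hyps]
    using vs2.dim_sums_Int_fin[OF sub fin IH(1,2)] IH(3) dimb insert.hyps
      vs2.subspace_sums[OF sub IH(1)] vs2.fin_dim_sums[OF fin IH(2)] by simp
qed

end

lemma ts_qformD:
  assumes "ts_qform K Q"
  shows "subfield K ring_of_type_algebra" "vector_space (qscale Q)" "0 \<in> qspace Q"
    "\<And>v w. v \<in> qspace Q \<Longrightarrow> w \<in> qspace Q \<Longrightarrow> v + w \<in> qspace Q"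
    "\<And>a v. a \<in> K \<Longrightarrow> v \<in> qspace Q \<Longrightarrow> qscale Q a v \<in> qspace Q"
    "\<exists>B. finite B \<and> B \<subseteq> qspace Q \<and> (\<forall>v\<in>qspace Q. \<exists>c. (\<forall>b\<in>B. c b \<in> K) \<and> v = (\<Sum>b\<in>B. qscale Q (c b) b))"
    "\<And>v. v \<in> qspace Q \<Longrightarrow> qval Q v \<in> K"
    "\<And>a v. a \<in> K \<Longrightarrow> v \<in> qspace Q \<Longrightarrow> qval Q (qscale Q a v) = a\<^sup>2 * qval Q v"
    "\<And>v w. v \<in> qspace Q \<Longrightarrow> w \<in> qspace Q \<Longrightarrow> qval Q (v + w) = qval Q v + qval Q w"
  using assms by (simp_all add: ts_qform_def)

lemma ts_qform_0:
  assumes "ts_qform K Q"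
  shows "qval Q 0 = 0"
proof -
  have "qval Q 0 + qval Q 0 = qval Q 0 + 0"
    using ts_qformD(9)[OF assms, of 0 0] ts_qformD(3)[OF assms] by (metis add.right_neutral)
  then show ?thesis by (simp only: add_left_cancel)
qed

lemma ts_qform_sum:
  assumes Q: "ts_qform K Q" and "finite B" "\<And>b. b \<in> B \<Longrightarrow> c b \<in> K \<and> f b \<in> qspace Q"
  shows "(\<Sum>b\<in>B. qscale Q (c b) (f b)) \<in> qspace Q \<and>
    qval Q (\<Sum>b\<in>B. qscale Q (c b) (f b)) = (\<Sum>b\<in>B. (c b)\<^sup>2 * qval Q (f b))"
  using assms(2,3)
proof (induction B rule: finite_induct)
  case empty
  then show ?case using ts_qformD(3)[OF Q] ts_qform_0[OF Q] by simp
next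
  case (insert b B)
  then show ?case using ts_qformD(4,5,8,9)[OF Q] by simp
qed

definition K_span :: "('k, 'v::ab_group_add) qform \<Rightarrow> 'k set \<Rightarrow> 'v set \<Rightarrow> 'v set" where
  "K_span Q K B = sum_space (\<lambda>b c. qscale Q c b) K B"

lemma K_span_closed:
  fixes Q :: "('k::field, 'v::ab_group_add) qform"
  assumes K: "subfield K ring_of_type_algebra" and V: "vector_space (qscale Q)"
  shows "0 \<in> K_span Q K B" "v \<in> K_span Q K B \<Longrightarrow> w \<in> K_span Q K B \<Longrightarrow> v + w \<in> K_span Q K B"
    "a \<in> K \<Longrightarrow> v \<in> K_span Q K B \<Longrightarrow> qscale Q a v \<in> K_span Q K B"
    "finite B \<Longrightarrow> b \<in> B \<Longrightarrow> b \<in> K_span Q K B"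
proof -
  interpret V: vector_space "qscale Q" by (rule V)
  note cl = subfield_closed[OF K]
  have "(\<Sum>b\<in>B. qscale Q 0 b) \<in> K_span Q K B"
    unfolding K_span_def by (rule sum_space_memI[of _ "\<lambda>_. 0"]) (use cl in simp)
  then show "0 \<in> K_span Q K B" by simp
  show "v + w \<in> K_span Q K B" if vw: "v \<in> K_span Q K B" "w \<in> K_span Q K B"
  proof -
    obtain c where c: "\<forall>b\<in>B. c b \<in> K" "v = (\<Sum>b\<in>B. qscale Q (c b) b)"
      using vw(1) unfolding K_span_def by (rule sum_space_E)
    obtain d where d: "\<forall>b\<in>B. d b \<in> K" "w = (\<Sum>b\<in>B. qscale Q (d b) b)"
      using vw(2) unfolding K_span_def by (rule sum_space_E)
    have "(\<Sum>b\<in>B. qscale Q (c b + d b) b) \<in> K_span Q K B"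
      unfolding K_span_def by (rule sum_space_memI) (use c d cl in simp)
    then show ?thesis unfolding c d by (simp add: V.scale_left_distrib sum.distrib)
  qed
  show "qscale Q a v \<in> K_span Q K B" if a: "a \<in> K" and v: "v \<in> K_span Q K B"
  proof -
    obtain c where c: "\<forall>b\<in>B. c b \<in> K" "v = (\<Sum>b\<in>B. qscale Q (c b) b)"
      using v unfolding K_span_def by (rule sum_space_E)
    have "(\<Sum>b\<in>B. qscale Q (a * c b) b) \<in> K_span Q K B"
      unfolding K_span_def by (rule sum_space_memI) (use c a cl in simp)
    then show ?thesis unfolding c by (simp add: V.scale_sum_right)
  qed
  show "b \<in> K_span Q K B" if b: "finite B" "b \<in> B"
  proof -
    define d where "d x = (if x = b then 1 else 0 :: 'k)" for x
    have "(\<Sum>x\<in>B. qscale Q (d x) x) \<in> K_span Q K B"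
      unfolding K_span_def by (rule sum_space_memI) (use cl d_def in simp)
    moreover have "(\<Sum>x\<in>B. qscale Q (d x) x) = (\<Sum>x\<in>B. if x = b then x else 0)"
      by (rule sum.cong) (simp_all add: d_def)
    ultimately show ?thesis using b by simp
  qed
qed

lemma K_span_minimal:
  assumes "finite B" "B \<subseteq> Z" "0 \<in> Z" "\<And>v w. v \<in> Z \<Longrightarrow> w \<in> Z \<Longrightarrow> v + w \<in> Z"
    "\<And>a v. a \<in> K \<Longrightarrow> v \<in> Z \<Longrightarrow> qscale Q a v \<in> Z"
  shows "K_span Q K B \<subseteq> Z"
proof
  fix v assume "v \<in> K_span Q K B"
  then obtain c where c: "\<forall>b\<in>B. c b \<in> K" "v = (\<Sum>b\<in>B. qscale Q (c b) b)"
    unfolding K_span_def by (rule sum_space_E)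
  have "(\<Sum>b\<in>B'. qscale Q (c b) b) \<in> Z" if "finite B'" "B' \<subseteq> B" for B'
    using that
  proof (induction B' rule: finite_induct)
    case (insert b B')
    then show ?case using assms c(1) by (auto simp: subset_iff)
  qed (use assms in simp)
  then show "v \<in> Z" using assms(1) c(2) by blast
qed

lemma K_span_le:
  assumes K: "subfield K ring_of_type_algebra" and V: "vector_space (qscale Q)"
    and "finite B" "B \<subseteq> K_span Q K C"
  shows "K_span Q K B \<subseteq> K_span Q K C"
  by (rule K_span_minimal[OF assms(3,4) K_span_closed(1,2,3)[OF K V]]; assumption)

lemma K_span_relation:
  fixes Q :: "('k::field, 'v::ab_group_add) qform"
  assumes K: "subfield K ring_of_type_algebra" and V: "vector_space (qscale Q)"
    and B: "finite B" "b \<in> B" and c: "\<forall>x\<in>B. c x \<in> K" "c b \<noteq> 0"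
  shows "b \<in> K_span Q K (insert (\<Sum>x\<in>B. qscale Q (c x) x) (B - {b}))"
proof -
  interpret V: vector_space "qscale Q" by (rule V)
  note cl = subfield_closed[OF K]
  define v where "v = (\<Sum>x\<in>B. qscale Q (c x) x)"
  define C where "C = insert v (B - {b})"
  have fC: "finite C" using B C_def by simp
  have "v = qscale Q (c b) b + (\<Sum>x\<in>B - {b}. qscale Q (c x) x)"
    unfolding v_def using B by (simp add: sum.remove)
  then have "qscale Q (c b) b = v + (\<Sum>x\<in>B - {b}. qscale Q (- c x) x)"
    by (simp add: sum_negf)
  then have "qscale Q (inverse (c b)) (qscale Q (c b) b) =
      qscale Q (inverse (c b)) (v + (\<Sum>x\<in>B - {b}. qscale Q (- c x) x))" by simp
  then have b: "b = qscale Q (inverse (c b)) (v + (\<Sum>x\<in>B - {b}. qscale Q (- c x) x))"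
    using c(2) by simp
  have "(\<Sum>x\<in>B - {b}. qscale Q (- c x) x) \<in> K_span Q K (B - {b})"
    unfolding K_span_def by (rule sum_space_memI) (use c cl in simp)
  moreover have "K_span Q K (B - {b}) \<subseteq> K_span Q K C"
    by (rule K_span_le[OF K V]) (use B fC C_def K_span_closed(4)[OF K V fC] in auto)
  moreover have "v \<in> K_span Q K C" using K_span_closed(4)[OF K V fC] C_def by simp
  ultimately have "v + (\<Sum>x\<in>B - {b}. qscale Q (- c x) x) \<in> K_span Q K C"
    using K_span_closed(2)[OF K V] by blast
  moreover have "inverse (c b) \<in> K" using cl(6)[of "c b"] c(1) B(2) by simp
  ultimately have "qscale Q (inverse (c b)) (v + (\<Sum>x\<in>B - {b}. qscale Q (- c x) x)) \<in> K_span Q K C"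
    using K_span_closed(3)[OF K V] by blast
  then show ?thesis using b unfolding C_def v_def by simp
qed

text \<open>
  \<open>B0\<close> is a basis of the subspace on which the form vanishes, and \<open>B1\<close> is a basis of an anisotropic
  complement: the values on \<open>B1\<close> are independent over \<open>K\<^sup>2\<close>.
\<close>

definition adapted_basis :: "'k set \<Rightarrow> ('k::field, 'v::ab_group_add) qform \<Rightarrow> 'v set \<Rightarrow> 'v set \<Rightarrow> bool" where
  "adapted_basis K Q B1 B0 \<longleftrightarrow>
     finite B1 \<and> finite B0 \<and> B1 \<subseteq> qspace Q \<and> B0 \<subseteq> qspace Q \<and> B1 \<inter> B0 = {} \<and>
     qspace Q = K_span Q K (B1 \<union> B0) \<and> (\<forall>b\<in>B0. qval Q b = 0) \<and>
     (\<forall>c. (\<forall>b\<in>B1. c b \<in> K) \<longrightarrow> (\<Sum>b\<in>B1. (c b)\<^sup>2 * qval Q b) = 0 \<longrightarrow> (\<forall>b\<in>B1. c b = 0)) \<and>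
     (\<forall>c. (\<forall>b\<in>B0. c b \<in> K) \<longrightarrow> (\<Sum>b\<in>B0. qscale Q (c b) b) = 0 \<longrightarrow> (\<forall>b\<in>B0. c b = 0))"

text \<open>
  Among the finite spanning sets \<open>B1 \<union> B0\<close> with \<open>B0\<close> consisting of vectors of value zero, one with
  \<open>B1\<close> smallest and then \<open>B0\<close> smallest is adapted.  Indeed, a relation \<open>\<Sum> c\<^sub>b\<^sup>2 q(b) = 0\<close> between the values
  on \<open>B1\<close> means that \<open>v = \<Sum> c\<^sub>b b\<close> has value zero, so one of the \<open>b\<close> can be traded for \<open>v\<close>, which goes into \<open>B0\<close>.
\<close>

lemma adapted_basis_exists:
  fixes Q :: "('k::field, 'v::ab_group_add) qform"
  assumes Q: "ts_qform K Q"
  shows "\<exists>B1 B0. adapted_basis K Q B1 B0"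
proof -
  note K = ts_qformD(1)[OF Q] and V = ts_qformD(2)[OF Q]
  interpret V: vector_space "qscale Q" by (rule V)
  define P where "P n m \<longleftrightarrow> (\<exists>B1 B0. finite B1 \<and> finite B0 \<and> B1 \<union> B0 \<subseteq> qspace Q \<and>
      (\<forall>b\<in>B0. qval Q b = 0) \<and> qspace Q \<subseteq> K_span Q K (B1 \<union> B0) \<and> card B1 = n \<and> card B0 = m)" for n m
  have PI: "P (card B1) (card B0)" if "finite B1" "finite B0" "B1 \<union> B0 \<subseteq> qspace Q"
    "\<forall>b\<in>B0. qval Q b = 0" "qspace Q \<subseteq> K_span Q K (B1 \<union> B0)" for B1 B0
    unfolding P_def using that by (intro exI[of _ B1] exI[of _ B0]) simp
  obtain B where B: "finite B" "B \<subseteq> qspace Q"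
    "\<forall>v\<in>qspace Q. \<exists>c. (\<forall>b\<in>B. c b \<in> K) \<and> v = (\<Sum>b\<in>B. qscale Q (c b) b)"
    using ts_qformD(6)[OF Q] by blast
  have "qspace Q \<subseteq> K_span Q K B" using B(3) unfolding K_span_def sum_space_def by auto
  then have "P (card B) (card ({} :: 'v set))" by (intro PI) (use B in auto)
  then have ex: "\<exists>n. \<exists>m. P n m" by blast
  define n where "n = (LEAST n. \<exists>m. P n m)"
  have n: "\<exists>m. P n m" unfolding n_def using ex by (rule LeastI_ex)
  have n_least: "n \<le> n'" if "P n' m'" for n' m' unfolding n_def by (rule Least_le) (use that in blast)
  define m where "m = (LEAST m. P n m)"
  have "P n m" unfolding m_def using n by (rule LeastI_ex)
  have m_least: "m \<le> m'" if "P n m'" for m' unfolding m_def by (rule Least_le) (use that in blast)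
  obtain B1 B0 where BB: "finite B1" "finite B0" "B1 \<union> B0 \<subseteq> qspace Q" "\<forall>b\<in>B0. qval Q b = 0"
      "qspace Q \<subseteq> K_span Q K (B1 \<union> B0)" "card B1 = n" "card B0 = m"
    using \<open>P n m\<close> unfolding P_def by auto
  have ind1: "\<forall>b\<in>B1. c b = 0" if c: "\<forall>b\<in>B1. c b \<in> K" "(\<Sum>b\<in>B1. (c b)\<^sup>2 * qval Q b) = 0" for c
  proof (rule ccontr)
    assume "\<not> (\<forall>b\<in>B1. c b = 0)"
    then obtain b where b: "b \<in> B1" "c b \<noteq> 0" by blast
    define v where "v = (\<Sum>x\<in>B1. qscale Q (c x) x)"
    have "v \<in> qspace Q \<and> qval Q v = (\<Sum>b\<in>B1. (c b)\<^sup>2 * qval Q b)"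
      unfolding v_def by (rule ts_qform_sum[OF Q BB(1)]) (use c BB in auto)
    then have v: "v \<in> qspace Q" "qval Q v = 0" using c by auto
    define C where "C = (B1 - {b}) \<union> insert v B0"
    have fC: "finite C" using BB C_def by simp
    have "K_span Q K (insert v (B1 - {b})) \<subseteq> K_span Q K C"
      by (rule K_span_le[OF K V]) (use BB fC C_def K_span_closed(4)[OF K V fC] in auto)
    then have "b \<in> K_span Q K C" using K_span_relation[OF K V BB(1) b(1) c(1) b(2)] unfolding v_def by blast
    then have "B1 \<union> B0 \<subseteq> K_span Q K C" using K_span_closed(4)[OF K V fC] unfolding C_def by auto
    then have "K_span Q K (B1 \<union> B0) \<subseteq> K_span Q K C" by (intro K_span_le[OF K V]) (use BB in auto)
    then have "P (card (B1 - {b})) (card (insert v B0))"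
      by (intro PI) (use BB v C_def in auto)
    then have "n \<le> card (B1 - {b})" by (rule n_least)
    then show False using b BB(1,6) card_Diff1_less[of B1 b] by simp
  qed
  have ind0: "\<forall>b\<in>B0. c b = 0" if c: "\<forall>b\<in>B0. c b \<in> K" "(\<Sum>b\<in>B0. qscale Q (c b) b) = 0" for c
  proof (rule ccontr)
    assume "\<not> (\<forall>b\<in>B0. c b = 0)"
    then obtain b where b: "b \<in> B0" "c b \<noteq> 0" by blast
    define C where "C = B1 \<union> (B0 - {b})"
    have fC: "finite C" using BB C_def by simp
    have "K_span Q K (insert 0 (B0 - {b})) \<subseteq> K_span Q K C"
      by (rule K_span_le[OF K V])
        (use BB fC C_def K_span_closed(1)[OF K V] K_span_closed(4)[OF K V fC] in auto)
    then have "b \<in> K_span Q K C" using K_span_relation[OF K V BB(2) b(1) c(1) b(2)] c(2) by auto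
    then have "B1 \<union> B0 \<subseteq> K_span Q K C" using K_span_closed(4)[OF K V fC] unfolding C_def by auto
    then have "K_span Q K (B1 \<union> B0) \<subseteq> K_span Q K C" by (intro K_span_le[OF K V]) (use BB in auto)
    then have "P (card B1) (card (B0 - {b}))"
      by (intro PI) (use BB C_def in auto)
    then have "m \<le> card (B0 - {b})" using m_least BB(6) by blast
    then show False using b BB(2,7) card_Diff1_less[of B0 b] by simp
  qed
  have "B1 \<inter> B0 = {}"
  proof (rule ccontr)
    assume "B1 \<inter> B0 \<noteq> {}"
    then obtain b where b: "b \<in> B1" "b \<in> B0" by blast
    define d where "d x = (if x = b then 1 else 0 :: 'k)" for x
    have "(\<Sum>x\<in>B1. (d x)\<^sup>2 * qval Q x) = 0"
      by (rule sum.neutral) (use BB(4) b d_def in auto)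
    moreover have "\<forall>x\<in>B1. d x \<in> K" using subfield_closed[OF K] d_def by simp
    ultimately have "d b = 0" using ind1 b by blast
    then show False by (simp add: d_def)
  qed
  moreover have "K_span Q K (B1 \<union> B0) \<subseteq> qspace Q"
    by (rule K_span_minimal) (use BB ts_qformD(3-5)[OF Q] in auto)
  ultimately have "adapted_basis K Q B1 B0"
    unfolding adapted_basis_def using BB ind1 ind0 by auto
  then show ?thesis by blast
qed

text \<open>
  Taking the value of a vanishing combination isolates the coefficients at \<open>B1\<close>.
\<close>

lemma adapted_basis_independent:
  fixes Q :: "('k::field, 'v::ab_group_add) qform"
  assumes Q: "ts_qform K Q" and B: "adapted_basis K Q B1 B0"
    and c: "\<forall>b\<in>B1 \<union> B0. c b \<in> K" "(\<Sum>b\<in>B1 \<union> B0. qscale Q (c b) b) = 0"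
  shows "\<forall>b\<in>B1 \<union> B0. c b = 0"
proof -
  interpret V: vector_space "qscale Q" by (rule ts_qformD(2)[OF Q])
  have fin: "finite B1" "finite B0" "B1 \<inter> B0 = {}" "B1 \<union> B0 \<subseteq> qspace Q" using B unfolding adapted_basis_def by auto
  have "qval Q (\<Sum>b\<in>B1 \<union> B0. qscale Q (c b) b) = (\<Sum>b\<in>B1 \<union> B0. (c b)\<^sup>2 * qval Q b)"
    using ts_qform_sum[OF Q, of "B1 \<union> B0" c "\<lambda>b. b"] fin c by auto
  moreover have "(\<Sum>b\<in>B0. (c b)\<^sup>2 * qval Q b) = 0"
    by (rule sum.neutral) (use B in \<open>auto simp: adapted_basis_def\<close>)
  ultimately have "(\<Sum>b\<in>B1. (c b)\<^sup>2 * qval Q b) = 0"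
    using c(2) ts_qform_0[OF Q] fin by (simp add: sum.union_disjoint)
  then have 1: "\<forall>b\<in>B1. c b = 0" using B c(1) unfolding adapted_basis_def by auto
  then have "(\<Sum>b\<in>B0. qscale Q (c b) b) = 0" using c(2) fin by (simp add: sum.union_disjoint)
  then have "\<forall>b\<in>B0. c b = 0" using B c(1) unfolding adapted_basis_def by auto
  then show ?thesis using 1 by blast
qed

section \<open>The anisotropic part\<close>

lemma sum_fun_eval: "(\<Sum>i\<in>I. f i) j = (\<Sum>i\<in>I. (f i j :: 'b::comm_monoid_add))"
  by (induction I rule: infinite_finite_induct) simp_all

lemma linear_over_0:
  assumes "linear_over K P Q f" "0 \<in> qspace P"
  shows "f 0 = 0"
proof -
  have "f (0 + 0) = f 0 + f 0" using assms unfolding linear_over_def by blast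
  then have "f 0 + f 0 = f 0 + 0" by simp
  then show ?thesis by (simp only: add_left_cancel)
qed

lemma linear_over_sum:
  assumes P: "ts_qform K P" and f: "linear_over K P Q f" and "finite I"
    and "\<And>i. i \<in> I \<Longrightarrow> c i \<in> K \<and> v i \<in> qspace P"
  shows "f (\<Sum>i\<in>I. qscale P (c i) (v i)) = (\<Sum>i\<in>I. qscale Q (c i) (f (v i)))"
  using assms(3,4)
proof (induction I rule: finite_induct)
  case empty
  then show ?case using linear_over_0[OF f ts_qformD(3)[OF P]] by simp
next
  case (insert i I)
  have 1: "qscale P (c i) (v i) \<in> qspace P" using insert.prems ts_qformD(5)[OF P] by simp
  have 2: "(\<Sum>i\<in>I. qscale P (c i) (v i)) \<in> qspace P"
    using ts_qform_sum[OF P insert.hyps(1), of c v] insert.prems by simp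
  have "f (qscale P (c i) (v i) + (\<Sum>i\<in>I. qscale P (c i) (v i))) =
      f (qscale P (c i) (v i)) + f (\<Sum>i\<in>I. qscale P (c i) (v i))"
    using f 1 2 by (simp add: linear_over_def)
  moreover have "f (qscale P (c i) (v i)) = qscale Q (c i) (f (v i))"
    using f insert.prems by (simp add: linear_over_def)
  ultimately show ?case using insert by simp
qed

lemma isometric_by_inverse:
  assumes G: "linear_over K P Q g" "bij_betw g (qspace P) (qspace Q)"
      "\<And>v. v \<in> qspace P \<Longrightarrow> qval P v = qval Q (g v)"
    and add: "\<And>v w. v \<in> qspace P \<Longrightarrow> w \<in> qspace P \<Longrightarrow> v + w \<in> qspace P"
    and scale: "\<And>a v. a \<in> K \<Longrightarrow> v \<in> qspace P \<Longrightarrow> qscale P a v \<in> qspace P"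
  shows "isometric K Q P"
proof -
  define f where "f = inv_into (qspace P) g"
  have gf: "g (f v) = v" if "v \<in> qspace Q" for v
    unfolding f_def using bij_betw_inv_into_right[OF G(2) that] .
  have fg: "f (g v) = v" if "v \<in> qspace P" for v
    unfolding f_def using bij_betw_inv_into_left[OF G(2) that] .
  have fbij: "bij_betw f (qspace Q) (qspace P)" unfolding f_def by (rule bij_betw_inv_into[OF G(2)])
  have fin: "f v \<in> qspace P" if "v \<in> qspace Q" for v using fbij that bij_betwE by blast
  have "linear_over K Q P f"
    unfolding linear_over_def
  proof (intro conjI ballI)
    show "f ` qspace Q \<subseteq> qspace P" using fin by blast
  next
    fix v w assume vw: "v \<in> qspace Q" "w \<in> qspace Q"
    have "g (f v + f w) = v + w" using G(1) fin vw gf by (simp add: linear_over_def)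
    then show "f (v + w) = f v + f w" using fg[OF add[OF fin[OF vw(1)] fin[OF vw(2)]]] by simp
  next
    fix a v assume av: "a \<in> K" "v \<in> qspace Q"
    have "g (qscale P a (f v)) = qscale Q a v" using G(1) fin av gf by (simp add: linear_over_def)
    then show "f (qscale Q a v) = qscale P a (f v)" using fg[OF scale[OF av(1) fin[OF av(2)]]] by simp
  qed
  moreover have "\<forall>v\<in>qspace Q. qval Q v = qval P (f v)" using G(3) fin gf by simp
  ultimately show ?thesis unfolding isometric_def using fbij by blast
qed

lemma adapted_basisD:
  assumes "adapted_basis K Q B1 B0"
  shows "finite B1" "finite B0" "B1 \<subseteq> qspace Q" "B0 \<subseteq> qspace Q" "B1 \<inter> B0 = {}"
    "qspace Q = K_span Q K (B1 \<union> B0)" "\<And>b. b \<in> B0 \<Longrightarrow> qval Q b = 0"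
    "\<And>c. \<forall>b\<in>B1. c b \<in> K \<Longrightarrow> (\<Sum>b\<in>B1. (c b)\<^sup>2 * qval Q b) = 0 \<Longrightarrow> \<forall>b\<in>B1. c b = 0"
    "\<And>c. \<forall>b\<in>B0. c b \<in> K \<Longrightarrow> (\<Sum>b\<in>B0. qscale Q (c b) b) = 0 \<Longrightarrow> \<forall>b\<in>B0. c b = 0"
proof -
  note a = assms[unfolded adapted_basis_def]
  show "finite B1" "finite B0" "B1 \<subseteq> qspace Q" "B0 \<subseteq> qspace Q" "B1 \<inter> B0 = {}"
    "qspace Q = K_span Q K (B1 \<union> B0)"
    by (insert a, (elim conjE, assumption)+)
  show "\<And>b. b \<in> B0 \<Longrightarrow> qval Q b = 0"
    "\<And>c. \<forall>b\<in>B1. c b \<in> K \<Longrightarrow> (\<Sum>b\<in>B1. (c b)\<^sup>2 * qval Q b) = 0 \<Longrightarrow> \<forall>b\<in>B1. c b = 0"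
    "\<And>c. \<forall>b\<in>B0. c b \<in> K \<Longrightarrow> (\<Sum>b\<in>B0. qscale Q (c b) b) = 0 \<Longrightarrow> \<forall>b\<in>B0. c b = 0"
    by (insert a, (elim conjE, simp)+)
qed

lemma adapted_basis_decompose:
  assumes Q: "ts_qform K Q" and B: "adapted_basis K Q B1 B0" and v: "v \<in> qspace Q"
  obtains c where "\<forall>b\<in>B1 \<union> B0. c b \<in> K"
    "v = (\<Sum>b\<in>B1. qscale Q (c b) b) + (\<Sum>b\<in>B0. qscale Q (c b) b)"
    "qval Q v = (\<Sum>b\<in>B1. (c b)\<^sup>2 * qval Q b)"
proof -
  note D = adapted_basisD[OF B]
  obtain c where c: "\<forall>b\<in>B1 \<union> B0. c b \<in> K" "v = (\<Sum>b\<in>B1 \<union> B0. qscale Q (c b) b)"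
    using v unfolding D(6) K_span_def by (rule sum_space_E)
  have "qval Q v = (\<Sum>b\<in>B1 \<union> B0. (c b)\<^sup>2 * qval Q b)"
    using ts_qform_sum[OF Q, of "B1 \<union> B0" c "\<lambda>b. b"] D(1-4) c by auto
  also have "\<dots> = (\<Sum>b\<in>B1. (c b)\<^sup>2 * qval Q b) + (\<Sum>b\<in>B0. (c b)\<^sup>2 * qval Q b)"
    by (rule sum.union_disjoint) (use D in simp_all)
  also have "(\<Sum>b\<in>B0. (c b)\<^sup>2 * qval Q b) = 0" using D(7) by simp
  finally have "qval Q v = (\<Sum>b\<in>B1. (c b)\<^sup>2 * qval Q b)" by simp
  moreover have "v = (\<Sum>b\<in>B1. qscale Q (c b) b) + (\<Sum>b\<in>B0. qscale Q (c b) b)"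
    unfolding c(2) by (rule sum.union_disjoint) (use D in simp_all)
  ultimately show ?thesis using that c(1) by blast
qed

text \<open>
  The value only involves the coordinates at \<open>B1\<close>, and it vanishes only if all of these do.
\<close>

lemma isotropic_vectors_eq:
  assumes Q: "ts_qform K Q" and B: "adapted_basis K Q B1 B0"
  shows "{v \<in> qspace Q. qval Q v = 0} = K_span Q K B0"
proof
  note D = adapted_basisD[OF B]
  interpret V: vector_space "qscale Q" by (rule ts_qformD(2)[OF Q])
  show "{v \<in> qspace Q. qval Q v = 0} \<subseteq> K_span Q K B0"
  proof
    fix v assume v: "v \<in> {v \<in> qspace Q. qval Q v = 0}"
    then have "v \<in> qspace Q" by simp
    then obtain c where c: "\<forall>b\<in>B1 \<union> B0. c b \<in> K"
      "v = (\<Sum>b\<in>B1. qscale Q (c b) b) + (\<Sum>b\<in>B0. qscale Q (c b) b)"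
      "qval Q v = (\<Sum>b\<in>B1. (c b)\<^sup>2 * qval Q b)"
      by (rule adapted_basis_decompose[OF Q B])
    have "\<forall>b\<in>B1. c b = 0" by (rule D(8)) (use c v in auto)
    then have "v = (\<Sum>b\<in>B0. qscale Q (c b) b)" using c(2) by simp
    moreover have "(\<Sum>b\<in>B0. qscale Q (c b) b) \<in> K_span Q K B0"
      unfolding K_span_def by (rule sum_space_memI) (use c(1) in simp)
    ultimately show "v \<in> K_span Q K B0" by simp
  qed
  show "K_span Q K B0 \<subseteq> {v \<in> qspace Q. qval Q v = 0}"
  proof
    fix v assume "v \<in> K_span Q K B0"
    then obtain c where c: "\<forall>b\<in>B0. c b \<in> K" "v = (\<Sum>b\<in>B0. qscale Q (c b) b)"
      unfolding K_span_def by (rule sum_space_E)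
    have "v \<in> qspace Q \<and> qval Q v = (\<Sum>b\<in>B0. (c b)\<^sup>2 * qval Q b)"
      unfolding c(2) by (rule ts_qform_sum[OF Q D(2)]) (use c D(4) in auto)
    then show "v \<in> {v \<in> qspace Q. qval Q v = 0}" using D(7) by simp
  qed
qed

lemma anisotropic_part:
  fixes Q :: "('k::field, 'v::ab_group_add) qform"
  assumes Q: "ts_qform K Q" and B: "adapted_basis K Q B1 B0"
  defines "A \<equiv> Q\<lparr>qspace := K_span Q K B1\<rparr>"
  shows "ts_qform K A" "anisotropic A"
proof -
  note D = adapted_basisD[OF B]
  note K = ts_qformD(1)[OF Q] and V = ts_qformD(2)[OF Q]
  interpret V: vector_space "qscale Q" by (rule V)
  have A: "qspace A = K_span Q K B1" "qscale A = qscale Q" "qval A = qval Q" by (simp_all add: A_def)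
  have sub: "K_span Q K B1 \<subseteq> qspace Q"
    by (rule K_span_minimal[OF D(1,3) ts_qformD(3,4,5)[OF Q]]; assumption)
  show "ts_qform K A"
    unfolding ts_qform_def A
  proof (intro conjI ballI)
    show "subfield K ring_of_type_algebra" "vector_space (qscale Q)" by (rule K, rule V)
    show "0 \<in> K_span Q K B1" by (rule K_span_closed(1)[OF K V])
    show "\<And>v w. v \<in> K_span Q K B1 \<Longrightarrow> w \<in> K_span Q K B1 \<Longrightarrow> v + w \<in> K_span Q K B1"
      by (rule K_span_closed(2)[OF K V])
    show "\<And>a v. a \<in> K \<Longrightarrow> v \<in> K_span Q K B1 \<Longrightarrow> qscale Q a v \<in> K_span Q K B1"
      by (rule K_span_closed(3)[OF K V])
    show "\<exists>B. finite B \<and> B \<subseteq> K_span Q K B1 \<and>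
      (\<forall>v\<in>K_span Q K B1. \<exists>c. (\<forall>b\<in>B. c b \<in> K) \<and> v = (\<Sum>b\<in>B. qscale Q (c b) b))"
    proof (intro exI[of _ B1] conjI ballI)
      show "finite B1" by (rule D)
      show "B1 \<subseteq> K_span Q K B1" using K_span_closed(4)[OF K V D(1)] by blast
      fix v assume "v \<in> K_span Q K B1"
      then show "\<exists>c. (\<forall>b\<in>B1. c b \<in> K) \<and> v = (\<Sum>b\<in>B1. qscale Q (c b) b)"
        unfolding K_span_def sum_space_def by auto
    qed
    show "\<And>v. v \<in> K_span Q K B1 \<Longrightarrow> qval Q v \<in> K" using sub ts_qformD(7)[OF Q] by auto
    show "\<And>a v. a \<in> K \<Longrightarrow> v \<in> K_span Q K B1 \<Longrightarrow> qval Q (qscale Q a v) = a\<^sup>2 * qval Q v"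
      using sub ts_qformD(8)[OF Q] by auto
    show "\<And>v w. v \<in> K_span Q K B1 \<Longrightarrow> w \<in> K_span Q K B1 \<Longrightarrow> qval Q (v + w) = qval Q v + qval Q w"
      using sub ts_qformD(9)[OF Q] by auto
  qed
  show "anisotropic A"
    unfolding anisotropic_def A
  proof (intro ballI impI notI)
    fix v assume v: "v \<in> K_span Q K B1" "v \<noteq> 0" "qval Q v = 0"
    obtain c where c: "\<forall>b\<in>B1. c b \<in> K" "v = (\<Sum>b\<in>B1. qscale Q (c b) b)"
      using v(1) unfolding K_span_def by (rule sum_space_E)
    have "qval Q v = (\<Sum>b\<in>B1. (c b)\<^sup>2 * qval Q b)"
      unfolding c(2) using ts_qform_sum[OF Q D(1), of c "\<lambda>b. b"] c(1) D(3) by auto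
    then have "\<forall>b\<in>B1. c b = 0" using D(8)[OF c(1)] v(3) by simp
    then have "v = 0" using c(2) by simp
    then show False using v(2) by simp
  qed
qed

text \<open>
  Splitting off \<open>B0\<close> realises the decomposition that defines the defect; the number of zero coefficients is
  the size of \<open>B0\<close>.
\<close>

lemma isometric_anisotropic_part:
  fixes Q :: "('k::field, 'v::ab_group_add) qform"
  assumes Q: "ts_qform K Q" and B: "adapted_basis K Q B1 B0"
  shows "isometric K Q (orth_sum (Q\<lparr>qspace := K_span Q K B1\<rparr>) (diag K (replicate (card B0) 0)))"
proof -
  note D = adapted_basisD[OF B]
  note K = ts_qformD(1)[OF Q] and V = ts_qformD(2)[OF Q]
  interpret V: vector_space "qscale Q" by (rule V)
  define k where "k = card B0"
  define A where "A = Q\<lparr>qspace := K_span Q K B1\<rparr>"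
  note An = anisotropic_part[OF Q B, folded A_def]
  define P where "P = orth_sum A (diag K (replicate k 0))"
  have A: "qspace A = K_span Q K B1" "qscale A = qscale Q" "qval A = qval Q" by (simp_all add: A_def)
  have sub: "K_span Q K B1 \<subseteq> qspace Q"
    by (rule K_span_minimal[OF D(1,3) ts_qformD(3,4,5)[OF Q]]; assumption)
  have Psp: "(w, x) \<in> qspace P \<longleftrightarrow> w \<in> K_span Q K B1 \<and> (\<forall>i<k. x i \<in> K) \<and> (\<forall>i\<ge>k. x i = 0)" for w x
    by (simp add: P_def orth_sum_def diag_def A)
  have Psc: "qscale P a (w, x) = (qscale Q a w, \<lambda>i. a * x i)" for a w x
    by (simp add: P_def orth_sum_def diag_def A)
  have Pval: "qval P (w, x) = qval Q w" for w x
    by (simp add: P_def orth_sum_def diag_def A)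
  obtain \<beta> where \<beta>: "bij_betw \<beta> {..<k} B0"
    using ex_bij_betw_nat_finite[OF D(2)] unfolding k_def by (auto simp: lessThan_atLeast0)
  have \<beta>B: "\<beta> i \<in> B0" if "i < k" for i using \<beta> that bij_betwE by blast
  have sumV: "(\<Sum>i<k. qscale Q (x i) (\<beta> i)) \<in> qspace Q \<and> qval Q (\<Sum>i<k. qscale Q (x i) (\<beta> i)) = 0"
    if "\<forall>i<k. x i \<in> K" for x
  proof -
    have "(\<Sum>i<k. qscale Q (x i) (\<beta> i)) \<in> qspace Q \<and>
        qval Q (\<Sum>i<k. qscale Q (x i) (\<beta> i)) = (\<Sum>i<k. (x i)\<^sup>2 * qval Q (\<beta> i))"
      by (rule ts_qform_sum[OF Q]) (use that \<beta>B D(4) in auto)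
    then show ?thesis using \<beta>B D(7) by simp
  qed
  have ind: "\<forall>i<k. x i = 0" if x: "\<forall>i<k. x i \<in> K" "(\<Sum>i<k. qscale Q (x i) (\<beta> i)) = 0" for x
  proof -
    define y where "y b = x (inv_into {..<k} \<beta> b)" for b
    have y\<beta>: "y (\<beta> i) = x i" if "i < k" for i
      unfolding y_def using bij_betw_inv_into_left[OF \<beta>, of i] that by simp
    have "(\<Sum>b\<in>B0. qscale Q (y b) b) = (\<Sum>i<k. qscale Q (y (\<beta> i)) (\<beta> i))"
      by (rule sum.reindex_bij_betw[OF \<beta>, symmetric])
    also have "\<dots> = (\<Sum>i<k. qscale Q (x i) (\<beta> i))" using y\<beta> by simp
    finally have 0: "(\<Sum>b\<in>B0. qscale Q (y b) b) = 0" using x(2) by simp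
    have "\<forall>b\<in>B0. y b \<in> K"
    proof
      fix b assume "b \<in> B0"
      then obtain i where "i < k" "b = \<beta> i" using \<beta> unfolding bij_betw_def by auto
      then show "y b \<in> K" using y\<beta> x(1) by simp
    qed
    then have "\<forall>b\<in>B0. y b = 0" using D(9) 0 by blast
    then show ?thesis using y\<beta> \<beta>B by metis
  qed
  define G where "G = (\<lambda>(w, x). w + (\<Sum>i<k. qscale Q (x i) (\<beta> i)))"
  have G: "G (w, x) = w + (\<Sum>i<k. qscale Q (x i) (\<beta> i))" for w x by (simp add: G_def)
  have Gin: "G p \<in> qspace Q" "qval Q (G p) = qval P p" if "p \<in> qspace P" for p
  proof -
    obtain w x where p: "p = (w, x)" by (cases p)
    have wx: "w \<in> qspace Q" "\<forall>i<k. x i \<in> K" using that p Psp sub by auto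
    show "G p \<in> qspace Q" unfolding p G using ts_qformD(4)[OF Q wx(1)] sumV[OF wx(2)] by blast
    show "qval Q (G p) = qval P p" unfolding p G Pval
      using ts_qformD(9)[OF Q wx(1)] sumV[OF wx(2)] by simp
  qed
  have Glin: "linear_over K P Q G"
    unfolding linear_over_def
  proof (intro conjI ballI)
    show "G ` qspace P \<subseteq> qspace Q" using Gin by blast
  next
    fix p q
    show "G (p + q) = G p + G q"
      by (cases p; cases q) (simp add: G V.scale_left_distrib sum.distrib add_ac)
  next
    fix a p
    show "G (qscale P a p) = qscale Q a (G p)"
      by (cases p) (simp add: G Psc V.scale_right_distrib V.scale_sum_right)
  qed
  have "bij_betw G (qspace P) (qspace Q)"
  proof (rule bij_betw_imageI)
    show "inj_on G (qspace P)"
    proof (rule inj_onI)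
      fix p q assume pq: "p \<in> qspace P" "q \<in> qspace P" "G p = G q"
      obtain w x where p: "p = (w, x)" by (cases p)
      obtain w' x' where q: "q = (w', x')" by (cases q)
      have w: "w \<in> K_span Q K B1" "w' \<in> K_span Q K B1" and x: "\<forall>i<k. x i \<in> K" "\<forall>i<k. x' i \<in> K"
        "\<forall>i\<ge>k. x i = 0" "\<forall>i\<ge>k. x' i = 0"
        using pq p q Psp by auto
      have m1: "- 1 \<in> K" using subfield_closed(5)[OF K subfield_closed(2)[OF K]] .
      have nw: "qscale Q (- 1) w' \<in> K_span Q K B1" using K_span_closed(3)[OF K V m1 w(2)] .
      have "qval Q w = qval Q w'" using Gin(2)[OF pq(1)] Gin(2)[OF pq(2)] pq(3) p q Pval by simp
      moreover have "qval Q (w + qscale Q (- 1) w') = qval Q w + qval Q (qscale Q (- 1) w')"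
        using ts_qformD(9)[OF Q, of w "qscale Q (- 1) w'"] w(1) nw sub by blast
      moreover have sc: "qval Q (qscale Q a w') = a\<^sup>2 * qval Q w'" if "a \<in> K" for a
        using ts_qformD(8)[OF Q that, of w'] w(2) sub by blast
      have w'Q: "w' \<in> qspace Q" using w sub by blast
      have "qscale Q (- 1) w' + w' = 0" by simp
      then have "qval Q (qscale Q (- 1) w') + qval Q w' = 0"
        using ts_qformD(9)[OF Q, of "qscale Q (- 1) w'" w'] nw sub w'Q ts_qform_0[OF Q] by auto
      ultimately have "qval Q (w + qscale Q (- 1) w') = 0" by (simp add: add.commute)
      moreover have "w + qscale Q (- 1) w' \<in> K_span Q K B1" by (rule K_span_closed(2)[OF K V w(1) nw])
      ultimately have "w + qscale Q (- 1) w' = 0" using An(2) unfolding anisotropic_def A by blast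
      then have ww: "w = w'" by simp
      have "(\<Sum>i<k. qscale Q (x i) (\<beta> i)) = (\<Sum>i<k. qscale Q (x' i) (\<beta> i))"
        using pq(3) unfolding p q G ww by simp
      then have "(\<Sum>i<k. qscale Q (x i + - x' i) (\<beta> i)) = 0"
        by (simp add: V.scale_left_diff_distrib sum_subtractf)
      moreover have "\<forall>i<k. x i + - x' i \<in> K"
        using x(1,2) subfield_closed(3)[OF K] subfield_closed(5)[OF K] by blast
      ultimately have "\<forall>i<k. x i + - x' i = 0" using ind[of "\<lambda>i. x i + - x' i"] by blast
      then have "x i = x' i" for i using x(3,4) by (cases "i < k") auto
      then show "p = q" unfolding p q ww by auto
    qed
    show "G ` qspace P = qspace Q"
    proof
      show "G ` qspace P \<subseteq> qspace Q" using Gin by blast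
      show "qspace Q \<subseteq> G ` qspace P"
      proof
        fix v assume "v \<in> qspace Q"
        then obtain c where c: "\<forall>b\<in>B1 \<union> B0. c b \<in> K"
          "v = (\<Sum>b\<in>B1. qscale Q (c b) b) + (\<Sum>b\<in>B0. qscale Q (c b) b)"
          "qval Q v = (\<Sum>b\<in>B1. (c b)\<^sup>2 * qval Q b)"
          by (rule adapted_basis_decompose[OF Q B])
        define w where "w = (\<Sum>b\<in>B1. qscale Q (c b) b)"
        define x where "x i = (if i < k then c (\<beta> i) else 0)" for i
        have "w \<in> K_span Q K B1" unfolding w_def K_span_def by (rule sum_space_memI) (use c in auto)
        then have "(w, x) \<in> qspace P" unfolding Psp using c(1) \<beta>B by (simp add: x_def)
        moreover have "(\<Sum>b\<in>B0. qscale Q (c b) b) = (\<Sum>i<k. qscale Q (c (\<beta> i)) (\<beta> i))"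
          by (rule sum.reindex_bij_betw[OF \<beta>, symmetric])
        then have "v = G (w, x)" unfolding c(2) G w_def x_def by simp
        ultimately show "v \<in> G ` qspace P" by blast
      qed
    qed
  qed
  then have "isometric K Q P"
  proof (rule isometric_by_inverse[OF Glin])
    show "qval P v = qval Q (G v)" if "v \<in> qspace P" for v using Gin(2)[OF that] by simp
    show "v + w \<in> qspace P" if "v \<in> qspace P" "w \<in> qspace P" for v w
      using that K_span_closed(2)[OF K V] subfield_closed(3)[OF K] by (cases v; cases w) (simp add: Psp)
    show "qscale P a v \<in> qspace P" if "a \<in> K" "v \<in> qspace P" for a v
      using that K_span_closed(3)[OF K V] subfield_closed(4)[OF K] by (cases v) (simp add: Psp Psc)
  qed
  then show ?thesis unfolding P_def A_def k_def .
qed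

section \<open>Counting the defect over a finite extension\<close>

text \<open>
  \<open>K\<close> is a finite extension of \<open>F\<close> embedded by \<open>h\<close>.  It is a subset of a type, so the dimension of a
  \<open>K\<close>-space is measured as its dimension over \<open>F\<close>, which is the degree of \<open>K\<close> times
  its dimension over \<open>K\<close>.
\<close>

locale finite_extension = char_two F for F :: "'a::field itself" +
  fixes h :: "'a \<Rightarrow> 'k::field" and K :: "'k set"
  assumes h_add: "h (x + y) = h x + h y" and h_mult: "h (x * y) = h x * h y" and h_1: "h 1 = 1"
    and subfield_K: "subfield K ring_of_type_algebra" and h_in_K: "h x \<in> K"
    and fin_dim_K: "fin_dim (\<lambda>a x. h a * x) K"
begin

definition degree :: nat where
  "degree = vector_space.dim (\<lambda>a x. h a * x) K"

lemma two_K [simp]: "(2::'k) = 0"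
proof -
  have "h (1 + 1) = 1 + 1" unfolding h_add h_1 ..
  moreover have "h 0 + h 0 = h 0 + 0" using h_add[of 0 0] by simp
  then have "h 0 = 0" by (simp only: add_left_cancel)
  ultimately show ?thesis by simp
qed

lemma sq_add_K: "(x + y)\<^sup>2 = x\<^sup>2 + (y::'k)\<^sup>2"
  by (simp add: power2_sum)

lemma vector_space_mult: "vector_space (\<lambda>a (x::'k). h a * x)"
  by unfold_locales (simp_all add: h_add h_mult h_1 algebra_simps)

lemma vector_space_square_mult: "vector_space (\<lambda>a (x::'k). (h a)\<^sup>2 * x)"
  by unfold_locales (simp_all add: h_add h_mult h_1 sq_add_K algebra_simps power_mult_distrib)

lemma vector_space_restrict:
  assumes "vector_space sc" shows "vector_space (\<lambda>a. sc (h a))"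
proof -
  interpret V: vector_space sc by (rule assms)
  show ?thesis
    by unfold_locales (simp_all add: h_add h_mult h_1 V.scale_left_distrib V.scale_right_distrib)
qed

lemma subspace_K: "module.subspace (\<lambda>a x. h a * x) K"
proof -
  interpret M: vector_space "\<lambda>a (x::'k). h a * x" by (rule vector_space_mult)
  show ?thesis unfolding M.subspace_def
    using subfield_closed(1)[OF subfield_K] subfield_closed(3,4)[OF subfield_K] h_in_K by blast
qed

lemma degree_pos: "degree > 0"
proof (rule ccontr)
  interpret M: vector_space "\<lambda>a (x::'k). h a * x" by (rule vector_space_mult)
  assume "\<not> degree > 0"
  then have "K = {0}" using M.fin_dim_dim_eq_0[OF fin_dim_K subspace_K] unfolding degree_def by simp
  then show False using subfield_closed(2)[OF subfield_K] by simp
qed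

lemma dim_sum_of_lines:
  assumes V: "vector_space (qscale Q)" and "finite I"
    and ind: "\<And>c. \<forall>i\<in>I. c i \<in> K \<Longrightarrow> (\<Sum>i\<in>I. qscale Q (c i) (v i)) = 0 \<Longrightarrow> \<forall>i\<in>I. c i = 0"
  shows "vector_space.dim (\<lambda>a. qscale Q (h a)) (sum_space (\<lambda>i c. qscale Q c (v i)) K I) = card I * degree"
proof -
  interpret V: vector_space "qscale Q" by (rule V)
  interpret vector_space_pair "\<lambda>a (x::'k). h a * x" "\<lambda>a. qscale Q (h a)"
    by (intro vector_space_pair.intro vector_space_mult vector_space_restrict V)
  have lin: "Vector_Spaces.linear (\<lambda>a (x::'k). h a * x) (\<lambda>a. qscale Q (h a)) (\<lambda>c. qscale Q c (v i))" for i
    unfolding Vector_Spaces.linear_iff using vector_space_mult vector_space_restrict[OF V]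
    by (simp add: V.scale_left_distrib)
  show ?thesis unfolding degree_def
    using dim_sum_space[OF subspace_K fin_dim_K assms(2), of "\<lambda>i c. qscale Q c (v i)"] lin ind by blast
qed

lemma dim_K_span:
  assumes "vector_space (qscale Q)" and "finite B"
    and "\<And>c. \<forall>b\<in>B. c b \<in> K \<Longrightarrow> (\<Sum>b\<in>B. qscale Q (c b) b) = 0 \<Longrightarrow> \<forall>b\<in>B. c b = 0"
  shows "vector_space.dim (\<lambda>a. qscale Q (h a)) (K_span Q K B) = card B * degree"
  unfolding K_span_def by (rule dim_sum_of_lines[OF assms])

lemma adapted_basis_dims:
  assumes Q: "ts_qform K Q" and B: "adapted_basis K Q B1 B0"
  shows "vector_space.dim (\<lambda>a. qscale Q (h a)) (qspace Q) = (card B1 + card B0) * degree"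
    "vector_space.dim (\<lambda>a. qscale Q (h a)) {v \<in> qspace Q. qval Q v = 0} = card B0 * degree"
    "vector_space.dim (\<lambda>a x. (h a)\<^sup>2 * x) (qval Q ` qspace Q) = card B1 * degree"
    "fin_dim (\<lambda>a x. (h a)\<^sup>2 * x) (qval Q ` qspace Q)"
proof -
  note D = adapted_basisD[OF B]
  note V = ts_qformD(2)[OF Q]
  interpret V: vector_space "qscale Q" by (rule V)
  have "vector_space.dim (\<lambda>a. qscale Q (h a)) (K_span Q K (B1 \<union> B0)) = card (B1 \<union> B0) * degree"
    by (rule dim_K_span[OF V]) (use D(1,2) adapted_basis_independent[OF Q B] in auto)
  then show "vector_space.dim (\<lambda>a. qscale Q (h a)) (qspace Q) = (card B1 + card B0) * degree"
    unfolding D(6)[symmetric] using card_Un_disjoint[OF D(1,2,5)] by simp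
  show "vector_space.dim (\<lambda>a. qscale Q (h a)) {v \<in> qspace Q. qval Q v = 0} = card B0 * degree"
    unfolding isotropic_vectors_eq[OF Q B] by (rule dim_K_span[OF V D(2) D(9)])
  interpret vector_space_pair "\<lambda>a (x::'k). h a * x" "\<lambda>a (x::'k). (h a)\<^sup>2 * x"
    by (intro vector_space_pair.intro vector_space_mult vector_space_square_mult)
  have lin: "Vector_Spaces.linear (\<lambda>a (x::'k). h a * x) (\<lambda>a (x::'k). (h a)\<^sup>2 * x) (\<lambda>c. c\<^sup>2 * d)" for d
    unfolding Vector_Spaces.linear_iff
    by (intro conjI vector_space_mult vector_space_square_mult)
      (simp_all add: sq_add_K algebra_simps power_mult_distrib)
  have img: "qval Q ` qspace Q = sum_space (\<lambda>b c. c\<^sup>2 * qval Q b) K B1"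
  proof
    show "qval Q ` qspace Q \<subseteq> sum_space (\<lambda>b c. c\<^sup>2 * qval Q b) K B1"
    proof (rule image_subsetI)
      fix v assume "v \<in> qspace Q"
      then obtain c where c: "\<forall>b\<in>B1 \<union> B0. c b \<in> K"
        "v = (\<Sum>b\<in>B1. qscale Q (c b) b) + (\<Sum>b\<in>B0. qscale Q (c b) b)"
        "qval Q v = (\<Sum>b\<in>B1. (c b)\<^sup>2 * qval Q b)"
        by (rule adapted_basis_decompose[OF Q B])
      show "qval Q v \<in> sum_space (\<lambda>b c. c\<^sup>2 * qval Q b) K B1"
        unfolding c(3) by (rule sum_space_memI) (use c(1) in simp)
    qed
    show "sum_space (\<lambda>b c. c\<^sup>2 * qval Q b) K B1 \<subseteq> qval Q ` qspace Q"
    proof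
      fix y assume "y \<in> sum_space (\<lambda>b c. c\<^sup>2 * qval Q b) K B1"
      then obtain c where c: "\<forall>b\<in>B1. c b \<in> K" "y = (\<Sum>b\<in>B1. (c b)\<^sup>2 * qval Q b)"
        by (rule sum_space_E)
      have "(\<Sum>b\<in>B1. qscale Q (c b) b) \<in> qspace Q \<and> qval Q (\<Sum>b\<in>B1. qscale Q (c b) b) = y"
        unfolding c(2) by (rule ts_qform_sum[OF Q D(1)]) (use c(1) D(3) in auto)
      then show "y \<in> qval Q ` qspace Q" by (metis image_eqI)
    qed
  qed
  have "fin_dim (\<lambda>a x. (h a)\<^sup>2 * x) (sum_space (\<lambda>b c. c\<^sup>2 * qval Q b) K B1) \<and>
      vs2.dim (sum_space (\<lambda>b c. c\<^sup>2 * qval Q b) K B1) = card B1 * degree"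
    unfolding degree_def
    using dim_sum_space[OF subspace_K fin_dim_K D(1), of "\<lambda>b c. c\<^sup>2 * qval Q b"] lin D(8) by blast
  then show "vector_space.dim (\<lambda>a x. (h a)\<^sup>2 * x) (qval Q ` qspace Q) = card B1 * degree"
    "fin_dim (\<lambda>a x. (h a)\<^sup>2 * x) (qval Q ` qspace Q)"
    unfolding img by simp_all
qed

text \<open>
  An anisotropic summand contributes no vectors of value zero, so these form a copy of \<open>K\<^sup>k\<close> in any
  decomposition \<open>A \<bottom> k \<times> \<langle>0\<rangle>\<close>.  Therefore \<open>k\<close> is determined by the form.
\<close>

lemma dim_isotropic_vectors:
  fixes Q :: "('k, 'v::ab_group_add) qform" and A :: "('k, 'w::ab_group_add) qform"
  assumes Q: "ts_qform K Q" and A: "ts_qform K A" "anisotropic A"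
    and iso: "isometric K Q (orth_sum A (diag K (replicate k 0)))"
  shows "vector_space.dim (\<lambda>a. qscale Q (h a)) {v \<in> qspace Q. qval Q v = 0} = k * degree"
proof -
  define P where "P = orth_sum A (diag K (replicate k 0))"
  interpret V: vector_space "qscale Q" by (rule ts_qformD(2)[OF Q])
  interpret W: vector_space "qscale A" by (rule ts_qformD(2)[OF A(1)])
  obtain f where f: "linear_over K Q P f" "bij_betw f (qspace Q) (qspace P)"
    "\<forall>v\<in>qspace Q. qval Q v = qval P (f v)"
    using iso unfolding isometric_def P_def by auto
  have Psp: "(w, x) \<in> qspace P \<longleftrightarrow> w \<in> qspace A \<and> (\<forall>i<k. x i \<in> K) \<and> (\<forall>i\<ge>k. x i = 0)" for w x
    by (simp add: P_def orth_sum_def diag_def)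
  have Psc: "qscale P a (w, x) = (qscale A a w, \<lambda>i. a * x i)" for a w x
    by (simp add: P_def orth_sum_def diag_def)
  have Pval: "qval P (w, x) = qval A w" for w x
    by (simp add: P_def orth_sum_def diag_def)
  define u :: "nat \<Rightarrow> nat \<Rightarrow> 'k" where "u i = (\<lambda>j. if j = i then 1 else 0)" for i
  define v where "v i = inv_into (qspace Q) f (0, u i)" for i
  have uP: "(0, u i) \<in> qspace P" if "i < k" for i
    unfolding Psp u_def using that ts_qformD(3)[OF A(1)] subfield_closed(1,2)[OF subfield_K] by simp
  have v: "v i \<in> qspace Q" "f (v i) = (0, u i)" if "i < k" for i
  proof -
    show "f (v i) = (0, u i)" unfolding v_def by (rule bij_betw_inv_into_right[OF f(2) uP[OF that]])
    show "v i \<in> qspace Q" unfolding v_def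
      using bij_betwE[OF bij_betw_inv_into[OF f(2)]] uP[OF that] by blast
  qed
  have fsum: "f (\<Sum>i\<in>{..<k}. qscale Q (c i) (v i)) = (0, \<lambda>j. if j < k then c j else 0)"
    if c: "\<forall>i\<in>{..<k}. c i \<in> K" for c
  proof -
    have "f (\<Sum>i\<in>{..<k}. qscale Q (c i) (v i)) = (\<Sum>i\<in>{..<k}. qscale P (c i) (f (v i)))"
      by (rule linear_over_sum[OF Q f(1)]) (use c v(1) in auto)
    also have "\<dots> = (\<Sum>i\<in>{..<k}. (0, \<lambda>j. if j = i then c i else 0))"
      by (rule sum.cong) (auto simp: v(2) Psc u_def)
    also have "\<dots> = (0, \<lambda>j. if j < k then c j else 0)"
      unfolding sum_prod by (auto simp: fun_eq_iff sum_fun_eval)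
    finally show ?thesis .
  qed
  have qsum: "(\<Sum>i\<in>{..<k}. qscale Q (c i) (v i)) \<in> qspace Q" if c: "\<forall>i\<in>{..<k}. c i \<in> K" for c
    using ts_qform_sum[OF Q, of "{..<k}" c v] c v(1) by auto
  have inj: "inj_on f (qspace Q)" using f(2) by (rule bij_betw_imp_inj_on)
  have eq: "{v \<in> qspace Q. qval Q v = 0} = sum_space (\<lambda>i c. qscale Q c (v i)) K {..<k}"
  proof
    show "{v \<in> qspace Q. qval Q v = 0} \<subseteq> sum_space (\<lambda>i c. qscale Q c (v i)) K {..<k}"
    proof
      fix y assume "y \<in> {v \<in> qspace Q. qval Q v = 0}"
      then have y: "y \<in> qspace Q" "qval Q y = 0" by simp_all
      obtain w x where wx: "f y = (w, x)" by (cases "f y")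
      have "(w, x) \<in> qspace P" using bij_betwE[OF f(2)] y(1) wx by metis
      then have P: "w \<in> qspace A" "\<forall>i<k. x i \<in> K" "\<forall>i\<ge>k. x i = 0" unfolding Psp by auto
      have "qval A w = 0" using f(3) y wx Pval by metis
      then have "w = 0" using A(2) P(1) unfolding anisotropic_def by blast
      moreover have "x = (\<lambda>j. if j < k then x j else 0)" using P(3) by (auto simp: fun_eq_iff)
      ultimately have "f y = f (\<Sum>i\<in>{..<k}. qscale Q (x i) (v i))" using fsum[of x] P(2) wx by simp
      then have "y = (\<Sum>i\<in>{..<k}. qscale Q (x i) (v i))"
        using inj_onD[OF inj _ y(1) qsum] P(2) by simp
      moreover have "(\<Sum>i\<in>{..<k}. qscale Q (x i) (v i)) \<in> sum_space (\<lambda>i c. qscale Q c (v i)) K {..<k}"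
        by (rule sum_space_memI) (use P(2) in simp)
      ultimately show "y \<in> sum_space (\<lambda>i c. qscale Q c (v i)) K {..<k}" by simp
    qed
    show "sum_space (\<lambda>i c. qscale Q c (v i)) K {..<k} \<subseteq> {v \<in> qspace Q. qval Q v = 0}"
    proof
      fix y assume "y \<in> sum_space (\<lambda>i c. qscale Q c (v i)) K {..<k}"
      then obtain c where c: "\<forall>i\<in>{..<k}. c i \<in> K" "y = (\<Sum>i\<in>{..<k}. qscale Q (c i) (v i))"
        by (rule sum_space_E)
      have y: "y \<in> qspace Q" unfolding c(2) by (rule qsum[OF c(1)])
      have "qval Q y = qval A 0" using f(3) y fsum[OF c(1)] c(2) Pval by metis
      then show "y \<in> {v \<in> qspace Q. qval Q v = 0}" using y ts_qform_0[OF A(1)] by simp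
    qed
  qed
  have "vector_space.dim (\<lambda>a. qscale Q (h a)) (sum_space (\<lambda>i c. qscale Q c (v i)) K {..<k}) = card {..<k} * degree"
  proof (rule dim_sum_of_lines[OF ts_qformD(2)[OF Q]])
    fix c assume c: "\<forall>i\<in>{..<k}. c i \<in> K" "(\<Sum>i\<in>{..<k}. qscale Q (c i) (v i)) = 0"
    have "f 0 = 0" by (rule linear_over_0[OF f(1) ts_qformD(3)[OF Q]])
    then have "(0, \<lambda>j. if j < k then c j else 0) = (0 :: 'w \<times> (nat \<Rightarrow> 'k))"
      using fsum[OF c(1)] c(2) by simp
    then have "(\<lambda>j. if j < k then c j else 0) = (\<lambda>j. 0)" by (simp add: zero_prod_def zero_fun_def)
    then show "\<forall>i\<in>{..<k}. c i = 0" by (metis lessThan_iff)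
  qed simp
  then show ?thesis unfolding eq by simp
qed

text \<open>
  Rank-nullity over \<open>F\<close> for the value map, which is linear into \<open>K\<close> if \<open>F\<close> acts there through squares.
\<close>

lemma defect_eq:
  fixes Q :: "('k, 'v::ab_group_add) qform"
  assumes Q: "ts_qform K Q"
  shows "defect K Q * degree + vector_space.dim (\<lambda>a x. (h a)\<^sup>2 * x) (qval Q ` qspace Q) =
    vector_space.dim (\<lambda>a. qscale Q (h a)) (qspace Q)"
proof -
  obtain B1 B0 where B: "adapted_basis K Q B1 B0" using adapted_basis_exists[OF Q] by blast
  define k where "k = card B0"
  have "defect K Q = k"
    unfolding defect_def
  proof (rule the_equality)
    show "\<exists>A :: ('k, 'v) qform. ts_qform K A \<and> anisotropic A \<and>
        isometric K Q (orth_sum A (diag K (replicate k 0)))"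
      using anisotropic_part[OF Q B] isometric_anisotropic_part[OF Q B] unfolding k_def by blast
  next
    fix k' assume "\<exists>A :: ('k, 'v) qform. ts_qform K A \<and> anisotropic A \<and>
        isometric K Q (orth_sum A (diag K (replicate k' 0)))"
    then obtain A :: "('k, 'v) qform" where A: "ts_qform K A" "anisotropic A"
        "isometric K Q (orth_sum A (diag K (replicate k' 0)))" by blast
    have "k' * degree = k * degree"
      unfolding k_def using dim_isotropic_vectors[OF Q A, symmetric] adapted_basis_dims(2)[OF Q B]
      by (rule trans)
    then show "k' = k" using degree_pos by simp
  qed
  then show ?thesis using adapted_basis_dims[OF Q B] unfolding k_def by (simp add: algebra_simps)
qed

end

context char_two
begin

section \<open>Base change to a quadratic extension\<close>

text \<open>
  In characteristic \<open>2\<close> there is only one square root \<open>s\<close>, and squares of elements of \<open>F + F s\<close> lie in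
  \<open>F\<close>; so \<open>F + F s\<close> is closed under inverses.  This holds also if \<open>a\<close> is a square, where
  the extension is \<open>F\<close> itself.
\<close>

lemma adjoin_sqrt_eq:
  fixes s :: "'a alg_closure"
  assumes s: "s\<^sup>2 = to_ac a"
  shows "adjoin_sqrt a = {to_ac x + to_ac y * s | x y. True}" (is "_ = ?E")
    "subfield (adjoin_sqrt a) ring_of_type_algebra"
proof -
  interpret R: Ring.field "ring_of_type_algebra :: 'a alg_closure ring" by (rule field_from_type_algebra)
  interpret L: char_two "TYPE('a alg_closure)" by unfold_locales (simp add: CHAR_eq_2)
  have sq: "\<exists>z. u\<^sup>2 = to_ac z" if u: "u \<in> ?E" for u
  proof -
    obtain x y where "u = to_ac x + to_ac y * s" using u by blast
    then have "u\<^sup>2 = to_ac (x\<^sup>2 + y\<^sup>2 * a)" by (simp add: L.sq_add power_mult_distrib s)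
    then show ?thesis by blast
  qed
  have add: "u + v \<in> ?E" if uv: "u \<in> ?E" "v \<in> ?E" for u v
  proof -
    obtain x y where u: "u = to_ac x + to_ac y * s" using uv by blast
    obtain x' y' where v: "v = to_ac x' + to_ac y' * s" using uv by blast
    have "u + v = to_ac (x + x') + to_ac (y + y') * s" unfolding u v by (simp add: algebra_simps)
    then show ?thesis by blast
  qed
  have mult: "u * v \<in> ?E" if uv: "u \<in> ?E" "v \<in> ?E" for u v
  proof -
    obtain x y where u: "u = to_ac x + to_ac y * s" using uv by blast
    obtain x' y' where v: "v = to_ac x' + to_ac y' * s" using uv by blast
    have "u * v = to_ac (x * x') + to_ac y * to_ac y' * s\<^sup>2 + to_ac (x * y' + y * x') * s"
      unfolding u v by (simp add: algebra_simps power2_eq_square)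
    then have "u * v = to_ac (x * x' + y * y' * a) + to_ac (x * y' + y * x') * s"
      unfolding s by simp
    then show ?thesis by blast
  qed
  have base: "to_ac x \<in> ?E" for x
  proof -
    have "to_ac x = to_ac x + to_ac 0 * s" by simp
    then show ?thesis by blast
  qed
  have inv: "inverse u \<in> ?E" if u: "u \<in> ?E" for u
  proof -
    obtain z where z: "u\<^sup>2 = to_ac z" using sq[OF u] by blast
    have "inverse u = u * to_ac (inverse z)"
      using z by (cases "u = 0") (simp_all add: z[symmetric] power2_eq_square field_simps)
    then show ?thesis using mult[OF u base] by metis
  qed
  have subE: "subfield ?E ring_of_type_algebra"
  proof (rule subfieldI_type)
    show "1 \<in> ?E" using base[of 1] by simp
    show "- x \<in> ?E" if "x \<in> ?E" for x using that by simp
  qed (rule add mult inv; assumption)+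
  have root: "{t. t\<^sup>2 = to_ac a} = {s}"
  proof -
    have "t = s" if "t\<^sup>2 = to_ac a" for t
    proof -
      have "(t + s)\<^sup>2 = 0" using that s by (simp add: L.sq_add)
      then have "t + s = 0" by simp
      then show ?thesis using L.eq_iff_add by blast
    qed
    then show ?thesis using s by blast
  qed
  have sE: "s \<in> ?E"
  proof -
    have "s = to_ac 0 + to_ac 1 * s" by simp
    then show ?thesis by blast
  qed
  show eq: "adjoin_sqrt a = ?E"
  proof
    show "adjoin_sqrt a \<subseteq> ?E"
      unfolding adjoin_sqrt_def root
      by (rule R.generate_field_min_subfield1[OF _ subE]) (use base sE in auto)
    show "?E \<subseteq> adjoin_sqrt a"
    proof
      fix u assume "u \<in> ?E"
      then obtain x y where u: "u = to_ac x + to_ac y * s" by blast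
      have "to_ac x \<in> adjoin_sqrt a" "to_ac y \<in> adjoin_sqrt a" "s \<in> adjoin_sqrt a"
        unfolding adjoin_sqrt_def using s by (auto intro: generate_field.incl)
      then show "u \<in> adjoin_sqrt a"
        unfolding u adjoin_sqrt_def
        using generate_field.eng_add[where R = "ring_of_type_algebra :: 'a alg_closure ring"]
          generate_field.eng_mult[where R = "ring_of_type_algebra :: 'a alg_closure ring"]
        by simp
    qed
  qed
  show "subfield (adjoin_sqrt a) ring_of_type_algebra" unfolding eq by (rule subE)
qed

lemma sqrt_exists: "\<exists>s :: 'a alg_closure. s\<^sup>2 = to_ac a"
proof -
  obtain s :: "'a alg_closure" where "s ^ 2 = to_ac a" using nth_root_exists[of 2 "to_ac a"] by auto
  then show ?thesis by blast
qed

lemma finite_extension_adjoin_sqrt: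
  "finite_extension (to_ac :: 'a \<Rightarrow> 'a alg_closure) (adjoin_sqrt a)"
proof -
  obtain s :: "'a alg_closure" where s: "s\<^sup>2 = to_ac a" using sqrt_exists by blast
  note E = adjoin_sqrt_eq[OF s]
  interpret M: vector_space "\<lambda>a (x::'a alg_closure). to_ac a * x"
    by unfold_locales (simp_all add: algebra_simps)
  show ?thesis
  proof (intro finite_extension.intro finite_extension_axioms.intro char_two_axioms)
    show "subfield (adjoin_sqrt a) ring_of_type_algebra" by (rule E(2))
    show "to_ac x \<in> adjoin_sqrt a" for x :: 'a
    proof -
      have "to_ac x = to_ac x + to_ac 0 * s" by simp
      then show ?thesis unfolding E(1) by blast
    qed
    have "adjoin_sqrt a \<subseteq> M.span {1, s}"
    proof
      fix u assume "u \<in> adjoin_sqrt a"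
      then obtain x y where u: "u = to_ac x * 1 + to_ac y * s" unfolding E(1) by auto
      show "u \<in> M.span {1, s}" unfolding u
        by (intro M.span_add M.span_scale M.span_base) simp_all
    qed
    then show "fin_dim (\<lambda>a (x::'a alg_closure). to_ac a * x) (adjoin_sqrt a)"
      unfolding fin_dim_def by (intro exI[of _ "{1, s}"]) simp
  qed (simp_all)
qed

text \<open>
  A basis \<open>B\<close> with its dual basis \<open>co\<close>.  The coordinate forms are defined on the whole type because the
  elements of the base change are functions of such linear forms.
\<close>

definition coordinate_system :: "('a, 'v::ab_group_add) qform \<Rightarrow> 'v set \<Rightarrow> ('v \<Rightarrow> 'v \<Rightarrow> 'a) \<Rightarrow> bool" where
  "coordinate_system Q B co \<longleftrightarrow>
     finite B \<and> B \<subseteq> qspace Q \<and> card B = qdim Q \<and>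
     (\<forall>b. Vector_Spaces.linear (qscale Q) (*) (co b)) \<and>
     (\<forall>v\<in>qspace Q. v = (\<Sum>b\<in>B. qscale Q (co b v) b)) \<and>
     (\<forall>b\<in>B. \<forall>b'\<in>B. co b' b = (if b' = b then 1 else 0))"

lemma coordinate_systemD:
  assumes "coordinate_system Q B co"
  shows "finite B" "B \<subseteq> qspace Q" "card B = qdim Q"
    "\<And>b. Vector_Spaces.linear (qscale Q) (*) (co b)"
    "\<And>v. v \<in> qspace Q \<Longrightarrow> v = (\<Sum>b\<in>B. qscale Q (co b v) b)"
    "\<And>b b'. b \<in> B \<Longrightarrow> b' \<in> B \<Longrightarrow> co b' b = (if b' = b then 1 else 0)"
proof -
  note a = assms[unfolded coordinate_system_def]
  show "finite B" "B \<subseteq> qspace Q" "card B = qdim Q"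
    by (insert a, (elim conjE, assumption)+)
  show "\<And>b. Vector_Spaces.linear (qscale Q) (*) (co b)"
    by (insert a, elim conjE allE, assumption)
  show "\<And>v. v \<in> qspace Q \<Longrightarrow> v = (\<Sum>b\<in>B. qscale Q (co b v) b)"
    by (insert a, elim conjE, erule (1) bspec)
  show "\<And>b b'. b \<in> B \<Longrightarrow> b' \<in> B \<Longrightarrow> co b' b = (if b' = b then 1 else 0)"
    by (insert a, elim conjE, simp)
qed

lemma coordinate_system_exists:
  fixes Q :: "('a, 'v::ab_group_add) qform"
  assumes Q: "ts_qform UNIV Q"
  shows "\<exists>B co. coordinate_system Q B co"
proof -
  interpret V: vector_space "qscale Q" by (rule ts_qformD(2)[OF Q])
  have subsp: "V.subspace (qspace Q)"
    unfolding V.subspace_def using ts_qformD(3,4,5)[OF Q] by simp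
  obtain G where G: "finite G" "G \<subseteq> qspace Q"
    "\<forall>v\<in>qspace Q. \<exists>c. (\<forall>b\<in>G. c b \<in> UNIV) \<and> v = (\<Sum>b\<in>G. qscale Q (c b) b)"
    using ts_qformD(6)[OF Q] by auto
  have "qspace Q \<subseteq> V.span G"
  proof
    fix v assume "v \<in> qspace Q"
    then obtain c where "v = (\<Sum>b\<in>G. qscale Q (c b) b)" using G(3) by auto
    then show "v \<in> V.span G" by (simp add: V.span_base V.span_scale V.span_sum)
  qed
  then have fin: "fin_dim (qscale Q) (qspace Q)" unfolding fin_dim_def using G(1) by blast
  obtain B where B: "finite B" "V.independent B" "B \<subseteq> qspace Q" "V.span B = qspace Q" "card B = V.dim (qspace Q)"
    by (rule V.fin_dim_basis[OF subsp fin])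
  define B' where "B' = V.extend_basis B"
  have B': "V.independent B'" "V.span B' = UNIV" "B \<subseteq> B'"
    using B(2) unfolding B'_def
    by (simp_all add: V.independent_extend_basis V.extend_basis_superset)
  define co where "co b v = V.representation B' v b" for b v
  show ?thesis
    unfolding coordinate_system_def
  proof (intro exI[of _ B] exI[of _ co] conjI allI ballI)
    show "finite B" "B \<subseteq> qspace Q" by (rule B(1), rule B(3))
    show "card B = qdim Q" unfolding qdim_def by (rule B(5))
    show "Vector_Spaces.linear (qscale Q) (*) (co b)" for b
      unfolding co_def by (rule V.linear_representation[OF B'(1,2)])
    show "v = (\<Sum>b\<in>B. qscale Q (co b v) b)" if "v \<in> qspace Q" for v
    proof -
      have v: "v \<in> V.span B" using that B(4) by simp
      then have "V.representation B' v = V.representation B v"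
        using V.representation_extend[OF B'(1) _ B'(3)] by simp
      then show ?thesis unfolding co_def
        using V.sum_representation_eq[OF B(2) v B(1) order_refl] by simp
    qed
    show "co b' b = (if b' = b then 1 else 0)" if "b \<in> B" "b' \<in> B" for b b'
      unfolding co_def using V.representation_basis[OF B'(1), of b] B'(3) that by auto
  qed
qed

lemma pure_tensor_simps:
  shows "pure_tensor Q (e + e') v = pure_tensor Q e v + pure_tensor Q e' v"
    "pure_tensor Q (e * e') v = (\<lambda>l. e * pure_tensor Q e' v l)"
    "pure_tensor Q e (v + w) = pure_tensor Q e v + pure_tensor Q e w"
    "pure_tensor Q e (qscale Q a v) = pure_tensor Q (e * to_ac a) v"
  by (auto simp: pure_tensor_def fun_eq_iff algebra_simps Vector_Spaces.linear_iff)

lemma pure_tensor_sum: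
  assumes "vector_space (qscale Q)"
  shows "pure_tensor Q e (\<Sum>b\<in>B. f b) = (\<Sum>b\<in>B. pure_tensor Q e (f b))"
proof -
  have 0: "pure_tensor Q e 0 = 0"
  proof -
    have "pure_tensor Q e (0 + 0) = pure_tensor Q e 0 + pure_tensor Q e 0" by (rule pure_tensor_simps)
    then have "pure_tensor Q e 0 + pure_tensor Q e 0 = pure_tensor Q e 0 + 0" by simp
    then show ?thesis by (simp only: add_left_cancel)
  qed
  show ?thesis by (induction B rule: infinite_finite_induct) (simp_all add: 0 pure_tensor_simps(3))
qed

text \<open>
  Tensors are unique combinations of \<open>c \<otimes> b\<close> with \<open>b\<close> in the basis: the coefficient at \<open>b\<close> is recovered by
  evaluating at the dual form \<open>co b\<close>.  This also shows that the value, defined through an arbitrary presentation as a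
  sum of pure tensors, is well defined.
\<close>

lemma base_change_in_coordinates:
  fixes Q :: "('a, 'v::ab_group_add) qform"
  assumes Q: "ts_qform UNIV Q" and E: "subfield E (ring_of_type_algebra :: 'a alg_closure ring)" "range to_ac \<subseteq> E"
    and coord: "coordinate_system Q B co"
  shows "qspace (base_change E Q) = sum_space (\<lambda>b c. pure_tensor Q c b) E B" (is ?space)
    and "\<And>c b. b \<in> B \<Longrightarrow> (\<Sum>b\<in>B. pure_tensor Q (c b) b) (co b) = c b"
    and "\<And>c. \<forall>b\<in>B. c b \<in> E \<Longrightarrow> qval (base_change E Q) (\<Sum>b\<in>B. pure_tensor Q (c b) b) =
      (\<Sum>b\<in>B. (c b)\<^sup>2 * to_ac (qval Q b))"
proof -
  note V = ts_qformD(2)[OF Q]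
  note B = coordinate_systemD(1,2,4,5,6)[OF coord]
  interpret L: char_two "TYPE('a alg_closure)" by unfold_locales (simp add: CHAR_eq_2)
  let ?T = "\<lambda>ts. \<Sum>(e, v)\<leftarrow>ts. pure_tensor Q e v"
  let ?q = "\<lambda>ts. \<Sum>(e, v)\<leftarrow>ts. e\<^sup>2 * to_ac (qval Q v)"
  have toE: "to_ac x \<in> E" for x using E(2) by blast
  have expand: "pure_tensor Q e v = (\<Sum>b\<in>B. pure_tensor Q (e * to_ac (co b v)) b)" if v: "v \<in> qspace Q" for e v
  proof -
    have "pure_tensor Q e v = pure_tensor Q e (\<Sum>b\<in>B. qscale Q (co b v) b)"
      using B(4)[OF v] by simp
    then show ?thesis unfolding pure_tensor_sum[OF V] pure_tensor_simps(4) .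
  qed
  have add: "(\<Sum>b\<in>B. pure_tensor Q (c b) b) + (\<Sum>b\<in>B. pure_tensor Q (d b) b) =
      (\<Sum>b\<in>B. pure_tensor Q (c b + d b) b)" for c d
    by (simp add: pure_tensor_simps(1) sum.distrib)
  have T_in: "?T ts \<in> sum_space (\<lambda>b c. pure_tensor Q c b) E B" if "set ts \<subseteq> E \<times> qspace Q" for ts
    using that
  proof (induction ts)
    case Nil
    have "(\<Sum>b\<in>B. pure_tensor Q 0 b) \<in> sum_space (\<lambda>b c. pure_tensor Q c b) E B"
      by (rule sum_space_memI[of _ "\<lambda>_. 0"]) (use subfield_closed(1)[OF E(1)] in simp)
    moreover have "(\<Sum>b\<in>B. pure_tensor Q 0 b) = 0"
      by (rule sum.neutral) (simp add: pure_tensor_def fun_eq_iff)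
    ultimately have "0 \<in> sum_space (\<lambda>b c. pure_tensor Q c b) E B" by (simp only:)
    then show ?case by (simp only: list.map sum_list.Nil)
  next
    case (Cons t ts)
    obtain e v where t: "t = (e, v)" by (cases t)
    have ev: "e \<in> E" "v \<in> qspace Q" using Cons.prems t by auto
    have "?T ts \<in> sum_space (\<lambda>b c. pure_tensor Q c b) E B" using Cons by simp
    then obtain c where c: "\<forall>b\<in>B. c b \<in> E" "?T ts = (\<Sum>b\<in>B. pure_tensor Q (c b) b)" by (rule sum_space_E)
    have "?T (t # ts) = pure_tensor Q e v + ?T ts" by (simp add: t)
    also have "\<dots> = (\<Sum>b\<in>B. pure_tensor Q (e * to_ac (co b v) + c b) b)"
      unfolding expand[OF ev(2)] c(2) add ..
    finally have eq: "?T (t # ts) = (\<Sum>b\<in>B. pure_tensor Q (e * to_ac (co b v) + c b) b)" .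
    have "\<forall>b\<in>B. e * to_ac (co b v) + c b \<in> E"
      using subfield_closed(3)[OF E(1) subfield_closed(4)[OF E(1) ev(1) toE]] c(1) by simp
    then show ?case unfolding eq by (rule sum_space_memI)
  qed
  obtain bs where bs: "set bs = B" "distinct bs" using finite_distinct_list[OF B(1)] by blast
  have T_list: "?T (map (\<lambda>b. (c b, b)) bs) = (\<Sum>b\<in>B. pure_tensor Q (c b) b)" for c
    using sum_list_distinct_conv_sum_set[OF bs(2), of "\<lambda>b. pure_tensor Q (c b) b"] bs(1)
    by (simp add: o_def)
  have q_list: "?q (map (\<lambda>b. (c b, b)) bs) = (\<Sum>b\<in>B. (c b)\<^sup>2 * to_ac (qval Q b))" for c
    using sum_list_distinct_conv_sum_set[OF bs(2), of "\<lambda>b. (c b)\<^sup>2 * to_ac (qval Q b)"] bs(1)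
    by (simp add: o_def)
  show ?space
  proof
    show "qspace (base_change E Q) \<subseteq> sum_space (\<lambda>b c. pure_tensor Q c b) E B"
    proof
      fix t assume "t \<in> qspace (base_change E Q)"
      then obtain ts where "t = ?T ts" "set ts \<subseteq> E \<times> qspace Q" by (auto simp: base_change_def)
      then show "t \<in> sum_space (\<lambda>b c. pure_tensor Q c b) E B" using T_in by simp
    qed
    show "sum_space (\<lambda>b c. pure_tensor Q c b) E B \<subseteq> qspace (base_change E Q)"
    proof
      fix t assume "t \<in> sum_space (\<lambda>b c. pure_tensor Q c b) E B"
      then obtain c where c: "\<forall>b\<in>B. c b \<in> E" "t = (\<Sum>b\<in>B. pure_tensor Q (c b) b)" by (rule sum_space_E)
      have "set (map (\<lambda>b. (c b, b)) bs) \<subseteq> E \<times> qspace Q" using c(1) bs(1) B(2) by auto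
      then have "?T (map (\<lambda>b. (c b, b)) bs) \<in> qspace (base_change E Q)"
        unfolding base_change_def by (simp only: qform.simps) blast
      then show "t \<in> qspace (base_change E Q)" unfolding T_list c(2) .
    qed
  qed
  show eval: "(\<Sum>b\<in>B. pure_tensor Q (c b) b) (co b) = c b" if b: "b \<in> B" for c b
  proof -
    have "(\<Sum>b\<in>B. pure_tensor Q (c b) b) (co b) = (\<Sum>x\<in>B. if x = b then c x else 0)"
      unfolding sum_fun_eval by (rule sum.cong) (use B(3,5) b in \<open>auto simp: pure_tensor_def\<close>)
    then show ?thesis using b B(1) by simp
  qed
  have q_eq: "?q ts = (\<Sum>b\<in>B. (?T ts (co b))\<^sup>2 * to_ac (qval Q b))" if "set ts \<subseteq> E \<times> qspace Q" for ts
    using that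
  proof (induction ts)
    case (Cons t ts)
    obtain e v where t: "t = (e, v)" by (cases t)
    have v: "v \<in> qspace Q" using Cons.prems t by auto
    have "qval Q v = (\<Sum>b\<in>B. (co b v)\<^sup>2 * qval Q b)"
    proof -
      have "qval Q (\<Sum>b\<in>B. qscale Q (co b v) b) = (\<Sum>b\<in>B. (co b v)\<^sup>2 * qval Q b)"
        using ts_qform_sum[OF Q B(1), of "\<lambda>b. co b v" "\<lambda>b. b"] B(2) by auto
      then show ?thesis using B(4)[OF v] by simp
    qed
    then have qv: "to_ac (qval Q v) = (\<Sum>b\<in>B. (to_ac (co b v))\<^sup>2 * to_ac (qval Q b))"
      by (simp add: to_ac_sum)
    have "?q (t # ts) = e\<^sup>2 * to_ac (qval Q v) + ?q ts" by (simp add: t)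
    also have "\<dots> = (\<Sum>b\<in>B. (e * to_ac (co b v))\<^sup>2 * to_ac (qval Q b)) +
        (\<Sum>b\<in>B. (?T ts (co b))\<^sup>2 * to_ac (qval Q b))"
      using Cons by (simp add: qv sum_distrib_left power_mult_distrib mult.assoc)
    also have "\<dots> = (\<Sum>b\<in>B. (e * to_ac (co b v) + ?T ts (co b))\<^sup>2 * to_ac (qval Q b))"
      by (simp add: L.sq_add distrib_right sum.distrib)
    also have "\<dots> = (\<Sum>b\<in>B. (?T (t # ts) (co b))\<^sup>2 * to_ac (qval Q b))"
      by (simp add: t pure_tensor_def B(3))
    finally show ?case .
  qed simp
  show "qval (base_change E Q) (\<Sum>b\<in>B. pure_tensor Q (c b) b) =
      (\<Sum>b\<in>B. (c b)\<^sup>2 * to_ac (qval Q b))" if c: "\<forall>b\<in>B. c b \<in> E" for c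
  proof -
    let ?t = "\<Sum>b\<in>B. pure_tensor Q (c b) b"
    let ?ts = "map (\<lambda>b. (c b, b)) bs"
    have ts: "set ?ts \<subseteq> E \<times> qspace Q" using c bs(1) B(2) by auto
    have "(THE q. \<exists>ts. set ts \<subseteq> E \<times> qspace Q \<and> ?t = ?T ts \<and> q = ?q ts) = ?q ?ts"
    proof (rule the_equality)
      show "\<exists>ts. set ts \<subseteq> E \<times> qspace Q \<and> ?t = ?T ts \<and> ?q ?ts = ?q ts"
        using ts T_list[of c] by (intro exI[of _ ?ts]) simp
      fix q assume "\<exists>ts. set ts \<subseteq> E \<times> qspace Q \<and> ?t = ?T ts \<and> q = ?q ts"
      then obtain ts' where ts': "set ts' \<subseteq> E \<times> qspace Q" "?t = ?T ts'" "q = ?q ts'" by blast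
      show "q = ?q ?ts" unfolding ts'(3) q_eq[OF ts'(1)] q_eq[OF ts] ts'(2)[symmetric] T_list ..
    qed
    then show ?thesis unfolding q_list by (simp add: base_change_def)
  qed
qed

lemma subspace_value_set:
  assumes Q: "ts_qform UNIV Q"
  shows "sq.subspace (value_set Q)"
  unfolding subspace_iff value_set_def
proof (intro conjI ballI allI)
  show "0 \<in> qval Q ` qspace Q"
    using ts_qformD(3)[OF Q] ts_qform_0[OF Q] by (metis image_eqI)
  fix x assume x: "x \<in> qval Q ` qspace Q"
  then obtain v where v: "v \<in> qspace Q" "x = qval Q v" by blast
  show "x + y \<in> qval Q ` qspace Q" if y: "y \<in> qval Q ` qspace Q" for y
  proof -
    obtain w where w: "w \<in> qspace Q" "y = qval Q w" using y by blast
    show ?thesis using ts_qformD(4)[OF Q v(1) w(1)] ts_qformD(9)[OF Q v(1) w(1)] v w by (metis image_eqI)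
  qed
  show "a\<^sup>2 * x \<in> qval Q ` qspace Q" for a
    using ts_qformD(5)[OF Q UNIV_I v(1), of a] ts_qformD(8)[OF Q UNIV_I v(1), of a] v(2) by (metis image_eqI)
qed

lemma value_set_eq_sums:
  assumes Q: "ts_qform UNIV Q" and coord: "coordinate_system Q B co"
  shows "value_set Q = {\<Sum>b\<in>B. (x b)\<^sup>2 * qval Q b | x. True}"
proof
  note B = coordinate_systemD(1,2,5)[OF coord]
  have val: "qval Q (\<Sum>b\<in>B. qscale Q (x b) b) = (\<Sum>b\<in>B. (x b)\<^sup>2 * qval Q b)"
    "(\<Sum>b\<in>B. qscale Q (x b) b) \<in> qspace Q" for x
    using ts_qform_sum[OF Q B(1), of x "\<lambda>b. b"] B(2) by auto
  show "value_set Q \<subseteq> {\<Sum>b\<in>B. (x b)\<^sup>2 * qval Q b | x. True}"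
  proof
    fix y assume "y \<in> value_set Q"
    then obtain v where v: "v \<in> qspace Q" "y = qval Q v" unfolding value_set_def by blast
    have "y = (\<Sum>b\<in>B. (co b v)\<^sup>2 * qval Q b)"
      using B(3)[OF v(1)] val(1)[of "\<lambda>b. co b v"] v(2) by simp
    then show "y \<in> {\<Sum>b\<in>B. (x b)\<^sup>2 * qval Q b | x. True}"
      by (intro CollectI exI[of _ "\<lambda>b. co b v"]) simp
  qed
  show "{\<Sum>b\<in>B. (x b)\<^sup>2 * qval Q b | x. True} \<subseteq> value_set Q"
  proof
    fix y assume "y \<in> {\<Sum>b\<in>B. (x b)\<^sup>2 * qval Q b | x. True}"
    then obtain x where "y = (\<Sum>b\<in>B. (x b)\<^sup>2 * qval Q b)" by blast
    then show "y \<in> value_set Q" unfolding value_set_def using val[of x] by (metis image_eqI)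
  qed
qed

lemma base_change_operations:
  fixes Q :: "('a, 'v::ab_group_add) qform"
  shows "(\<Sum>b\<in>B. pure_tensor Q (c b) b) + (\<Sum>b\<in>B. pure_tensor Q (d b) b) =
      (\<Sum>b\<in>B. pure_tensor Q (c b + d b) b)"
    and "qscale (base_change E Q) e (\<Sum>b\<in>B. pure_tensor Q (c b) b) = (\<Sum>b\<in>B. pure_tensor Q (e * c b) b)"
    and "qscale (base_change E Q) e (pure_tensor Q 1 v) = pure_tensor Q e v"
    and "vector_space (qscale (base_change E Q))"
proof -
  have sc: "qscale (base_change E Q) = (\<lambda>a t l. a * t l)" by (simp add: base_change_def)
  show "(\<Sum>b\<in>B. pure_tensor Q (c b) b) + (\<Sum>b\<in>B. pure_tensor Q (d b) b) =
      (\<Sum>b\<in>B. pure_tensor Q (c b + d b) b)"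
    by (simp add: pure_tensor_simps(1) sum.distrib)
  show V: "vector_space (qscale (base_change E Q))"
    unfolding sc by unfold_locales (simp_all add: fun_eq_iff algebra_simps)
  interpret V: vector_space "qscale (base_change E Q)" by (rule V)
  have pt: "qscale (base_change E Q) e (pure_tensor Q e' v) = pure_tensor Q (e * e') v" for e e' v
    unfolding sc by (rule pure_tensor_simps(2)[symmetric])
  show "qscale (base_change E Q) e (\<Sum>b\<in>B. pure_tensor Q (c b) b) = (\<Sum>b\<in>B. pure_tensor Q (e * c b) b)"
    unfolding V.scale_sum_right pt ..
  show "qscale (base_change E Q) e (pure_tensor Q 1 v) = pure_tensor Q e v"
    unfolding pt by simp
qed

text \<open>
  All operations of the base change are computed on the coefficients with respect to the pure tensors
  \<open>1 \<otimes> b\<close>.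
\<close>

lemma ts_qform_base_change:
  fixes Q :: "('a, 'v::ab_group_add) qform"
  assumes Q: "ts_qform UNIV Q" and E: "subfield E (ring_of_type_algebra :: 'a alg_closure ring)" "range to_ac \<subseteq> E"
  shows "ts_qform E (base_change E Q)"
proof -
  interpret L: char_two "TYPE('a alg_closure)" by unfold_locales (simp add: CHAR_eq_2)
  obtain B co where coord: "coordinate_system Q B co" using coordinate_system_exists[OF Q] by blast
  note B = coordinate_systemD[OF coord]
  define R where "R = base_change E Q"
  note bc = base_change_in_coordinates[OF Q E coord, folded R_def]
  note ops = base_change_operations(1)[where Q = Q] base_change_operations(2,3,4)[where Q = Q and E = E, folded R_def]
  note cl = subfield_closed[OF E(1)]
  have memR: "(\<Sum>b\<in>B. pure_tensor Q (c b) b) \<in> qspace R" if "\<forall>b\<in>B. c b \<in> E" for c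
    unfolding bc(1) by (rule sum_space_memI[OF that])
  have sumE: "(\<Sum>b\<in>B. (c b)\<^sup>2 * to_ac (qval Q b)) \<in> E" if c: "\<forall>b\<in>B. c b \<in> E" for c
  proof -
    have "(\<Sum>b\<in>B'. (c b)\<^sup>2 * to_ac (qval Q b)) \<in> E" if "finite B'" "B' \<subseteq> B" for B'
      using that
    proof (induction B' rule: finite_induct)
      case (insert b B')
      have "to_ac (qval Q b) \<in> E" using E(2) by blast
      then have "(c b)\<^sup>2 * to_ac (qval Q b) \<in> E"
        unfolding power2_eq_square using c insert.prems by (intro cl(4)) auto
      then show ?case using insert cl(3) by simp
    qed (use cl(1) in simp)
    then show ?thesis using B(1) by blast
  qed
  have "ts_qform E R"
    unfolding ts_qform_def
  proof (intro conjI ballI)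
    show "subfield E ring_of_type_algebra" by (rule E(1))
    show "vector_space (qscale R)" by (rule ops(4))
    have pt0: "pure_tensor Q 0 b = 0" for b by (simp add: pure_tensor_def fun_eq_iff)
    have "(\<Sum>b\<in>B. pure_tensor Q 0 b) \<in> qspace R" by (rule memR) (use cl(1) in simp)
    then show R0: "0 \<in> qspace R" by (simp add: pt0)
    let ?G = "pure_tensor Q 1 ` B"
    have finG: "finite ?G" using B(1) by simp
    show "\<exists>B. finite B \<and> B \<subseteq> qspace R \<and>
      (\<forall>v\<in>qspace R. \<exists>c. (\<forall>b\<in>B. c b \<in> E) \<and> v = (\<Sum>b\<in>B. qscale R (c b) b))"
    proof (intro exI[of _ ?G] conjI ballI)
      show "finite ?G" by (rule finG)
      show "?G \<subseteq> qspace R"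
      proof (rule image_subsetI)
        fix b assume b: "b \<in> B"
        have "pure_tensor Q (if x = b then 1 else 0) x = (if x = b then pure_tensor Q 1 x else 0)" for x
          by (simp add: pt0)
        then have "(\<Sum>x\<in>B. pure_tensor Q (if x = b then 1 else 0) x) = pure_tensor Q 1 b"
          using b B(1) by simp
        then show "pure_tensor Q 1 b \<in> qspace R"
          using memR[of "\<lambda>x. if x = b then 1 else 0"] cl(1,2) by simp
      qed
      fix t assume "t \<in> qspace R"
      then obtain c where c: "\<forall>b\<in>B. c b \<in> E" "t = (\<Sum>b\<in>B. pure_tensor Q (c b) b)"
        unfolding bc(1) by (rule sum_space_E)
      have "(\<Sum>b\<in>B'. pure_tensor Q (c b) b) \<in> K_span R E ?G" if "finite B'" "B' \<subseteq> B" for B'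
        using that
      proof (induction B' rule: finite_induct)
        case empty
        show ?case unfolding sum.empty by (rule K_span_closed(1)[OF E(1) ops(4)])
      next
        case (insert b B')
        have b: "b \<in> B" using insert.prems by simp
        have "qscale R (c b) (pure_tensor Q 1 b) \<in> K_span R E ?G"
          by (rule K_span_closed(3)[OF E(1) ops(4) _ K_span_closed(4)[OF E(1) ops(4) finG]])
            (use b c(1) in auto)
        then have "pure_tensor Q (c b) b \<in> K_span R E ?G" unfolding ops(3) .
        then have "pure_tensor Q (c b) b + (\<Sum>b\<in>B'. pure_tensor Q (c b) b) \<in> K_span R E ?G"
          by (rule K_span_closed(2)[OF E(1) ops(4)]) (use insert in simp)
        then show ?case unfolding sum.insert[OF insert.hyps] .
      qed
      then have "t \<in> K_span R E ?G" using c(2) B(1) by blast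
      then show "\<exists>c. (\<forall>b\<in>?G. c b \<in> E) \<and> t = (\<Sum>b\<in>?G. qscale R (c b) b)"
        unfolding K_span_def sum_space_def by auto
    qed
  next
    fix t u assume "t \<in> qspace R" "u \<in> qspace R"
    obtain c where c: "\<forall>b\<in>B. c b \<in> E" "t = (\<Sum>b\<in>B. pure_tensor Q (c b) b)"
      using \<open>t \<in> qspace R\<close> unfolding bc(1) by (rule sum_space_E)
    obtain d where d: "\<forall>b\<in>B. d b \<in> E" "u = (\<Sum>b\<in>B. pure_tensor Q (d b) b)"
      using \<open>u \<in> qspace R\<close> unfolding bc(1) by (rule sum_space_E)
    have cd: "\<forall>b\<in>B. c b + d b \<in> E" using c d cl(3) by simp
    show "t + u \<in> qspace R" unfolding c d ops(1) by (rule memR[OF cd])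
    show "qval R (t + u) = qval R t + qval R u"
      unfolding c d ops(1) bc(3)[OF c(1)] bc(3)[OF d(1)] bc(3)[OF cd]
      by (simp add: L.sq_add distrib_right sum.distrib)
  next
    fix e t assume "e \<in> E" "t \<in> qspace R"
    obtain c where c: "\<forall>b\<in>B. c b \<in> E" "t = (\<Sum>b\<in>B. pure_tensor Q (c b) b)"
      using \<open>t \<in> qspace R\<close> unfolding bc(1) by (rule sum_space_E)
    have ec: "\<forall>b\<in>B. e * c b \<in> E" using c \<open>e \<in> E\<close> cl(4) by simp
    show "qscale R e t \<in> qspace R" unfolding c ops(2) by (rule memR[OF ec])
    show "qval R (qscale R e t) = e\<^sup>2 * qval R t"
      unfolding c ops(2) bc(3)[OF c(1)] bc(3)[OF ec]
      by (simp add: power_mult_distrib sum_distrib_left mult.assoc)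
  next
    fix t assume "t \<in> qspace R"
    then obtain c where c: "\<forall>b\<in>B. c b \<in> E" "t = (\<Sum>b\<in>B. pure_tensor Q (c b) b)"
      unfolding bc(1) by (rule sum_space_E)
    show "qval R t \<in> E" unfolding c bc(3)[OF c(1)] by (rule sumE[OF c(1)])
  qed
  then show ?thesis unfolding R_def .
qed

text \<open>
  With \<open>s\<close> the square root of \<open>a\<close>, one has \<open>(x + y s)\<^sup>2 = x\<^sup>2 + a y\<^sup>2\<close>.  So the value set over \<open>F(s)\<close> is
  \<open>D + a D\<close>, where \<open>D\<close> is the value set over \<open>F\<close>, and \<open>defect_eq\<close> applies.
\<close>

theorem defect_quadratic_extension:
  fixes Q :: "('a, 'v::ab_group_add) qform"
  assumes Q: "ts_qform UNIV Q"
  shows "defect (adjoin_sqrt a) (base_change (adjoin_sqrt a) Q) *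
      finite_extension.degree (to_ac :: 'a \<Rightarrow> _) (adjoin_sqrt a) + sq.dim (spread a (value_set Q)) =
    qdim Q * finite_extension.degree (to_ac :: 'a \<Rightarrow> _) (adjoin_sqrt a)"
proof -
  define E where "E = adjoin_sqrt a"
  interpret X: finite_extension "TYPE('a)" "to_ac :: 'a \<Rightarrow> 'a alg_closure" E
    unfolding E_def by (rule finite_extension_adjoin_sqrt)
  obtain s :: "'a alg_closure" where s: "s\<^sup>2 = to_ac a" using sqrt_exists by blast
  have E: "E = {to_ac x + to_ac y * s | x y. True}" unfolding E_def by (rule adjoin_sqrt_eq(1)[OF s])
  interpret L: char_two "TYPE('a alg_closure)" by unfold_locales (simp add: CHAR_eq_2)
  have toE: "range to_ac \<subseteq> E" using X.h_in_K by blast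
  obtain B co where coord: "coordinate_system Q B co" using coordinate_system_exists[OF Q] by blast
  note B = coordinate_systemD[OF coord]
  define R where "R = base_change E Q"
  note bc = base_change_in_coordinates[OF Q X.subfield_K toE coord, folded R_def]
  note ops = base_change_operations(1)[where Q = Q] base_change_operations(2,3,4)[where Q = Q and E = E, folded R_def]
  have dimR: "vector_space.dim (\<lambda>a. qscale R (to_ac a)) (qspace R) = qdim Q * X.degree"
  proof -
    have "qspace R = sum_space (\<lambda>b c. qscale R c (pure_tensor Q 1 b)) E B"
      unfolding bc(1) ops(3) ..
    moreover have "vector_space.dim (\<lambda>a. qscale R (to_ac a)) (sum_space (\<lambda>b c. qscale R c (pure_tensor Q 1 b)) E B) =
        card B * X.degree"
    proof (rule X.dim_sum_of_lines[OF ops(4) B(1)])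
      fix c assume c: "\<forall>b\<in>B. c b \<in> E" "(\<Sum>b\<in>B. qscale R (c b) (pure_tensor Q 1 b)) = 0"
      have "(\<Sum>b\<in>B. pure_tensor Q (c b) b) = 0" using c(2) unfolding ops(3) .
      then show "\<forall>b\<in>B. c b = 0" using bc(2)[of _ c] by simp
    qed
    ultimately show ?thesis using B(3) by simp
  qed
  have valQ: "value_set Q = {\<Sum>b\<in>B. (x b)\<^sup>2 * qval Q b | x. True}"
    by (rule value_set_eq_sums[OF Q coord])
  have img: "qval R ` qspace R = to_ac ` spread a (value_set Q)"
  proof
    have key: "(\<Sum>b\<in>B. (to_ac (x b) + to_ac (y b) * s)\<^sup>2 * to_ac (qval Q b)) =
        to_ac ((\<Sum>b\<in>B. (x b)\<^sup>2 * qval Q b) + a * (\<Sum>b\<in>B. (y b)\<^sup>2 * qval Q b))" for x y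
    proof -
      have "(to_ac (x b) + to_ac (y b) * s)\<^sup>2 * to_ac (qval Q b) =
          to_ac ((x b)\<^sup>2 * qval Q b + a * ((y b)\<^sup>2 * qval Q b))" for b
        by (simp add: L.sq_add power_mult_distrib s algebra_simps)
      then show ?thesis by (simp add: to_ac_sum sum.distrib sum_distrib_left)
    qed
    show "qval R ` qspace R \<subseteq> to_ac ` spread a (value_set Q)"
    proof (rule image_subsetI)
      fix t assume "t \<in> qspace R"
      then obtain c where c: "\<forall>b\<in>B. c b \<in> E" "t = (\<Sum>b\<in>B. pure_tensor Q (c b) b)"
        unfolding bc(1) by (rule sum_space_E)
      have "\<forall>b\<in>B. \<exists>x y. c b = to_ac x + to_ac y * s" using c(1) unfolding E by blast
      then obtain x y where xy: "\<forall>b\<in>B. c b = to_ac (x b) + to_ac (y b) * s" by metis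
      have "qval R t = (\<Sum>b\<in>B. (to_ac (x b) + to_ac (y b) * s)\<^sup>2 * to_ac (qval Q b))"
        unfolding c(2) bc(3)[OF c(1)] using xy by simp
      then show "qval R t \<in> to_ac ` spread a (value_set Q)"
        unfolding key spread_def valQ by blast
    qed
    show "to_ac ` spread a (value_set Q) \<subseteq> qval R ` qspace R"
    proof (rule image_subsetI)
      fix z assume "z \<in> spread a (value_set Q)"
      then obtain x y where z: "z = (\<Sum>b\<in>B. (x b)\<^sup>2 * qval Q b) + a * (\<Sum>b\<in>B. (y b)\<^sup>2 * qval Q b)"
        unfolding spread_def valQ by auto
      define c where "c b = to_ac (x b) + to_ac (y b) * s" for b
      have c: "\<forall>b\<in>B. c b \<in> E" unfolding E c_def by blast
      have "to_ac z = qval R (\<Sum>b\<in>B. pure_tensor Q (c b) b)"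
        unfolding bc(3)[OF c] z key[symmetric] by (simp add: c_def)
      then show "to_ac z \<in> qval R ` qspace R" unfolding bc(1) by (intro image_eqI[OF _ sum_space_memI[OF c]])
    qed
  qed
  have lin: "Vector_Spaces.linear sq_scale (\<lambda>a (x::'a alg_closure). (to_ac a)\<^sup>2 * x) to_ac"
    unfolding Vector_Spaces.linear_iff
    by (intro conjI vector_space_sq_scale X.vector_space_square_mult) (simp_all add: sq_scale_def)
  have "inj_on to_ac (spread a (value_set Q))" using inj_to_ac by (rule inj_on_subset) simp
  moreover have subv: "sq.subspace (value_set Q)"
    by (rule subspace_value_set[OF Q])
  ultimately have "vector_space.dim (\<lambda>a (x::'a alg_closure). (to_ac a)\<^sup>2 * x) (to_ac ` spread a (value_set Q)) =
      sq.dim (spread a (value_set Q))"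
    using linear.dim_inj_image[OF lin] subspace_spread by blast
  then show ?thesis
    using X.defect_eq[OF ts_qform_base_change[OF Q X.subfield_K toE]] dimR img unfolding R_def E_def by simp
qed

section \<open>Forms over the base field and their value sets\<close>

lemma subfield_UNIV: "subfield (UNIV :: 'a set) ring_of_type_algebra"
  by (rule subfieldI_type) simp_all

text \<open>
  The trivial extension, which turns the counting results into statements over \<open>F\<close>.
\<close>

lemma finite_extension_UNIV: "finite_extension (\<lambda>x::'a. x) UNIV"
proof (intro finite_extension.intro finite_extension_axioms.intro char_two_axioms subfield_UNIV)
  interpret M: vector_space "\<lambda>a (x::'a). a * x" by unfold_locales (simp_all add: algebra_simps)
  have "x \<in> M.span {1}" for x unfolding M.span_singleton by simp
  then show "fin_dim (\<lambda>a (x::'a). a * x) UNIV"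
    unfolding fin_dim_def by (intro exI[of _ "{1}"]) blast
qed simp_all

lemma degree_UNIV: "finite_extension.degree (\<lambda>x::'a. x) UNIV = 1"
proof -
  interpret X: finite_extension "TYPE('a)" "\<lambda>x::'a. x" UNIV by (rule finite_extension_UNIV)
  interpret M: vector_space "\<lambda>a (x::'a). a * x" by (rule X.vector_space_mult)
  have "M.span {1} = UNIV" unfolding M.span_singleton by auto
  then have "M.dim UNIV = card {1::'a}"
    by (intro M.dim_unique) auto
  then show ?thesis unfolding X.degree_def by simp
qed

lemma adapted_basis_counts:
  fixes Q :: "('a, 'v::ab_group_add) qform"
  assumes Q: "ts_qform UNIV Q" and B: "adapted_basis UNIV Q B1 B0"
  shows "qdim Q = card B1 + card B0" "sq.dim (value_set Q) = card B1" "fd (value_set Q)"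
    "vector_space.dim (qscale Q) {v \<in> qspace Q. qval Q v = 0} = card B0"
proof -
  interpret X: finite_extension "TYPE('a)" "\<lambda>x::'a. x" UNIV by (rule finite_extension_UNIV)
  have sc: "(\<lambda>a (x::'a). a\<^sup>2 * x) = sq_scale" by (simp add: fun_eq_iff sq_scale_def)
  note d = X.adapted_basis_dims[OF Q B, unfolded degree_UNIV sc mult_1_right]
  show "qdim Q = card B1 + card B0" "sq.dim (value_set Q) = card B1" "fd (value_set Q)"
    "vector_space.dim (qscale Q) {v \<in> qspace Q. qval Q v = 0} = card B0"
    using d unfolding qdim_def value_set_def by simp_all
qed

lemma fd_value_set:
  assumes "ts_qform UNIV Q" shows "fd (value_set Q)"
  using adapted_basis_exists[OF assms] adapted_basis_counts(3)[OF assms] by blast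

lemma spread_equivalent_value_sets:
  assumes "ts_qform UNIV P" "ts_qform UNIV Q" "weakly_Vishik_equivalent P Q"
  shows "spread_equivalent (value_set P) (value_set Q)"
  unfolding spread_equivalent_def
proof (intro conjI allI subspace_value_set fd_value_set assms(1,2))
  fix a
  have "qdim P = qdim Q"
    "defect (adjoin_sqrt a) (base_change (adjoin_sqrt a) P) = defect (adjoin_sqrt a) (base_change (adjoin_sqrt a) Q)"
    using assms(3) unfolding weakly_Vishik_equivalent_def by blast+
  then show "sq.dim (spread a (value_set P)) = sq.dim (spread a (value_set Q))"
    using defect_quadratic_extension[OF assms(1), of a] defect_quadratic_extension[OF assms(2), of a] by simp
qed

lemma isometric_value_set: "isometric UNIV P Q \<Longrightarrow> value_set P = value_set Q"
  unfolding isometric_def value_set_def bij_betw_def by (metis (no_types, lifting) image_cong image_image)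

lemma scaled_simps [simp]:
  "qspace (scaled c Q) = qspace Q" "qscale (scaled c Q) = qscale Q" "qval (scaled c Q) v = c * qval Q v"
  by (simp_all add: scaled_def)

lemma value_set_scaled: "value_set (scaled c Q) = (*) c ` value_set Q"
  unfolding value_set_def by (simp add: image_image)

lemma qdim_scaled: "qdim (scaled c Q) = qdim Q"
  by (simp add: qdim_def)

lemma ts_qform_scaled:
  assumes "ts_qform UNIV Q" shows "ts_qform UNIV (scaled c Q)"
  unfolding ts_qform_def scaled_simps
  using ts_qformD[OF assms] by (simp add: distrib_left mult.left_commute)

lemma value_set_orth_sum:
  "value_set (orth_sum P (scaled b Q)) = twisted_sum (value_set P) b (value_set Q)"
  unfolding value_set_def twisted_sum_def orth_sum_def by (force simp: image_iff)

lemma subform_value_set: "subform UNIV P Q \<Longrightarrow> value_set P \<subseteq> value_set Q"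
  unfolding subform_def linear_over_def value_set_def by (auto simp: image_subset_iff)

text \<open>
  A subform cannot have more independent vectors of value zero than the whole form.
\<close>

lemma subform_codim:
  fixes P :: "('a, 'v::ab_group_add) qform" and Q :: "('a, 'w::ab_group_add) qform"
  assumes P: "ts_qform UNIV P" and Q: "ts_qform UNIV Q" and sub: "subform UNIV P Q"
  shows "sq.dim (value_set Q) + qdim P \<le> sq.dim (value_set P) + qdim Q"
proof -
  interpret V: vector_space "qscale P" by (rule ts_qformD(2)[OF P])
  interpret W: vector_space "qscale Q" by (rule ts_qformD(2)[OF Q])
  obtain f where f: "linear_over UNIV P Q f" "inj_on f (qspace P)" "\<forall>v\<in>qspace P. qval P v = qval Q (f v)"
    using sub unfolding subform_def by blast
  obtain B1 B0 where B: "adapted_basis UNIV P B1 B0" using adapted_basis_exists[OF P] by blast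
  obtain C1 C0 where C: "adapted_basis UNIV Q C1 C0" using adapted_basis_exists[OF Q] by blast
  note DB = adapted_basisD[OF B] and DC = adapted_basisD[OF C]
  have f0: "f 0 = 0" by (rule linear_over_0[OF f(1) ts_qformD(3)[OF P]])
  have inj0: "inj_on f B0" using f(2) DB(4) by (rule inj_on_subset)
  have "W.independent (f ` B0)"
  proof (rule W.independent_if_scalars_zero)
    show "finite (f ` B0)" using DB(2) by simp
    fix g x assume g: "(\<Sum>x\<in>f ` B0. qscale Q (g x) x) = 0" and x: "x \<in> f ` B0"
    have "(\<Sum>x\<in>f ` B0. qscale Q (g x) x) = (\<Sum>b\<in>B0. qscale Q (g (f b)) (f b))"
      by (rule sum.reindex_cong[OF inj0]) simp_all
    also have "\<dots> = f (\<Sum>b\<in>B0. qscale P (g (f b)) b)"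
      by (rule linear_over_sum[OF P f(1) DB(2), symmetric]) (use DB(4) in auto)
    finally have "f (\<Sum>b\<in>B0. qscale P (g (f b)) b) = f 0" using g f0 by simp
    moreover have "(\<Sum>b\<in>B0. qscale P (g (f b)) b) \<in> qspace P"
      using ts_qform_sum[OF P DB(2), of "\<lambda>b. g (f b)" "\<lambda>b. b"] DB(4) by auto
    ultimately have "(\<Sum>b\<in>B0. qscale P (g (f b)) b) = 0"
      using inj_onD[OF f(2)] ts_qformD(3)[OF P] by blast
    then have "\<forall>b\<in>B0. g (f b) = 0" using DB(9)[of "\<lambda>b. g (f b)"] by simp
    then show "g x = 0" using x by blast
  qed
  moreover have "f ` B0 \<subseteq> {v \<in> qspace Q. qval Q v = 0}"
  proof (rule image_subsetI)
    fix b assume b: "b \<in> B0"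
    then have "b \<in> qspace P" "qval P b = 0" using DB(4,7) by auto
    then show "f b \<in> {v \<in> qspace Q. qval Q v = 0}" using f(1,3) unfolding linear_over_def by auto
  qed
  moreover have "fin_dim (qscale Q) {v \<in> qspace Q. qval Q v = 0}"
  proof -
    have "{v \<in> qspace Q. qval Q v = 0} \<subseteq> W.span C0"
      unfolding isotropic_vectors_eq[OF Q C]
      by (rule K_span_minimal[OF DC(2) W.span_superset W.span_zero W.span_add W.span_scale])
    then show ?thesis unfolding fin_dim_def using DC(2) by blast
  qed
  ultimately have "card (f ` B0) \<le> card C0"
    using W.fin_dim_independent(2)[of "{v \<in> qspace Q. qval Q v = 0}" "f ` B0"] adapted_basis_counts(4)[OF Q C] by simp
  then have "card B0 \<le> card C0" using card_image[OF inj0] by simp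
  then show ?thesis using adapted_basis_counts[OF P B] adapted_basis_counts[OF Q C] by simp
qed

text \<open>
  The vectors in the part \<open>B1\<close> of an adapted basis of \<open>P\<close> are sent to vectors of \<open>Q\<close> with the same values, and the
  basis \<open>B0\<close> of the vectors of value zero to the corresponding basis for \<open>Q\<close>.  The resulting linear map preserves values,
  so its kernel consists of vectors of value zero, on which it is injective.
\<close>

theorem isometric_if_value_set_eq:
  fixes P :: "('a, 'v::ab_group_add) qform" and Q :: "('a, 'w::ab_group_add) qform"
  assumes P: "ts_qform UNIV P" and Q: "ts_qform UNIV Q"
    and val: "value_set P = value_set Q" and dim: "qdim P = qdim Q"
  shows "isometric UNIV P Q"
proof -
  interpret V: vector_space "qscale P" by (rule ts_qformD(2)[OF P])
  interpret W: vector_space "qscale Q" by (rule ts_qformD(2)[OF Q])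
  interpret VW: vector_space_pair "qscale P" "qscale Q" by unfold_locales
  obtain B1 B0 where B: "adapted_basis UNIV P B1 B0" using adapted_basis_exists[OF P] by blast
  obtain C1 C0 where C: "adapted_basis UNIV Q C1 C0" using adapted_basis_exists[OF Q] by blast
  note DB = adapted_basisD[OF B] and DC = adapted_basisD[OF C]
  note nB = adapted_basis_counts[OF P B] and nC = adapted_basis_counts[OF Q C]
  have "card B0 = card C0" using nB(1,2) nC(1,2) val dim by simp
  then obtain \<beta> where \<beta>: "bij_betw \<beta> B0 C0" using finite_same_card_bij[OF DB(2) DC(2)] by blast
  have "\<forall>b\<in>B1. \<exists>w. w \<in> qspace Q \<and> qval Q w = qval P b"
  proof
    fix b assume "b \<in> B1"
    then have "qval P b \<in> value_set P" using DB(3) unfolding value_set_def by blast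
    then have "qval P b \<in> value_set Q" using val by simp
    then show "\<exists>w. w \<in> qspace Q \<and> qval Q w = qval P b" unfolding value_set_def by (metis imageE)
  qed
  then obtain \<gamma> where \<gamma>: "\<forall>b\<in>B1. \<gamma> b \<in> qspace Q \<and> qval Q (\<gamma> b) = qval P b" by metis
  define g where "g b = (if b \<in> B1 then \<gamma> b else \<beta> b)" for b
  have g1: "g b \<in> qspace Q" "qval Q (g b) = qval P b" if "b \<in> B1 \<union> B0" for b
  proof -
    have "\<beta> b \<in> C0" if "b \<in> B0" using \<beta> that bij_betwE by blast
    then show "g b \<in> qspace Q" "qval Q (g b) = qval P b"
      using that \<gamma> DC(4,7) DB(7) DB(5) unfolding g_def by auto
  qed
  have ind: "V.independent (B1 \<union> B0)"
    by (rule V.independent_if_scalars_zero)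
      (use DB(1,2) adapted_basis_independent[OF P B] in auto)
  define f where "f = VW.construct (B1 \<union> B0) g"
  have flin: "Vector_Spaces.linear (qscale P) (qscale Q) f"
    unfolding f_def by (rule VW.linear_construct[OF ind])
  interpret f: Vector_Spaces.linear "qscale P" "qscale Q" f by (rule flin)
  have fb: "f b = g b" if "b \<in> B1 \<union> B0" for b
    unfolding f_def by (rule VW.construct_basis[OF ind that])
  have fin: "finite (B1 \<union> B0)" using DB(1,2) by simp
  have fsum: "f (\<Sum>b\<in>B1 \<union> B0. qscale P (c b) b) = (\<Sum>b\<in>B1 \<union> B0. qscale Q (c b) (g b))" for c
    unfolding f.sum by (rule sum.cong) (simp_all add: f.scale fb)
  have key: "f v \<in> qspace Q \<and> qval Q (f v) = qval P v" if v: "v \<in> qspace P" for v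
  proof -
    obtain c where c: "v = (\<Sum>b\<in>B1 \<union> B0. qscale P (c b) b)"
      using v unfolding DB(6) K_span_def by (rule sum_space_E)
    have "f v \<in> qspace Q \<and> qval Q (f v) = (\<Sum>b\<in>B1 \<union> B0. (c b)\<^sup>2 * qval Q (g b))"
      unfolding c fsum by (rule ts_qform_sum[OF Q fin]) (use g1 in simp)
    moreover have "(\<Sum>b\<in>B1 \<union> B0. (c b)\<^sup>2 * qval Q (g b)) = (\<Sum>b\<in>B1 \<union> B0. (c b)\<^sup>2 * qval P b)"
      by (rule sum.cong) (simp_all add: g1)
    moreover have "qval P v = (\<Sum>b\<in>B1 \<union> B0. (c b)\<^sup>2 * qval P b)"
      using ts_qform_sum[OF P fin, of c "\<lambda>b. b"] DB(3,4) unfolding c by auto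
    ultimately show ?thesis by simp
  qed
  have subP: "V.subspace (qspace P)" unfolding V.subspace_def using ts_qformD(3,4,5)[OF P] by simp
  have subQ: "W.subspace (qspace Q)" unfolding W.subspace_def using ts_qformD(3,4,5)[OF Q] by simp
  have inj: "inj_on f (qspace P)"
    unfolding f.inj_on_iff_eq_0[OF subP]
  proof (intro ballI impI)
    fix v assume v: "v \<in> qspace P" "f v = 0"
    have "qval P v = 0" using key[OF v(1)] v(2) ts_qform_0[OF Q] by simp
    then have "v \<in> K_span P UNIV B0" using isotropic_vectors_eq[OF P B] v(1) by blast
    then obtain c where c: "v = (\<Sum>b\<in>B0. qscale P (c b) b)"
      unfolding K_span_def by (rule sum_space_E)
    have gB0: "g b = \<beta> b" if "b \<in> B0" for b using DB(5) that unfolding g_def by auto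
    have "f v = (\<Sum>b\<in>B0. qscale Q (c b) (\<beta> b))"
      unfolding c f.sum by (rule sum.cong) (simp_all add: f.scale fb gB0)
    define d where "d u = c (inv_into B0 \<beta> u)" for u
    have d: "d (\<beta> b) = c b" if "b \<in> B0" for b
      unfolding d_def using bij_betw_inv_into_left[OF \<beta> that] by simp
    have "(\<Sum>u\<in>C0. qscale Q (d u) u) = (\<Sum>b\<in>B0. qscale Q (d (\<beta> b)) (\<beta> b))"
      by (rule sum.reindex_bij_betw[OF \<beta>, symmetric])
    also have "\<dots> = (\<Sum>b\<in>B0. qscale Q (c b) (\<beta> b))" by (rule sum.cong) (simp_all add: d)
    finally have "(\<Sum>u\<in>C0. qscale Q (d u) u) = 0"
      using \<open>f v = (\<Sum>b\<in>B0. qscale Q (c b) (\<beta> b))\<close> v(2) by simp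
    then have "\<forall>u\<in>C0. d u = 0" using DC(9)[of d] by simp
    then have "c b = 0" if "b \<in> B0" for b using d[OF that] bij_betwE[OF \<beta>] that by metis
    then show "v = 0" unfolding c by simp
  qed
  have finQ: "fin_dim (qscale Q) (qspace Q)"
  proof -
    have "qspace Q \<subseteq> W.span (C1 \<union> C0)"
      unfolding DC(6)
      by (rule K_span_minimal[OF _ W.span_superset W.span_zero W.span_add W.span_scale]) (use DC(1,2) in simp)
    then show ?thesis unfolding fin_dim_def using DC(1,2) by blast
  qed
  have "f ` qspace P \<subseteq> qspace Q" using key by blast
  moreover have "W.dim (f ` qspace P) = W.dim (qspace Q)"
    using f.dim_inj_image[OF inj subP] dim unfolding qdim_def by simp
  ultimately have img: "f ` qspace P = qspace Q"
    using W.fin_dim_subspace_eq[OF finQ f.subspace_image[OF subP] subQ] by simp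
  have "linear_over UNIV P Q f"
    unfolding linear_over_def using img by (simp add: f.add f.scale)
  moreover have "bij_betw f (qspace P) (qspace Q)" unfolding bij_betw_def using inj img by simp
  ultimately show ?thesis unfolding isometric_def using key by (intro exI[of _ f]) simp
qed

lemma ts_qform_diag: "ts_qform UNIV (diag UNIV (as :: 'a list))"
proof -
  define u :: "nat \<Rightarrow> nat \<Rightarrow> 'a" where "u i = (\<lambda>j. if j = i then 1 else 0)" for i
  let ?n = "length as"
  have vs: "vector_space (\<lambda>(a::'a) x (i::nat). a * x i)"
    by unfold_locales (simp_all add: fun_eq_iff algebra_simps)
  have inj: "inj_on u {..<?n}" by (rule inj_onI) (metis u_def zero_neq_one)
  have span: "\<exists>c. v = (\<Sum>b\<in>u ` {..<?n}. (\<lambda>i. c b * b i))" if v: "\<forall>i\<ge>?n. v i = 0" for v :: "nat \<Rightarrow> 'a"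
  proof -
    define c where "c b = v (inv_into {..<?n} u b)" for b
    have "(\<Sum>b\<in>u ` {..<?n}. (\<lambda>i. c b * b i)) = (\<Sum>j<?n. (\<lambda>i. c (u j) * u j i))"
      by (rule sum.reindex_cong[OF inj]) simp_all
    also have "\<dots> = (\<Sum>j<?n. (\<lambda>i. v j * u j i))"
      by (rule sum.cong) (simp_all add: c_def inv_into_f_f[OF inj])
    also have "\<dots> = (\<Sum>j<?n. (\<lambda>i. if i = j then v j else 0))"
      by (rule sum.cong) (auto simp: u_def fun_eq_iff)
    also have "\<dots> = v" using v by (auto simp: fun_eq_iff sum_fun_eval)
    finally show ?thesis by metis
  qed
  have "\<exists>B. finite B \<and> B \<subseteq> qspace (diag UNIV as) \<and>
      (\<forall>v\<in>qspace (diag UNIV as). \<exists>c. (\<forall>b\<in>B. c b \<in> UNIV) \<and> v = (\<Sum>b\<in>B. qscale (diag UNIV as) (c b) b))"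
    by (rule exI[of _ "u ` {..<?n}"]) (use span in \<open>auto simp: diag_def u_def\<close>)
  then show ?thesis
    unfolding ts_qform_def using vs subfield_UNIV
    by (simp add: diag_def sq_add distrib_left sum.distrib power_mult_distrib sum_distrib_left mult.left_commute)
qed

lemma value_set_diag: "value_set (diag UNIV (as :: 'a list)) = sq.span (set as)"
proof
  show "value_set (diag UNIV as) \<subseteq> sq.span (set as)"
  proof
    fix y assume "y \<in> value_set (diag UNIV as)"
    then obtain x where "y = (\<Sum>i<length as. as ! i * (x i)\<^sup>2)" by (auto simp: value_set_def diag_def)
    then have "y = (\<Sum>i<length as. sq_scale (x i) (as ! i))" by (simp add: sq_scale_def mult.commute)
    moreover have "(\<Sum>i<length as. sq_scale (x i) (as ! i)) \<in> sq.span (set as)"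
      by (intro sq.span_sum sq.span_scale sq.span_base) simp
    ultimately show "y \<in> sq.span (set as)" by simp
  qed
  show "sq.span (set as) \<subseteq> value_set (diag UNIV as)"
  proof (rule sq.span_minimal[OF _ subspace_value_set[OF ts_qform_diag]], rule subsetI)
    fix a assume "a \<in> set as"
    then obtain j where j: "j < length as" "a = as ! j" by (metis in_set_conv_nth)
    define u :: "nat \<Rightarrow> 'a" where "u i = (if i = j then 1 else 0)" for i
    have "(\<Sum>i<length as. as ! i * (u i)\<^sup>2) = (\<Sum>i<length as. if i = j then as ! i else 0)"
      by (rule sum.cong) (simp_all add: u_def)
    then have "a = qval (diag UNIV as) u" using j by (simp add: diag_def)
    moreover have "u \<in> qspace (diag UNIV as)" using j(1) by (simp add: diag_def u_def)
    ultimately show "a \<in> value_set (diag UNIV as)" unfolding value_set_def by blast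
  qed
qed

text \<open>
  Tensoring with \<open>\<langle>1, a\<rangle>\<close> replaces a value set \<open>D\<close> by \<open>D + a D\<close>.
\<close>

lemma value_set_pfister_form: "value_set (pfister_form as) = sq_adjoin (as :: 'a list)"
  unfolding pfister_form_def value_set_diag
proof (induction as)
  case Nil
  then show ?case by (simp add: squares_eq_span)
next
  case (Cons a as)
  have "set (pfister_coeffs (a # as)) = set (pfister_coeffs as) \<union> (*) a ` set (pfister_coeffs as)"
    by (simp add: tensor_coeffs_def)
  moreover have "sq.span ((*) a ` set (pfister_coeffs as)) = (*) a ` sq.span (set (pfister_coeffs as))"
    using Vector_Spaces.linear.axioms(3)[OF linear_mult] module_hom.span_image by blast
  ultimately have "sq.span (set (pfister_coeffs (a # as))) = spread a (sq.span (set (pfister_coeffs as)))"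
    unfolding spread_sums by (simp only: sq.span_Un)
  then show ?case using Cons by simp
qed

lemma quasi_Pfister_value_set:
  fixes Q :: "('a, 'v::ab_group_add) qform"
  assumes "quasi_Pfister Q" obtains as where "value_set Q = sq_adjoin as"
proof -
  obtain as where "isometric UNIV Q (pfister_form as)" using assms unfolding quasi_Pfister_def by blast
  then have "value_set Q = sq_adjoin as" using isometric_value_set value_set_pfister_form by metis
  then show ?thesis by (rule that)
qed

text \<open>
  Connects the action through squares with the dimension over the subfield of squares that defines the norm degree.
\<close>

lemma dimension_over_squares:
  assumes "finite B" "sq.independent B"
  shows "ring.dimension ring_of_type_algebra (card B) squares (sq.span B)"
  using assms
proof (induction B rule: finite_induct)
  interpret R: Ring.field "ring_of_type_algebra :: 'a ring" by (rule field_from_type_algebra)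
  case empty
  then show ?case using R.zero_dim[of squares] by simp
next
  interpret R: Ring.field "ring_of_type_algebra :: 'a ring" by (rule field_from_type_algebra)
  case (insert b B)
  have ind: "sq.independent B" using insert.prems by (rule sq.independent_mono) blast
  have nb: "b \<notin> sq.span B"
    using insert.prems insert.hyps(2) unfolding sq.dependent_def by (metis Diff_insert_absorb insertI1)
  have "R.line_extension squares b (sq.span B) = sq.span (insert b B)"
  proof (rule Set.set_eqI)
    fix x
    have "x \<in> sq.span (insert b B) \<longleftrightarrow> (\<exists>k. x - sq_scale k b \<in> sq.span B)" by (rule sq.span_breakdown_eq)
    also have "\<dots> \<longleftrightarrow> (\<exists>k\<in>squares. \<exists>v\<in>sq.span B. x = k * b + v)"
    proof
      assume "\<exists>k. x - sq_scale k b \<in> sq.span B"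
      then obtain k where k: "x - sq_scale k b \<in> sq.span B" by blast
      then show "\<exists>k\<in>squares. \<exists>v\<in>sq.span B. x = k * b + v"
        by (intro bexI[of _ "k\<^sup>2"] bexI[of _ "x - sq_scale k b"]) (simp_all add: sq_scale_def)
    next
      assume "\<exists>k\<in>squares. \<exists>v\<in>sq.span B. x = k * b + v"
      then obtain k v where kv: "k \<in> squares" "v \<in> sq.span B" "x = k * b + v" by blast
      then obtain l where "k = l\<^sup>2" unfolding squares_def by blast
      then show "\<exists>k. x - sq_scale k b \<in> sq.span B" using kv by (intro exI[of _ l]) (simp add: sq_scale_def)
    qed
    finally show "x \<in> R.line_extension squares b (sq.span B) \<longleftrightarrow> x \<in> sq.span (insert b B)"
      unfolding R.line_extension_mem_iff by simp
  qed
  then show ?case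
    using R.Suc_dim[OF _ nb insert.IH[OF ind]] insert.hyps by simp
qed

lemma subfield_sq_ring: "sq_ring R \<Longrightarrow> subfield (R :: 'a set) ring_of_type_algebra"
  by (rule subfieldI_type) (auto intro: sq_ring_1 sq_ring_add sq_ring_mult sq_ring_inverse)

lemma ring_dim_squares:
  assumes "sq.subspace N" "fd N"
  shows "ring.dim ring_of_type_algebra squares N = sq.dim N"
proof -
  interpret R: Ring.field "ring_of_type_algebra :: 'a ring" by (rule field_from_type_algebra)
  obtain B where B: "finite B" "sq.independent B" "B \<subseteq> N" "sq.span B = N" "card B = sq.dim N"
    by (rule sq.fin_dim_basis[OF assms])
  show ?thesis
    using R.dimI[OF subfield_sq_ring[OF sq_ring_squares] dimension_over_squares[OF B(1,2)]] B(4,5)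
    by (simp add: over_def)
qed

text \<open>
  If the value set is contained in \<open>p F\<^sup>2(g\<^sub>1, \<dots>, g\<^sub>n)\<close>, then the norm field is contained in
  \<open>F\<^sup>2(g\<^sub>1, \<dots>, g\<^sub>n)\<close>, so the norm degree is at most \<open>2\<^sup>n\<close>.
\<close>

lemma minimal_form_value_set:
  assumes Q: "ts_qform UNIV Q" and min: "minimal_form Q"
  shows "minimal_space (value_set Q)"
proof -
  interpret R: Ring.field "ring_of_type_algebra :: 'a ring" by (rule field_from_type_algebra)
  have m: "anisotropic Q" "qdim Q \<ge> 1" "ndeg Q = 2 ^ (qdim Q - 1)" using min unfolding minimal_form_def by auto
  obtain B1 B0 where B: "adapted_basis UNIV Q B1 B0" using adapted_basis_exists[OF Q] by blast
  note D = adapted_basisD[OF B] and n = adapted_basis_counts[OF Q B]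
  interpret V: vector_space "qscale Q" by (rule ts_qformD(2)[OF Q])
  have "B0 = {}"
  proof (rule ccontr)
    assume "B0 \<noteq> {}"
    then obtain b where b: "b \<in> B0" by blast
    have "b = 0" using m(1) b D(4,7) unfolding anisotropic_def by auto
    then have "(\<Sum>x\<in>B0. qscale Q (if x = b then 1 else 0) x) = 0" by (intro sum.neutral) auto
    then have "(if b = b then 1 else 0 :: 'a) = 0" using D(9)[of "\<lambda>x. if x = b then 1 else 0"] b by blast
    then show False by simp
  qed
  then have dim: "sq.dim (value_set Q) = qdim Q" using n(1,2) by simp
  show ?thesis
    unfolding minimal_space_def
  proof (intro conjI allI impI)
    show "sq.subspace (value_set Q)" by (rule subspace_value_set[OF Q])
    show "fd (value_set Q)" by (rule fd_value_set[OF Q])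
    show "sq.dim (value_set Q) > 0" using dim m(2) by simp
    fix p gs assume p: "p \<noteq> 0" and sub: "value_set Q \<subseteq> (*) p ` sq_adjoin gs"
    have quot: "x / y \<in> sq_adjoin gs" if "x \<in> nonzero_values Q" "y \<in> nonzero_values Q" for x y
    proof -
      have "x / p \<in> sq_adjoin gs" "y / p \<in> sq_adjoin gs"
        using sub that in_mult_image_iff[OF p] unfolding nonzero_values_def value_set_def by blast+
      then have "(x / p) / (y / p) \<in> sq_adjoin gs" by (rule sq_ring_divide[OF sq_ring_adjoin])
      then show ?thesis using p by simp
    qed
    define N where "N = norm_field Q"
    let ?G = "squares \<union> {x / y | x y. x \<in> nonzero_values Q \<and> y \<in> nonzero_values Q}"
    have "N \<subseteq> sq_adjoin gs" unfolding N_def norm_field_def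
    proof (rule R.generate_field_min_subfield1[OF _ subfield_sq_ring[OF sq_ring_adjoin]])
      show "?G \<subseteq> sq_adjoin gs" using quot sq_ring_adjoin[of gs] unfolding sq_ring_def by blast
    qed simp
    have subN: "subfield N ring_of_type_algebra"
      unfolding N_def norm_field_def by (rule R.generate_field_is_subfield) simp
    have "squares \<subseteq> N" unfolding N_def norm_field_def by (auto intro: generate_field.incl)
    then have "sq_ring N" unfolding sq_ring_def using subfield_closed(3,4)[OF subN] by blast
    then have sN: "sq.subspace N" by (rule subspace_sq_ring)
    have fN: "fd N" by (rule sq.fin_dim_mono[OF fd_adjoin \<open>N \<subseteq> sq_adjoin gs\<close>])
    have "2 ^ (qdim Q - 1) = sq.dim N"
      using m(3) ring_dim_squares[OF sN fN] unfolding ndeg_def N_def by simp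
    also have "\<dots> \<le> sq.dim (sq_adjoin gs)" by (rule sq.fin_dim_dim_mono[OF fd_adjoin \<open>N \<subseteq> sq_adjoin gs\<close>])
    also have "\<dots> \<le> 2 ^ length gs" by (rule dim_adjoin_le)
    finally have "qdim Q - 1 \<le> length gs" by simp
    then show "sq.dim (value_set Q) \<le> length gs + 1" using dim by simp
  qed
qed

text \<open>
  A neighbor of codimension one has its value set in a multiple of a field, with codimension at most one by
  \<open>subform_codim\<close>; the codimension can drop to zero if the forms are isotropic.
\<close>

lemma rigid_value_set:
  assumes \<sigma>: "ts_qform UNIV \<sigma>"
    and shape: "quasi_Pfister \<sigma> \<or> quasi_Pfister_neighbor_codim 1 \<sigma> \<or> minimal_form \<sigma>"
  shows "rigid (value_set \<sigma>)"
  using shape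
proof (elim disjE)
  assume "quasi_Pfister \<sigma>"
  then obtain as where as: "value_set \<sigma> = sq_adjoin as" by (rule quasi_Pfister_value_set)
  show ?thesis unfolding as
    by (rule rigid_codim_le_one[OF sq_ring_adjoin[of as] fd_adjoin subspace_adjoin, where c = 1]) simp_all
next
  assume "quasi_Pfister_neighbor_codim 1 \<sigma>"
  then obtain as where as: "quasi_Pfister_neighbor_of \<sigma> (pfister_form as)" "qdim (pfister_form as) = qdim \<sigma> + 1"
    unfolding quasi_Pfister_neighbor_codim_def by blast
  then obtain c where c: "c \<noteq> 0" "subform UNIV (scaled c \<sigma>) (pfister_form as)"
    unfolding quasi_Pfister_neighbor_of_def by blast
  have "(*) c ` value_set \<sigma> \<subseteq> sq_adjoin as"
    using subform_value_set[OF c(2)] unfolding value_set_scaled value_set_pfister_form .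
  then have "(*) (inverse c) ` (*) c ` value_set \<sigma> \<subseteq> (*) (inverse c) ` sq_adjoin as" by (rule image_mono)
  then have sub: "value_set \<sigma> \<subseteq> (*) (inverse c) ` sq_adjoin as" using c(1) unfolding mult_image_image by simp
  have "sq.dim (value_set (pfister_form as)) + qdim (scaled c \<sigma>) \<le> sq.dim (value_set (scaled c \<sigma>)) + qdim (pfister_form as)"
    using subform_codim[OF ts_qform_scaled[OF \<sigma>] _ c(2)] ts_qform_diag unfolding pfister_form_def by blast
  then have "sq.dim (sq_adjoin as) \<le> sq.dim (value_set \<sigma>) + 1"
    using as(2) dim_mult[OF subspace_value_set[OF \<sigma>] c(1)]
    unfolding value_set_pfister_form value_set_scaled qdim_scaled by simp
  then show ?thesis
    using rigid_codim_le_one[OF sq_ring_adjoin[of as] fd_adjoin subspace_value_set[OF \<sigma>] sub] c(1) by simp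
next
  assume "minimal_form \<sigma>"
  then show ?thesis by (intro rigid_minimal_space minimal_form_value_set[OF \<sigma>])
qed

end

section \<open>Similarity of weakly Vishik equivalent forms\<close>

theorem theorem4p17:
  fixes \<phi> :: "('a::field, 'v::ab_group_add) qform"
    and \<psi> :: "('a, 'w::ab_group_add) qform"
    and \<pi> :: "('a, 'p::ab_group_add) qform"
    and \<sigma> :: "('a, 's::ab_group_add) qform"
    and b c :: 'a
  assumes "CHAR('a) = 2"
    and "ts_qform UNIV \<phi>" and "ts_qform UNIV \<psi>"
    and "ts_qform UNIV \<pi>" and "ts_qform UNIV \<sigma>"
    and "weakly_Vishik_equivalent \<phi> \<psi>"
    and "special_quasi_Pfister_neighbor \<phi> \<pi> b \<sigma>"
    and "c \<noteq> 0" and "subform UNIV (scaled c \<pi>) \<psi>"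
    and "quasi_Pfister \<sigma> \<or> quasi_Pfister_neighbor_codim 1 \<sigma> \<or> minimal_form \<sigma>"
  shows "similar UNIV \<phi> \<psi>"
proof -
  interpret char_two "TYPE('a)" by unfold_locales (rule assms(1))
  define S W where "S = value_set \<sigma>" and "W = value_set \<psi>"
  have sp: "quasi_Pfister \<pi>" "subform UNIV \<sigma> \<pi>" "similar UNIV \<phi> (orth_sum \<pi> (scaled b \<sigma>))"
    using assms(7) unfolding special_quasi_Pfister_neighbor_def by auto
  obtain as where P: "value_set \<pi> = sq_adjoin as" using sp(1) by (rule quasi_Pfister_value_set)
  obtain s where s: "s \<noteq> 0" "isometric UNIV \<phi> (scaled s (orth_sum \<pi> (scaled b \<sigma>)))"
    using sp(3) unfolding similar_def by blast
  define U where "U = twisted_sum (sq_adjoin as) b S"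
  have phi: "value_set \<phi> = (*) s ` U"
    using isometric_value_set[OF s(2)] unfolding value_set_scaled value_set_orth_sum P U_def S_def .
  have "spread_equivalent ((*) s ` U) W"
    using spread_equivalent_value_sets[OF assms(2,3,6)] unfolding phi W_def .
  then have "spread_equivalent ((*) (inverse s) ` (*) s ` U) W"
    by (rule spread_equivalent_mult) (use s(1) in simp)
  then have "spread_equivalent U W" using s(1) unfolding mult_image_image by simp
  then have "spread_equivalent W U" by (rule spread_equivalent_sym)
  then have "spread_equivalent ((*) (inverse c) ` W) U"
    by (rule spread_equivalent_mult) (use assms(8) in simp)
  then have eqv: "spread_equivalent U ((*) (inverse c) ` W)" by (rule spread_equivalent_sym)
  have "(*) c ` sq_adjoin as \<subseteq> W"
    using subform_value_set[OF assms(9)] unfolding value_set_scaled P W_def .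
  then have "(*) (inverse c) ` (*) c ` sq_adjoin as \<subseteq> (*) (inverse c) ` W" by (rule image_mono)
  then have PW: "sq_adjoin as \<subseteq> (*) (inverse c) ` W" using assms(8) unfolding mult_image_image by simp
  have "S \<subseteq> sq_adjoin as" using subform_value_set[OF sp(2)] unfolding P S_def .
  then obtain t where t: "t \<noteq> 0" "(*) (inverse c) ` W = (*) t ` U"
    using twisted_sum_similar[OF sq_ring_adjoin fd_adjoin _ _ _ eqv[unfolded U_def] PW]
      subspace_value_set[OF assms(5)] rigid_value_set[OF assms(5,10)]
    unfolding U_def S_def by blast
  \<comment> \<open>\<open>W / c = t U\<close> and the value set of \<open>\<phi>\<close> is \<open>s U\<close>.\<close>
  define d where "d = s / (t * c)"
  have d: "d \<noteq> 0" using s(1) t(1) assms(8) unfolding d_def by simp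
  have "value_set (scaled d \<psi>) = (*) (s / t) ` (*) (inverse c) ` W"
    unfolding value_set_scaled W_def[symmetric] mult_image_image d_def by (simp add: field_simps)
  also have "\<dots> = value_set \<phi>" unfolding t(2) phi mult_image_image using t(1) by simp
  finally have "value_set \<phi> = value_set (scaled d \<psi>)" by simp
  moreover have "qdim \<phi> = qdim (scaled d \<psi>)"
    using assms(6) unfolding weakly_Vishik_equivalent_def qdim_scaled by blast
  ultimately have "isometric UNIV \<phi> (scaled d \<psi>)"
    by (rule isometric_if_value_set_eq[OF assms(2) ts_qform_scaled[OF assms(3)]])
  then show ?thesis unfolding similar_def using d by blast
qed

end
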